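(* Let $n\ge3$ and let $L=L_0\oplus L_1$ be a non-nilpotent solvable Leibniz superalgebra whose nilradical is isomorphic to the superalgebra $H(0,\dots,0)$ defined in the context. Then $L$ is isomorphic to one of the following pairwise non-isomorphic superalgebras $MH_1$, $MH_2$, $H_1(b)$, $H_2(b)$, $H_3$, $H_4$, $H_5(\gamma)$. Each of them has odd basis $y_1,\dots,y_n$ and even basis $e_1,\dots,e_n,x_1,x_2$ (for $MH_1,MH_2$) or $e_1,\dots,e_n,x$ (for the others), and has the products $$(P)\quad\begin{aligned} &[e_1,e_1]=e_3,\quad [e_i,e_1]=e_{i+1}\ (3\le i\le n-1),\quad [y_j,e_1]=y_{j+1}\ (1\le j\le n-1),\\ &[y_1,y_1]=e_1,\quad [y_j,y_1]=e_{j+1}\ (2\le j\le n-1),\quad [e_1,y_1]=\tfrac12y_2,\quad [e_i,y_1]=\tfrac12y_i\ (3\le i\le n), \end{aligned}$$ together with the following ones (omitted products of basis elements are zero): $MH_1$: $[y_i,x_1]=(2i-1)y_i$ $(1\le i\le n)$, $[e_1,x_1]=2e_1$, $[e_i,x_1]=2(i-1)e_i$ $(3\le i\le n)$, $[x_1,e_1]=-2e_1$, $[x_1,y_1]=-y_1$, $[e_2,x_2]=e_2$. $MH_2$: $[y_i,x_1]=(2i-1)y_i$ $(1\le i\le n)$, $[e_1,x_1]=2e_1$, $[e_i,x_1]=2(i-1)e_i$ $(3\le i\le n)$, $[x_1,e_1]=-2e_1$, $[x_1,y_1]=-y_1$, $[e_2,x_2]=e_2$, $[x_2,e_2]=-e_2$.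 $H_1(b)$, $b\in\mathbb C$, $b\ne0$: $[y_i,x]=(2i-1)y_i$ $(1\le i\le n)$, $[e_1,x]=2e_1$, $[e_2,x]=be_2$, $[e_i,x]=2(i-1)e_i$ $(3\le i\le n)$, $[x,e_1]=-2e_1$, $[x,e_2]=-be_2$, $[x,y_1]=-y_1$. $H_2(b)$, $b\in\mathbb C$: $[y_i,x]=(2i-1)y_i$ $(1\le i\le n)$, $[e_1,x]=2e_1$, $[e_2,x]=be_2$, $[e_i,x]=2(i-1)e_i$ $(3\le i\le n)$, $[x,e_1]=-2e_1$, $[x,y_1]=-y_1$. $H_3$: $[y_i,x]=(2i-1)y_i$ $(1\le i\le n)$, $[e_1,x]=2e_1$, $[e_i,x]=2(i-1)e_i$ $(3\le i\le n)$, $[x,e_1]=-2e_1$, $[x,y_1]=-y_1$, $[x,x]=e_2$. $H_4$ (depending on $a_2,\dots,a_n\in\mathbb C$): $[e_1,x]=\sum_{k=3}^{n}a_{k-1}e_k$, $[e_2,x]=e_2$, $[e_i,x]=\sum_{k=i+1}^{n}a_{k+1-i}e_k$ $(3\le i\le n)$, $[y_i,x]=\sum_{k=i+1}^{n}a_{k+1-i}y_k$ $(1\le i\le n-1)$. $H_5(\gamma)$, $\gamma\in\{0,1\}$ (depending on $a_2,\dots,a_n\in\mathbb C$): $[e_1,x]=\sum_{k=3}^{n}a_{k-1}e_k$, $[e_2,x]=e_2$, $[e_i,x]=\sum_{k=i+1}^{n}a_{k+1-i}e_k$ $(3\le i\le n)$, $[y_i,x]=\sum_{k=i+1}^{n}a_{k+1-i}y_k$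 $(1\le i\le n)$, $[x,e_2]=-e_2$, $[x,x]=\gamma e_2$. Moreover, the first non-vanishing parameter among $a_2,a_3,\dots,a_n$ in $H_4$ and $H_5(\gamma)$ can be scaled to $1$. (Accordingly, the non-isomorphism assertion concerns superalgebras with different names, displayed parameters $b,\gamma$ included, and not members of the family $H_4$, or of $H_5(\gamma)$ for one value of $\gamma$, with different $(a_2,\dots,a_n)$.)
   Context: All vector spaces are finite-dimensional over $\mathbb C$; isomorphisms preserve the $\mathbb Z_2$-grading; empty sums are zero. A Leibniz superalgebra is a $\mathbb Z_2$-graded vector space $L=L_0\oplus L_1$ with an even (grading-compatible) bilinear product $[-,-]$ such that $[x,[y,z]]=[[x,y],z]-(-1)^{\alpha\beta}[[x,z],y]$ for all $x\in L$, $y\in L_\alpha$, $z\in L_\beta$. Nilpotency and solvability are defined as for Leibniz algebras, via $L^1=L,\ L^{k+1}=[L^k,L]$ and $L^{[1]}=L,\ L^{[k+1]}=[L^{[k]},L^{[k]}]$ respectively. The nilradical of $L$ is the maximal nilpotent ideal $N$ of $L$ such that $[L,L]\subset N$. $H(0,\dots,0)$ is the nilpotent Leibniz superalgebra with even basis $e_1,\dots,e_n$, odd basis $y_1,\dots,y_n$ and products (omitted products are zero) $$\begin{aligned} &[e_1,e_1]=e_3,\quad [e_i,e_1]=e_{i+1}\ (3\le i\le n-1),\quad [y_j,e_1]=y_{j+1}\ (1\le j\le n-1),\\ &[e_1,y_1]=\tfrac12y_2,\quad [e_i,y_1]=\tfrac12y_i\ (3\le i\le n),\quad [y_1,y_1]=e_1,\quad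 [y_j,y_1]=e_{j+1}\ (2\le j\le n-1). \end{aligned}$$ *)

theory Defs
  imports Complex_Main "HOL-Library.Poly_Mapping"
begin

section \<open>Superalgebras\<close>

text \<open>A superalgebra lives on a subspace of an ambient complex vector space, so that ideals
  can be regarded as superalgebras without changing the type.\<close>

record 'a superalgebra =
  scale :: "complex \<Rightarrow> 'a \<Rightarrow> 'a"
  even_part :: "'a set"
  odd_part :: "'a set"
  bracket :: "'a \<Rightarrow> 'a \<Rightarrow> 'a"

text \<open>Degrees are natural numbers read modulo 2.\<close>

definition part :: "'a superalgebra \<Rightarrow> nat \<Rightarrow> 'a set" where
  "part L \<alpha> = (if even \<alpha> then even_part L else odd_part L)"

definition carrier :: "('a::ab_group_add) superalgebra \<Rightarrow> 'a set" where
  "carrier L = {u + v | u v. u \<in> even_part L \<and> v \<in> odd_part L}"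

definition superalgebra :: "('a::ab_group_add) superalgebra \<Rightarrow> bool" where
  "superalgebra L \<longleftrightarrow>
     vector_space (scale L) \<and>
     module.subspace (scale L) (even_part L) \<and>
     module.subspace (scale L) (odd_part L) \<and>
     even_part L \<inter> odd_part L = {0} \<and>
     (\<forall>\<alpha> \<beta>. \<forall>u \<in> part L \<alpha>. \<forall>v \<in> part L \<beta>. bracket L u v \<in> part L (\<alpha> + \<beta>)) \<and>
     (\<forall>u \<in> carrier L. \<forall>v \<in> carrier L. \<forall>w \<in> carrier L.
        bracket L (u + v) w = bracket L u w + bracket L v w \<and>
        bracket L w (u + v) = bracket L w u + bracket L w v) \<and>
     (\<forall>c. \<forall>u \<in> carrier L. \<forall>v \<in> carrier L.
        bracket L (scale L c u) v = scale L c (bracket L u v) \<and>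
        bracket L u (scale L c v) = scale L c (bracket L u v))"

definition leibniz_superalgebra :: "('a::ab_group_add) superalgebra \<Rightarrow> bool" where
  "leibniz_superalgebra L \<longleftrightarrow>
     superalgebra L \<and>
     (\<forall>\<alpha> \<beta>. \<forall>u \<in> carrier L. \<forall>v \<in> part L \<alpha>. \<forall>w \<in> part L \<beta>.
        bracket L u (bracket L v w) =
          bracket L (bracket L u v) w
            - scale L ((- 1) ^ (\<alpha> * \<beta>)) (bracket L (bracket L u w) v))"

definition finite_dimensional :: "('a::ab_group_add) superalgebra \<Rightarrow> bool" where
  "finite_dimensional L \<longleftrightarrow> (\<exists>B. finite B \<and> module.span (scale L) B = carrier L)"

definition bracket_span :: "('a::ab_group_add) superalgebra \<Rightarrow> 'a set \<Rightarrow> 'a set \<Rightarrow> 'a set" where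
  "bracket_span L A B = module.span (scale L) {bracket L u v | u v. u \<in> A \<and> v \<in> B}"

text \<open>Both series start at index 0 here: \<open>lower_central L k\<close> is $L^{k+1}$ and
  \<open>derived_series L k\<close> is $L^{[k+1]}$.\<close>

fun lower_central :: "('a::ab_group_add) superalgebra \<Rightarrow> nat \<Rightarrow> 'a set" where
  "lower_central L 0 = carrier L"
| "lower_central L (Suc k) = bracket_span L (lower_central L k) (carrier L)"

fun derived_series :: "('a::ab_group_add) superalgebra \<Rightarrow> nat \<Rightarrow> 'a set" where
  "derived_series L 0 = carrier L"
| "derived_series L (Suc k) = bracket_span L (derived_series L k) (derived_series L k)"

definition nilpotent :: "('a::ab_group_add) superalgebra \<Rightarrow> bool" where
  "nilpotent L \<longleftrightarrow> (\<exists>k. lower_central L k = {0})"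

definition solvable :: "('a::ab_group_add) superalgebra \<Rightarrow> bool" where
  "solvable L \<longleftrightarrow> (\<exists>k. derived_series L k = {0})"

definition restrict :: "'a superalgebra \<Rightarrow> 'a set \<Rightarrow> 'a superalgebra" where
  "restrict L I = L\<lparr>even_part := even_part L \<inter> I, odd_part := odd_part L \<inter> I\<rparr>"

text \<open>Ideals are two-sided and graded: \<open>carrier (restrict L I) = I\<close> says that $I$ is the sum of
  $I \cap L_0$ and $I \cap L_1$.\<close>

definition ideal :: "('a::ab_group_add) superalgebra \<Rightarrow> 'a set \<Rightarrow> bool" where
  "ideal L I \<longleftrightarrow>
     module.subspace (scale L) I \<and>
     carrier (restrict L I) = I \<and>
     (\<forall>u \<in> I. \<forall>v \<in> carrier L. bracket L u v \<in> I \<and> bracket L v u \<in> I)"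

definition nilpotent_ideal_over_square :: "('a::ab_group_add) superalgebra \<Rightarrow> 'a set \<Rightarrow> bool" where
  "nilpotent_ideal_over_square L I \<longleftrightarrow>
     ideal L I \<and> nilpotent (restrict L I) \<and> bracket_span L (carrier L) (carrier L) \<subseteq> I"

definition is_nilradical :: "('a::ab_group_add) superalgebra \<Rightarrow> 'a set \<Rightarrow> bool" where
  "is_nilradical L N \<longleftrightarrow>
     nilpotent_ideal_over_square L N \<and>
     (\<forall>M. nilpotent_ideal_over_square L M \<and> N \<subseteq> M \<longrightarrow> M = N)"

definition isomorphic ::
    "('a::ab_group_add) superalgebra \<Rightarrow> ('b::ab_group_add) superalgebra \<Rightarrow> bool" where
  "isomorphic L M \<longleftrightarrow>
     (\<exists>f. bij_betw f (carrier L) (carrier M) \<and>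
          (\<forall>u \<in> carrier L. \<forall>v \<in> carrier L. f (u + v) = f u + f v) \<and>
          (\<forall>c. \<forall>u \<in> carrier L. f (scale L c u) = scale M c (f u)) \<and>
          f ` even_part L = even_part M \<and>
          f ` odd_part L = odd_part M \<and>
          (\<forall>u \<in> carrier L. \<forall>v \<in> carrier L. f (bracket L u v) = bracket M (f u) (f v)))"

section \<open>Superalgebras given by a multiplication table\<close>

text \<open>Basis vectors \<open>E i\<close>, \<open>Y i\<close>, \<open>X i\<close> stand for $e_i$, $y_i$, $x_i$; when there is only one
  generator $x$, it is \<open>X 1\<close>. The vector $c\,e_i$ is \<open>Poly_Mapping.single (E i) c\<close>.\<close>

datatype gen = E nat | Y nat | X nat

type_synonym vec = "gen \<Rightarrow>\<^sub>0 complex"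
type_synonym table = "gen \<Rightarrow> gen \<Rightarrow> vec"

abbreviation smul :: "complex \<Rightarrow> vec \<Rightarrow> vec" where
  "smul c \<equiv> Poly_Mapping.map ((*) c)"

definition from_table :: "gen set \<Rightarrow> gen set \<Rightarrow> table \<Rightarrow> vec superalgebra" where
  "from_table B0 B1 T =
     \<lparr>scale = smul,
      even_part = {u. Poly_Mapping.keys u \<subseteq> B0},
      odd_part = {u. Poly_Mapping.keys u \<subseteq> B1},
      bracket = (\<lambda>u v. \<Sum>p \<in> B0 \<union> B1. \<Sum>q \<in> B0 \<union> B1.
        smul (Poly_Mapping.lookup u p * Poly_Mapping.lookup v q) (T p q))\<rparr>"

definition product_rule :: "gen \<Rightarrow> gen \<Rightarrow> vec \<Rightarrow> table" where
  "product_rule p q w = (\<lambda>p' q'. if p' = p \<and> q' = q then w else 0)"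

text \<open>The products (P).\<close>

fun nil_table :: "nat \<Rightarrow> table" where
  "nil_table n (E i) (E j) =
     (if i = 1 \<and> j = 1 then Poly_Mapping.single (E 3) 1
      else if 3 \<le> i \<and> i < n \<and> j = 1 then Poly_Mapping.single (E (i + 1)) 1
      else 0)"
| "nil_table n (Y i) (E j) =
     (if 1 \<le> i \<and> i < n \<and> j = 1 then Poly_Mapping.single (Y (i + 1)) 1 else 0)"
| "nil_table n (E i) (Y j) =
     (if i = 1 \<and> j = 1 then Poly_Mapping.single (Y 2) (1 / 2)
      else if 3 \<le> i \<and> i \<le> n \<and> j = 1 then Poly_Mapping.single (Y i) (1 / 2)
      else 0)"
| "nil_table n (Y i) (Y j) =
     (if i = 1 \<and> j = 1 then Poly_Mapping.single (E 1) 1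
      else if 2 \<le> i \<and> i < n \<and> j = 1 then Poly_Mapping.single (E (i + 1)) 1
      else 0)"
| "nil_table n _ _ = 0"

text \<open>The nilpotent superalgebra $H(0,\dots,0)$.\<close>

definition H_zero :: "nat \<Rightarrow> vec superalgebra" where
  "H_zero n = from_table (E ` {1..n}) (Y ` {1..n}) (nil_table n)"

text \<open>The products of $x_1$ common to $MH_1$, $MH_2$, and of $x$ common to $H_1(b)$, $H_2(b)$, $H_3$.\<close>

fun diag_table :: table where
  "diag_table (Y i) (X k) =
     (if k = 1 then Poly_Mapping.single (Y i) (2 * of_nat i - 1) else 0)"
| "diag_table (E i) (X k) =
     (if k = 1 \<and> i = 1 then Poly_Mapping.single (E 1) 2
      else if k = 1 \<and> 3 \<le> i then Poly_Mapping.single (E i) (2 * (of_nat i - 1))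
      else 0)"
| "diag_table (X k) (E i) = (if k = 1 \<and> i = 1 then Poly_Mapping.single (E 1) (- 2) else 0)"
| "diag_table (X k) (Y i) = (if k = 1 \<and> i = 1 then Poly_Mapping.single (Y 1) (- 1) else 0)"
| "diag_table _ _ = 0"

text \<open>The products of $x$ common to $H_4$ and $H_5(\gamma)$.\<close>

fun shift_table :: "nat \<Rightarrow> (nat \<Rightarrow> complex) \<Rightarrow> table" where
  "shift_table n a (E i) (X k) =
     (if k = 1 \<and> i = 1 then \<Sum>j = 3..n. Poly_Mapping.single (E j) (a (j - 1))
      else if k = 1 \<and> i = 2 then Poly_Mapping.single (E 2) 1
      else if k = 1 \<and> 3 \<le> i then \<Sum>j = i + 1..n. Poly_Mapping.single (E j) (a (j + 1 - i))
      else 0)"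
| "shift_table n a (Y i) (X k) =
     (if k = 1 then \<Sum>j = i + 1..n. Poly_Mapping.single (Y j) (a (j + 1 - i)) else 0)"
| "shift_table n a _ _ = 0"

text \<open>The names of the superalgebras; the parameters $a_2,\dots,a_n$ of $H_4$ and $H_5(\gamma)$
  are not part of the name.\<close>

datatype name = MH1 | MH2 | H1 complex | H2 complex | H3 | H4 | H5 complex

fun admissible :: "name \<Rightarrow> bool" where
  "admissible (H1 b) \<longleftrightarrow> b \<noteq> 0"
| "admissible (H5 \<gamma>) \<longleftrightarrow> \<gamma> \<in> {0, 1}"
| "admissible _ \<longleftrightarrow> True"

fun extra_table :: "nat \<Rightarrow> (nat \<Rightarrow> complex) \<Rightarrow> name \<Rightarrow> table" where
  "extra_table n a MH1 p q =
     diag_table p q + product_rule (E 2) (X 2) (Poly_Mapping.single (E 2) 1) p q"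
| "extra_table n a MH2 p q =
     diag_table p q + product_rule (E 2) (X 2) (Poly_Mapping.single (E 2) 1) p q
       + product_rule (X 2) (E 2) (Poly_Mapping.single (E 2) (- 1)) p q"
| "extra_table n a (H1 b) p q =
     diag_table p q + product_rule (E 2) (X 1) (Poly_Mapping.single (E 2) b) p q
       + product_rule (X 1) (E 2) (Poly_Mapping.single (E 2) (- b)) p q"
| "extra_table n a (H2 b) p q =
     diag_table p q + product_rule (E 2) (X 1) (Poly_Mapping.single (E 2) b) p q"
| "extra_table n a H3 p q =
     diag_table p q + product_rule (X 1) (X 1) (Poly_Mapping.single (E 2) 1) p q"
| "extra_table n a H4 p q = shift_table n a p q"
| "extra_table n a (H5 \<gamma>) p q =
     shift_table n a p q + product_rule (X 1) (E 2) (Poly_Mapping.single (E 2) (- 1)) p q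
       + product_rule (X 1) (X 1) (Poly_Mapping.single (E 2) \<gamma>) p q"

definition model :: "nat \<Rightarrow> name \<Rightarrow> (nat \<Rightarrow> complex) \<Rightarrow> vec superalgebra" where
  "model n m a =
     from_table (E ` {1..n} \<union> X ` (if m \<in> {MH1, MH2} then {1, 2} else {1})) (Y ` {1..n})
       (\<lambda>p q. nil_table n p q + extra_table n a m p q)"

end

theory Submission imports Defs begin

text \<open>
  Let $R$ be right multiplication by $y_1$. Up to powers of 2 the vectors
  $y_1, R y_1, R^2 y_1, \dots$ of $H(0,\dots,0)$ are $y_1, e_1, y_2, e_3, y_3, e_4, \dots, y_n$, and the
  next one vanishes. So the nilradical is the direct sum of the line of $e_2$ and of a chain generated
  by the single odd element $y_1$. Moreover $[x,e_1] = 2R^2x$, and all elements of the chain beyond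
  $y_1, e_1$ are annihilated by left multiplications of the whole algebra $L$ (\<open>annihilator\<close>); an
  extension of the nilradical is thus governed by its action on $y_1$ and on $e_2$.

  An even $x$ acts from the right by a derivation. It satisfies $[y_1,x] = \alpha y_1 + R^2z$,
  $[e_2,x] = \beta e_2$, $[x,e_2] = \varepsilon e_2$ and $[x,y_1] = -\alpha y_1 + R^2z'$, where
  $\varepsilon$ is $0$ or $-\beta$ (\<open>weights_exist\<close>, \<open>weights_left\<close>). An odd element, or an even one
  with $\alpha=\beta=0$, lowers a flag of the nilradical $N$, hence spans together with $N$ a nilpotent
  ideal, and maximality puts it into $N$ (\<open>odd_in_radical\<close>, \<open>even_in_radical\<close>). Therefore $L/N$ is even
  and embeds by $(\alpha,\beta)$ into the plane; it has dimension one or two.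

  If $\alpha=1$, the eigenvalues $2i-1$ of $x$ on the odd part are distinct, so $y_1$ can be replaced
  by an eigenvector (\<open>eigenvector\<close>). Subtracting an element of $N$ from $x$ then removes the tail of
  $[x,y_1]$; the only term that could resist is excluded by $[x,[x,x]]=0$ (\<open>normalise_diagonal\<close>).
  If all $\alpha$ vanish, the tail of $[y_1,x]$ survives and gives the parameters $a_2,\dots,a_n$. The
  products of the generators with each other end up on the line of $e_2$ (\<open>square_split\<close>,
  \<open>pair_relations\<close>) and are removed by adding multiples of $e_2$, with the single exception $H_3$. All
  models, and $H(0,\dots,0)$ too, are instances of one multiplication table, so that the passage from
  these relations to an isomorphism is made only once (\<open>isomorphic_extension\<close>).

  The models are told apart by eigenvalues. The lines of $y_n$ and $e_2$ can be described in terms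
  of products alone, so the set of triples $((2n-1)\alpha, \beta, \varepsilon)$ realised by even elements is
  an isomorphism invariant (\<open>weight_set_model\<close>). It determines the name up to the pairs $H_2(0), H_3$
  and $H_5(0), H_5(1)$, and in these the question is whether $e_2$ is, up to a factor, the square of an
  even element (\<open>split_square_model\<close>). Finally $y_1 \mapsto t y_1$ extends to a rescaling of the basis that
  multiplies $a_k$ by $t^{-2(k-1)}$ (\<open>rescale_shift\<close>).
\<close>

section \<open>Isomorphisms and multiplication tables\<close>

abbreviation lookup :: "vec \<Rightarrow> gen \<Rightarrow> complex" where "lookup \<equiv> Poly_Mapping.lookup"
abbreviation single :: "gen \<Rightarrow> complex \<Rightarrow> vec" where "single \<equiv> Poly_Mapping.single"
abbreviation keys :: "vec \<Rightarrow> gen set" where "keys \<equiv> Poly_Mapping.keys"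

lemma lookup_smul [simp]: "lookup (smul c u) p = c * lookup u p"
  by (simp add: map.rep_eq when_def)

lemma smul_single [simp]: "smul c (single p d) = single p (c * d)"
  by (rule poly_mapping_eqI) (simp add: lookup_single when_def)

lemma vector_space_smul: "vector_space smul"
  by unfold_locales (rule poly_mapping_eqI, simp add: lookup_add algebra_simps)+

definition carrier_closed :: "('a::ab_group_add) superalgebra \<Rightarrow> bool" where
  "carrier_closed L \<longleftrightarrow> 0 \<in> carrier L \<and>
     (\<forall>u \<in> carrier L. \<forall>v \<in> carrier L. u + v \<in> carrier L \<and> bracket L u v \<in> carrier L) \<and>
     (\<forall>c. \<forall>u \<in> carrier L. scale L c u \<in> carrier L)"

definition is_isomorphism ::
    "(('a::ab_group_add) \<Rightarrow> 'b) \<Rightarrow> 'a superalgebra \<Rightarrow> ('b::ab_group_add) superalgebra \<Rightarrow> bool" where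
  "is_isomorphism f L M \<longleftrightarrow>
     bij_betw f (carrier L) (carrier M) \<and>
     (\<forall>u \<in> carrier L. \<forall>v \<in> carrier L. f (u + v) = f u + f v) \<and>
     (\<forall>c. \<forall>u \<in> carrier L. f (scale L c u) = scale M c (f u)) \<and>
     f ` even_part L = even_part M \<and>
     f ` odd_part L = odd_part M \<and>
     (\<forall>u \<in> carrier L. \<forall>v \<in> carrier L. f (bracket L u v) = bracket M (f u) (f v))"

lemma isomorphic_iff: "isomorphic L M \<longleftrightarrow> (\<exists>f. is_isomorphism f L M)"
  unfolding isomorphic_def is_isomorphism_def ..

definition parts_in_carrier :: "('a::ab_group_add) superalgebra \<Rightarrow> bool" where
  "parts_in_carrier L \<longleftrightarrow> even_part L \<subseteq> carrier L \<and> odd_part L \<subseteq> carrier L"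

lemma is_isomorphism_inverse:
  assumes "carrier_closed L" and gr: "parts_in_carrier L" and f: "is_isomorphism f L M"
  shows "is_isomorphism (inv_into (carrier L) f) M L"
proof -
  let ?g = "inv_into (carrier L) f"
  have bij: "bij_betw f (carrier L) (carrier M)" using f by (simp add: is_isomorphism_def)
  have inj: "inj_on f (carrier L)" using bij by (rule bij_betw_imp_inj_on)
  have im: "f ` carrier L = carrier M" using bij by (rule bij_betw_imp_surj_on)
  have gf: "?g (f u) = u" if "u \<in> carrier L" for u using inj that by (rule inv_into_f_f)
  have gim: "?g ` f ` A = A" if "A \<subseteq> carrier L" for A
    using inj that by (rule inv_into_image_cancel)
  have "\<forall>u \<in> carrier M. \<forall>v \<in> carrier M. ?g (u + v) = ?g u + ?g v"
    unfolding im[symmetric]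
  proof safe
    fix u v assume "u \<in> carrier L" "v \<in> carrier L"
    then show "?g (f u + f v) = ?g (f u) + ?g (f v)"
      using assms gf[of "u + v"] gf by (simp add: carrier_closed_def is_isomorphism_def)
  qed
  moreover have "\<forall>u \<in> carrier M. \<forall>v \<in> carrier M. ?g (bracket M u v) = bracket L (?g u) (?g v)"
    unfolding im[symmetric]
  proof safe
    fix u v assume "u \<in> carrier L" "v \<in> carrier L"
    then show "?g (bracket M (f u) (f v)) = bracket L (?g (f u)) (?g (f v))"
      using assms gf[of "bracket L u v"] gf by (simp add: carrier_closed_def is_isomorphism_def)
  qed
  moreover have "\<forall>c. \<forall>u \<in> carrier M. ?g (scale M c u) = scale L c (?g u)"
    unfolding im[symmetric]
  proof safe
    fix c u assume "u \<in> carrier L"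
    then show "?g (scale M c (f u)) = scale L c (?g (f u))"
      using assms gf[of "scale L c u"] gf by (simp add: carrier_closed_def is_isomorphism_def)
  qed
  ultimately show ?thesis
    using bij_betw_inv_into[OF bij] gim gr f
    unfolding is_isomorphism_def parts_in_carrier_def by metis
qed

lemma isomorphic_sym: "carrier_closed L \<Longrightarrow> parts_in_carrier L \<Longrightarrow> isomorphic L M \<Longrightarrow> isomorphic M L"
  using is_isomorphism_inverse unfolding isomorphic_iff by blast

definition bilinear :: "('a::ab_group_add) superalgebra \<Rightarrow> bool" where
  "bilinear L \<longleftrightarrow>
     (\<forall>u \<in> carrier L. \<forall>v \<in> carrier L. \<forall>w \<in> carrier L.
        bracket L (u + v) w = bracket L u w + bracket L v w \<and>
        bracket L w (u + v) = bracket L w u + bracket L w v) \<and>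
     (\<forall>c. \<forall>u \<in> carrier L. \<forall>v \<in> carrier L.
        bracket L (scale L c u) v = scale L c (bracket L u v) \<and>
        bracket L u (scale L c v) = scale L c (bracket L u v))"

lemma bracket_sum:
  fixes L :: "('a::ab_group_add) superalgebra"
  assumes vs: "vector_space (scale L)" and bil: "bilinear L" and sub: "module.subspace (scale L) (carrier L)"
    and fin: "finite A" and b: "\<And>p. p \<in> A \<Longrightarrow> b p \<in> carrier L" and w: "w \<in> carrier L"
  shows "bracket L (\<Sum>p\<in>A. scale L (c p) (b p)) w = (\<Sum>p\<in>A. scale L (c p) (bracket L (b p) w))"
    and "bracket L w (\<Sum>p\<in>A. scale L (c p) (b p)) = (\<Sum>p\<in>A. scale L (c p) (bracket L w (b p)))"
proof -
  interpret vector_space "scale L" by (rule vs)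
  have z: "0 \<in> carrier L" using sub by (rule subspace_0)
  have "bracket L (0 + 0) w = bracket L 0 w + bracket L 0 w"
    "bracket L w (0 + 0) = bracket L w 0 + bracket L w 0"
    using bil w z unfolding bilinear_def by blast+
  then have 0: "bracket L 0 w = 0" "bracket L w 0 = 0" by simp_all
  have "bracket L (\<Sum>p\<in>A. scale L (c p) (b p)) w = (\<Sum>p\<in>A. scale L (c p) (bracket L (b p) w)) \<and>
    bracket L w (\<Sum>p\<in>A. scale L (c p) (b p)) = (\<Sum>p\<in>A. scale L (c p) (bracket L w (b p)))"
    using fin b
  proof (induction A rule: finite_induct)
    case (insert p A)
    then have "scale L (c p) (b p) \<in> carrier L" "(\<Sum>p\<in>A. scale L (c p) (b p)) \<in> carrier L" "b p \<in> carrier L"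
      using sub by (auto intro: subspace_scale subspace_sum)
    then show ?case using insert bil w by (simp add: bilinear_def)
  qed (simp add: 0)
  then show "bracket L (\<Sum>p\<in>A. scale L (c p) (b p)) w = (\<Sum>p\<in>A. scale L (c p) (bracket L (b p) w))"
    and "bracket L w (\<Sum>p\<in>A. scale L (c p) (b p)) = (\<Sum>p\<in>A. scale L (c p) (bracket L w (b p)))"
    by auto
qed

lemma keys_subset_iff: "keys u \<subseteq> B \<longleftrightarrow> (\<forall>p. p \<notin> B \<longrightarrow> lookup u p = 0)"
  by (metis (no_types, lifting) in_keys_iff subset_iff)

lemma lookup_bracket_from_table:
  "lookup (bracket (from_table B0 B1 T) u v) r =
     (\<Sum>p \<in> B0 \<union> B1. \<Sum>q \<in> B0 \<union> B1.
        lookup u p * lookup v q * lookup (T p q) r)"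
  by (simp add: from_table_def lookup_sum)

lemma carrier_from_table:
  assumes "finite B0" "finite B1"
  shows "carrier (from_table B0 B1 T) = {u. keys u \<subseteq> B0 \<union> B1}"
proof (intro equalityI subsetI)
  fix u assume "u \<in> carrier (from_table B0 B1 T)"
  then show "u \<in> {u. keys u \<subseteq> B0 \<union> B1}"
    unfolding carrier_def from_table_def by (auto simp: keys_subset_iff lookup_add)
next
  fix u :: vec assume u: "u \<in> {u. keys u \<subseteq> B0 \<union> B1}"
  define u0 where "u0 = (\<Sum>p\<in>B0. single p (lookup u p))"
  have l: "lookup u0 p = (if p \<in> B0 then lookup u p else 0)" for p
    using assms by (auto simp: u0_def lookup_sum lookup_single when_def sum.delta)
  have "keys u0 \<subseteq> B0" "keys (u - u0) \<subseteq> B1"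
    using u by (auto simp: keys_subset_iff l lookup_minus)
  then show "u \<in> carrier (from_table B0 B1 T)"
    unfolding carrier_def from_table_def
    by (simp, intro exI[of _ u0] exI[of _ "u - u0"]) simp
qed

lemma from_table_simps [simp]:
  "scale (from_table B0 B1 T) = smul"
  "u \<in> even_part (from_table B0 B1 T) \<longleftrightarrow> keys u \<subseteq> B0"
  "u \<in> odd_part (from_table B0 B1 T) \<longleftrightarrow> keys u \<subseteq> B1"
  by (simp_all add: from_table_def)

lemma parts_in_carrier_from_table:
  assumes "finite B0" "finite B1"
  shows "parts_in_carrier (from_table B0 B1 T)"
  using assms by (auto simp: parts_in_carrier_def carrier_from_table)

lemma carrier_closed_from_table:
  assumes "finite B0" "finite B1"
    and T: "\<And>p q. p \<in> B0 \<union> B1 \<Longrightarrow> q \<in> B0 \<union> B1 \<Longrightarrow> keys (T p q) \<subseteq> B0 \<union> B1"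
  shows "carrier_closed (from_table B0 B1 T)"
  using assms unfolding carrier_closed_def carrier_from_table[OF assms(1,2)]
  by (auto simp: keys_subset_iff lookup_bracket_from_table lookup_add intro!: sum.neutral)

lemma bilinear_from_table: "bilinear (from_table B0 B1 T)"
  unfolding bilinear_def
  by (intro conjI allI ballI poly_mapping_eqI;
      simp add: lookup_bracket_from_table lookup_add distrib_left distrib_right sum.distrib
        sum_distrib_left mult_ac)

lemma from_table_cong:
  assumes "\<And>p q. p \<in> B0 \<union> B1 \<Longrightarrow> q \<in> B0 \<union> B1 \<Longrightarrow> T p q = T' p q"
  shows "from_table B0 B1 T = from_table B0 B1 T'"
  using assms by (auto simp: from_table_def fun_eq_iff intro!: sum.cong)

text \<open>A superalgebra is isomorphic to the one given by a multiplication table as soon as it has a basis with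
these products. Spanning and independence are phrased by coefficient functions, the form in which they
are obtained for the chains below.\<close>

lemma isomorphic_from_table:
  fixes L :: "('a::ab_group_add) superalgebra"
  assumes vs: "vector_space (scale L)" and bil: "bilinear L"
    and fin: "finite B0" "finite B1" and dis: "B0 \<inter> B1 = {}"
    and T: "\<And>p q. p \<in> B0 \<union> B1 \<Longrightarrow> q \<in> B0 \<union> B1 \<Longrightarrow> keys (T p q) \<subseteq> B0 \<union> B1"
    and indep: "\<And>c. (\<Sum>p \<in> B0 \<union> B1. scale L (c p) (b p)) = 0 \<Longrightarrow> \<forall>p \<in> B0 \<union> B1. c p = 0"
    and even: "even_part L = range (\<lambda>c. \<Sum>p \<in> B0. scale L (c p) (b p))"
    and odd: "odd_part L = range (\<lambda>c. \<Sum>p \<in> B1. scale L (c p) (b p))"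
    and br: "\<And>p q. p \<in> B0 \<union> B1 \<Longrightarrow> q \<in> B0 \<union> B1 \<Longrightarrow>
        bracket L (b p) (b q) = (\<Sum>r \<in> B0 \<union> B1. scale L (lookup (T p q) r) (b r))"
  shows "isomorphic L (from_table B0 B1 T)"
proof -
  interpret vector_space "scale L" by (rule vs)
  let ?B = "B0 \<union> B1"
  let ?M = "from_table B0 B1 T"
  define g where "g u = (\<Sum>p \<in> ?B. scale L (lookup u p) (b p))" for u :: vec
  have finB: "finite ?B" using fin by simp
  note carM = carrier_from_table[OF fin, of T]
  define vec_of where "vec_of A c = (\<Sum>p\<in>A. single p (c p))" for A :: "gen set" and c :: "gen \<Rightarrow> complex"
  have lvec: "lookup (vec_of A c) p = (if p \<in> A then c p else 0)" if "finite A" for A c p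
    using that by (auto simp: vec_of_def lookup_sum lookup_single when_def sum.delta)
  have gvec: "g (vec_of A c) = (\<Sum>p\<in>A. scale L (c p) (b p))" if "A \<subseteq> ?B" for A c
  proof -
    have "finite A" using that finB finite_subset by blast
    then show ?thesis unfolding g_def lvec[OF \<open>finite A\<close>]
      using sum.inter_restrict[OF finB, of "\<lambda>p. scale L (c p) (b p)" A] that
      by (simp add: if_distrib[of "\<lambda>d. scale L d _"] if_distribR Int_absorb1 cong: if_cong)
  qed
  have g_add: "g (u + v) = g u + g v" for u v
    by (simp add: g_def lookup_add scale_left_distrib sum.distrib)
  have g_scale: "g (smul c u) = scale L c (g u)" for c u
    by (simp add: g_def scale_sum_right)
  have g_sum: "g (sum h A) = (\<Sum>a\<in>A. g (h a))" if "finite A" for h :: "gen \<Rightarrow> vec" and A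
    using that by (induction A rule: finite_induct) (simp_all add: g_add, simp add: g_def)
  have vec_of_lookup: "vec_of A (lookup u) = u" if "finite A" "keys u \<subseteq> A" for u A
    using that by (intro poly_mapping_eqI) (auto simp: lvec keys_subset_iff)
  have keys_vec_of: "keys (vec_of A c) \<subseteq> A" if "finite A" for A c
    using that by (auto simp: keys_subset_iff lvec)
  have im: "g ` {u. keys u \<subseteq> A} = range (\<lambda>c. \<Sum>p\<in>A. scale L (c p) (b p))" if "A \<subseteq> ?B" for A
  proof -
    have fA: "finite A" using that finB finite_subset by blast
    show ?thesis
    proof (intro equalityI subsetI)
      fix w assume "w \<in> g ` {u. keys u \<subseteq> A}"
      then obtain u where u: "keys u \<subseteq> A" "w = g u" by blast
      have "w = (\<Sum>p\<in>A. scale L (lookup u p) (b p))"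
        using gvec[OF that, of "lookup u"] vec_of_lookup[OF fA u(1)] u(2) by simp
      then show "w \<in> range (\<lambda>c. \<Sum>p\<in>A. scale L (c p) (b p))" by blast
    next
      fix w assume "w \<in> range (\<lambda>c. \<Sum>p\<in>A. scale L (c p) (b p))"
      then obtain c where "w = (\<Sum>p\<in>A. scale L (c p) (b p))" by blast
      then show "w \<in> g ` {u. keys u \<subseteq> A}"
        using gvec[OF that, of c] keys_vec_of[OF fA, of c] by force
    qed
  qed
  have even': "g ` even_part ?M = even_part L" using im[of B0] even by (simp add: from_table_def)
  have odd': "g ` odd_part ?M = odd_part L" using im[of B1] odd by (simp add: from_table_def)
  have car: "g ` carrier ?M = carrier L"
  proof (intro equalityI subsetI)
    fix w assume "w \<in> g ` carrier ?M"
    then obtain u v where "u \<in> even_part ?M" "v \<in> odd_part ?M" "w = g (u + v)"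
      unfolding carrier_def by blast
    then show "w \<in> carrier L"
      unfolding carrier_def even'[symmetric] odd'[symmetric] g_add by blast
  next
    fix w assume "w \<in> carrier L"
    then obtain u v where uv: "u \<in> even_part ?M" "v \<in> odd_part ?M" "w = g u + g v"
      unfolding carrier_def even'[symmetric] odd'[symmetric] by blast
    then have "u + v \<in> carrier ?M" unfolding carrier_def by blast
    then show "w \<in> g ` carrier ?M" unfolding uv(3) g_add[symmetric] by blast
  qed
  have inj: "inj_on g (carrier ?M)"
  proof (rule inj_onI)
    fix u v assume uv: "u \<in> carrier ?M" "v \<in> carrier ?M" "g u = g v"
    have "(\<Sum>p \<in> ?B. scale L (lookup (u - v) p) (b p)) = 0"
      using uv(3) by (simp add: g_def lookup_minus scale_left_diff_distrib sum_subtractf)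
    then have "\<forall>p \<in> ?B. lookup (u - v) p = 0" by (rule indep)
    then show "u = v" using uv(1,2)
      by (intro poly_mapping_eqI) (metis (mono_tags, lifting) carM diff_eq_eq add_0 keys_subset_iff lookup_minus mem_Collect_eq)
  qed
  have bin: "b p \<in> carrier L" if "p \<in> ?B" for p
  proof -
    have "g (single p 1) = b p"
      using that finB by (simp add: g_def lookup_single when_def if_distrib[of "\<lambda>d. scale L d _"] sum.delta' cong: if_cong)
    moreover have "single p 1 \<in> carrier ?M" using that by (simp add: carM)
    ultimately show ?thesis using car by force
  qed
  have g0: "g 0 = 0" by (simp add: g_def)
  have sub: "subspace (carrier L)"
  proof (rule subspaceI)
    have "0 \<in> carrier ?M" by (simp add: carM)
    then show "0 \<in> carrier L" unfolding car[symmetric] using g0 by force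
  next
    fix u v assume "u \<in> carrier L" "v \<in> carrier L"
    then obtain u' v' where uv: "u' \<in> carrier ?M" "u = g u'" "v' \<in> carrier ?M" "v = g v'"
      unfolding car[symmetric] by blast
    then have "u' + v' \<in> carrier ?M" by (auto simp: carM keys_subset_iff lookup_add)
    then show "u + v \<in> carrier L" unfolding car[symmetric] uv g_add[symmetric] by (rule imageI)
  next
    fix c u assume "u \<in> carrier L"
    then obtain u' where u: "u' \<in> carrier ?M" "u = g u'" unfolding car[symmetric] by blast
    then have "smul c u' \<in> carrier ?M" by (auto simp: carM keys_subset_iff)
    then show "scale L c u \<in> carrier L" unfolding car[symmetric] u g_scale[symmetric] by (rule imageI)
  qed
  have sums: "bracket L (\<Sum>p\<in>?B. scale L (c p) (b p)) w = (\<Sum>p\<in>?B. scale L (c p) (bracket L (b p) w))"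
    "bracket L w (\<Sum>p\<in>?B. scale L (c p) (b p)) = (\<Sum>p\<in>?B. scale L (c p) (bracket L w (b p)))"
    if "w \<in> carrier L" for c w
    using bracket_sum[OF vs bil sub finB, of b w c] bin that by blast+
  have sum_in: "(\<Sum>p\<in>?B. scale L (c p) (b p)) \<in> carrier L" for c
    using sub bin by (intro subspace_sum subspace_scale)
  have gbr: "g (bracket ?M u v) = bracket L (g u) (g v)" for u v
  proof -
    have "bracket L (g u) (g v) = (\<Sum>p\<in>?B. scale L (lookup u p)
        (\<Sum>q\<in>?B. scale L (lookup v q) (bracket L (b p) (b q))))"
      unfolding g_def sums(1)[OF sum_in]
      by (intro sum.cong arg_cong[where f="scale L _"] refl sums(2) bin)
    also have "\<dots> = (\<Sum>p\<in>?B. \<Sum>q\<in>?B. g (smul (lookup u p * lookup v q) (T p q)))"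
      unfolding g_scale scale_sum_right
      by (intro sum.cong refl) (simp add: br g_def)
    also have "\<dots> = g (bracket ?M u v)"
      by (simp add: from_table_def g_sum fin)
    finally show ?thesis by simp
  qed
  have "is_isomorphism g ?M L"
    unfolding is_isomorphism_def bij_betw_def
    using inj car even' odd' g_add g_scale gbr from_table_simps(1) by metis
  then have "isomorphic ?M L" unfolding isomorphic_iff by blast
  moreover have "carrier_closed ?M" using fin T by (intro carrier_closed_from_table) blast+
  moreover have "parts_in_carrier ?M" using fin by (intro parts_in_carrier_from_table)
  ultimately show ?thesis by (rule isomorphic_sym[rotated 2])
qed

section \<open>A common multiplication table for the models\<close>

text \<open>The data of an extension of $H(0,\dots,0)$ by even generators $x_k$, where $k$ runs through \<open>gens\<close>:
$[y_1,x_k]$ is \<open>chain_weight\<close> times $y_1$ plus the sum of \<open>shift k j\<close> times $y_j$ over $j\ge2$;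
$[e_2,x_k]$ and $[x_k,e_2]$ are \<open>split_weight\<close> and \<open>left_weight\<close> times $e_2$; and $[x_k,x_l]$ is
\<open>square k l\<close> times $e_2$. The chain part of the table is what the Leibniz identity makes of this.\<close>

record extension =
  gens :: "nat set"
  chain_weight :: "nat \<Rightarrow> complex"
  split_weight :: "nat \<Rightarrow> complex"
  left_weight :: "nat \<Rightarrow> complex"
  shift :: "nat \<Rightarrow> nat \<Rightarrow> complex"
  square :: "nat \<Rightarrow> nat \<Rightarrow> complex"

fun extension_table :: "nat \<Rightarrow> extension \<Rightarrow> table" where
  "extension_table n D (Y i) (X k) =
     single (Y i) ((2 * of_nat i - 1) * chain_weight D k)
       + (\<Sum>j = i + 1..n. single (Y j) (shift D k (j + 1 - i)))"
| "extension_table n D (E i) (X k) =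
     (if i = 1 then single (E 1) (2 * chain_weight D k)
          + (\<Sum>j = 3..n. single (E j) (shift D k (j - 1)))
      else if i = 2 then single (E 2) (split_weight D k)
      else single (E i) (2 * (of_nat i - 1) * chain_weight D k)
          + (\<Sum>j = i + 1..n. single (E j) (shift D k (j + 1 - i))))"
| "extension_table n D (X k) (E i) =
     (if i = 1 then single (E 1) (- 2 * chain_weight D k)
      else if i = 2 then single (E 2) (left_weight D k) else 0)"
| "extension_table n D (X k) (Y i) =
     (if i = 1 then single (Y 1) (- chain_weight D k) else 0)"
| "extension_table n D (X k) (X l) = single (E 2) (square D k l)"
| "extension_table n D _ _ = 0"

definition extension_algebra :: "nat \<Rightarrow> extension \<Rightarrow> vec superalgebra" where
  "extension_algebra n D =
     from_table (E ` {1..n} \<union> X ` gens D) (Y ` {1..n}) (\<lambda>p q. nil_table n p q + extension_table n D p q)"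

fun data_of :: "name \<Rightarrow> (nat \<Rightarrow> complex) \<Rightarrow> extension" where
  "data_of MH1 a = \<lparr>gens = {1, 2}, chain_weight = (\<lambda>k. if k = 1 then 1 else 0),
     split_weight = (\<lambda>k. if k = 2 then 1 else 0), left_weight = (\<lambda>_. 0),
     shift = (\<lambda>_ _. 0), square = (\<lambda>_ _. 0)\<rparr>"
| "data_of MH2 a = \<lparr>gens = {1, 2}, chain_weight = (\<lambda>k. if k = 1 then 1 else 0),
     split_weight = (\<lambda>k. if k = 2 then 1 else 0), left_weight = (\<lambda>k. if k = 2 then -1 else 0),
     shift = (\<lambda>_ _. 0), square = (\<lambda>_ _. 0)\<rparr>"
| "data_of (H1 b) a = \<lparr>gens = {1}, chain_weight = (\<lambda>_. 1), split_weight = (\<lambda>_. b),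
     left_weight = (\<lambda>_. - b), shift = (\<lambda>_ _. 0), square = (\<lambda>_ _. 0)\<rparr>"
| "data_of (H2 b) a = \<lparr>gens = {1}, chain_weight = (\<lambda>_. 1), split_weight = (\<lambda>_. b),
     left_weight = (\<lambda>_. 0), shift = (\<lambda>_ _. 0), square = (\<lambda>_ _. 0)\<rparr>"
| "data_of H3 a = \<lparr>gens = {1}, chain_weight = (\<lambda>_. 1), split_weight = (\<lambda>_. 0),
     left_weight = (\<lambda>_. 0), shift = (\<lambda>_ _. 0), square = (\<lambda>_ _. 1)\<rparr>"
| "data_of H4 a = \<lparr>gens = {1}, chain_weight = (\<lambda>_. 0), split_weight = (\<lambda>_. 1),
     left_weight = (\<lambda>_. 0), shift = (\<lambda>_. a), square = (\<lambda>_ _. 0)\<rparr>"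
| "data_of (H5 \<gamma>) a = \<lparr>gens = {1}, chain_weight = (\<lambda>_. 0), split_weight = (\<lambda>_. 1),
     left_weight = (\<lambda>_. - 1), shift = (\<lambda>_. a), square = (\<lambda>_ _. \<gamma>)\<rparr>"

lemma extra_table_eq:
  assumes "p \<in> (E ` {1..n} \<union> X ` gens (data_of m a)) \<union> Y ` {1..n}"
    and "q \<in> (E ` {1..n} \<union> X ` gens (data_of m a)) \<union> Y ` {1..n}"
  shows "extra_table n a m p q = extension_table n (data_of m a) p q"
  using assms
  by (cases m; cases p; cases q) (auto simp: product_rule_def)

lemma model_eq: "model n m a = extension_algebra n (data_of m a)"
proof -
  have "X ` (if m \<in> {MH1, MH2} then {1, 2} else {1}) = X ` gens (data_of m a)"
    by (cases m) auto
  then show ?thesis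
    unfolding model_def extension_algebra_def using extra_table_eq
    by (auto intro!: from_table_cong)
qed

lemma finite_gens: "finite (gens (data_of m a))"
  by (cases m) auto

lemma lookup_single_sum [simp]:
  "finite A \<Longrightarrow> lookup (\<Sum>j\<in>A. single (E j) (f j)) (E i) = (if i \<in> A then f i else 0)"
  "finite A \<Longrightarrow> lookup (\<Sum>j\<in>A. single (Y j) (f j)) (Y i) = (if i \<in> A then f i else 0)"
  "lookup (\<Sum>j\<in>A. single (E j) (f j)) (Y i) = 0"
  "lookup (\<Sum>j\<in>A. single (E j) (f j)) (X i) = 0"
  "lookup (\<Sum>j\<in>A. single (Y j) (f j)) (E i) = 0"
  "lookup (\<Sum>j\<in>A. single (Y j) (f j)) (X i) = 0"
  by (auto simp: lookup_sum lookup_single when_def)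

lemma keys_table:
  assumes "n \<ge> 3" "p \<in> (E ` {1..n} \<union> X ` K) \<union> Y ` {1..n}" "q \<in> (E ` {1..n} \<union> X ` K) \<union> Y ` {1..n}"
  shows "keys (nil_table n p q + extension_table n D p q) \<subseteq> (E ` {1..n} \<union> X ` K) \<union> Y ` {1..n}"
  unfolding keys_subset_iff
proof (intro allI impI)
  fix r assume r: "r \<notin> (E ` {1..n} \<union> X ` K) \<union> Y ` {1..n}"
  show "lookup (nil_table n p q + extension_table n D p q) r = 0"
    using assms r
    by (cases p; cases q; cases r) (auto simp: lookup_add lookup_single when_def)
qed

section \<open>Leibniz superalgebras over an ideal\<close>

definition right_pow :: "'a superalgebra \<Rightarrow> 'a \<Rightarrow> nat \<Rightarrow> 'a \<Rightarrow> 'a" where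
  "right_pow L y k = ((\<lambda>u. bracket L u y) ^^ k)"

locale leibniz_over_ideal =
  fixes L :: "('a::ab_group_add) superalgebra" and N :: "'a set"
  assumes leibniz: "leibniz_superalgebra L" and over: "nilpotent_ideal_over_square L N"
begin

abbreviation L0 where "L0 \<equiv> even_part L"
abbreviation L1 where "L1 \<equiv> odd_part L"
abbreviation mult (infixl "\<cdot>" 75) where "u \<cdot> v \<equiv> bracket L u v"
abbreviation smult (infixr "*s" 80) where "c *s u \<equiv> scale L c u"

sublocale vs: vector_space "scale L"
  using leibniz by (simp add: leibniz_superalgebra_def superalgebra_def)

lemma superalgebra: "superalgebra L"
  using leibniz by (simp add: leibniz_superalgebra_def)

lemma subspace_even: "vs.subspace (L0)" and subspace_odd: "vs.subspace (L1)"
  using superalgebra by (simp_all add: superalgebra_def)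

lemma subspace_N: "vs.subspace N" and ideal_N: "ideal L N"
  using over by (simp_all add: nilpotent_ideal_over_square_def ideal_def)

lemma even_carrier [simp]: "u \<in> L0 \<Longrightarrow> u \<in> carrier L"
  unfolding carrier_def using vs.subspace_0[OF subspace_odd] by force

lemma odd_carrier [simp]: "u \<in> L1 \<Longrightarrow> u \<in> carrier L"
  unfolding carrier_def using vs.subspace_0[OF subspace_even] by force

lemma carrier_cases:
  assumes "u \<in> carrier L"
  obtains u0 u1 where "u0 \<in> L0" "u1 \<in> L1" "u = u0 + u1"
  using assms unfolding carrier_def by blast

text \<open>Ideals are graded, so the homogeneous components of an element of $N$ stay in $N$.\<close>

lemma N_cases:
  assumes "u \<in> N"
  obtains u0 u1 where "u0 \<in> L0" "u0 \<in> N" "u1 \<in> L1" "u1 \<in> N" "u = u0 + u1"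
proof -
  have "u \<in> carrier (restrict L N)" using assms ideal_N by (simp add: ideal_def)
  then show ?thesis using that unfolding carrier_def restrict_def by auto
qed

lemma N_carrier [simp]: "u \<in> N \<Longrightarrow> u \<in> carrier L"
  by (erule N_cases) (auto simp: carrier_def)

lemma subspace_carrier: "vs.subspace (carrier L)"
proof (rule vs.subspaceI)
  show "0 \<in> carrier L" using vs.subspace_0[OF subspace_even] by simp
next
  fix u v assume "u \<in> carrier L" "v \<in> carrier L"
  then obtain u0 u1 v0 v1 where "u0 \<in> L0" "u1 \<in> L1" "u = u0 + u1"
    "v0 \<in> L0" "v1 \<in> L1" "v = v0 + v1"
    by (metis carrier_cases)
  then show "u + v \<in> carrier L"
    unfolding carrier_def using vs.subspace_add[OF subspace_even] vs.subspace_add[OF subspace_odd]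
    by (intro CollectI exI[of _ "u0 + v0"] exI[of _ "u1 + v1"]) (auto simp: algebra_simps)
next
  fix c u assume "u \<in> carrier L"
  then obtain u0 u1 where "u0 \<in> L0" "u1 \<in> L1" "u = u0 + u1"
    by (metis carrier_cases)
  then show "c *s u \<in> carrier L"
    unfolding carrier_def using vs.subspace_scale[OF subspace_even] vs.subspace_scale[OF subspace_odd]
    by (intro CollectI exI[of _ "c *s u0"] exI[of _ "c *s u1"]) (auto simp: vs.scale_right_distrib)
qed

lemmas subspaces = subspace_even subspace_odd subspace_N subspace_carrier

lemma closure [simp]:
  "0 \<in> L0" "0 \<in> L1" "0 \<in> N" "0 \<in> carrier L"
  "u \<in> L0 \<Longrightarrow> v \<in> L0 \<Longrightarrow> u + v \<in> L0"
  "u \<in> L1 \<Longrightarrow> v \<in> L1 \<Longrightarrow> u + v \<in> L1"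
  "u \<in> N \<Longrightarrow> v \<in> N \<Longrightarrow> u + v \<in> N"
  "u \<in> carrier L \<Longrightarrow> v \<in> carrier L \<Longrightarrow> u + v \<in> carrier L"
  "u \<in> L0 \<Longrightarrow> v \<in> L0 \<Longrightarrow> u - v \<in> L0"
  "u \<in> L1 \<Longrightarrow> v \<in> L1 \<Longrightarrow> u - v \<in> L1"
  "u \<in> N \<Longrightarrow> v \<in> N \<Longrightarrow> u - v \<in> N"
  "u \<in> carrier L \<Longrightarrow> v \<in> carrier L \<Longrightarrow> u - v \<in> carrier L"
  "u \<in> L0 \<Longrightarrow> - u \<in> L0"
  "u \<in> L1 \<Longrightarrow> - u \<in> L1"
  "u \<in> N \<Longrightarrow> - u \<in> N"
  "u \<in> carrier L \<Longrightarrow> - u \<in> carrier L"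
  "u \<in> L0 \<Longrightarrow> c *s u \<in> L0"
  "u \<in> L1 \<Longrightarrow> c *s u \<in> L1"
  "u \<in> N \<Longrightarrow> c *s u \<in> N"
  "u \<in> carrier L \<Longrightarrow> c *s u \<in> carrier L"
  using subspaces
  by (auto intro: vs.subspace_0 vs.subspace_add vs.subspace_diff vs.subspace_neg vs.subspace_scale)

lemma closure_sum [simp]:
  "(\<And>k. k \<in> A \<Longrightarrow> f k \<in> L0) \<Longrightarrow> sum f A \<in> L0"
  "(\<And>k. k \<in> A \<Longrightarrow> f k \<in> L1) \<Longrightarrow> sum f A \<in> L1"
  "(\<And>k. k \<in> A \<Longrightarrow> f k \<in> N) \<Longrightarrow> sum f A \<in> N"
  "(\<And>k. k \<in> A \<Longrightarrow> f k \<in> carrier L) \<Longrightarrow> sum f A \<in> carrier L"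
  using subspaces by (auto intro: vs.subspace_sum)

lemma bracket_N [simp]: "u \<in> carrier L \<Longrightarrow> v \<in> carrier L \<Longrightarrow> u \<cdot> v \<in> N"
proof -
  assume "u \<in> carrier L" "v \<in> carrier L"
  then have "u \<cdot> v \<in> bracket_span L (carrier L) (carrier L)"
    unfolding bracket_span_def by (intro vs.span_base) blast
  then show ?thesis using over by (auto simp: nilpotent_ideal_over_square_def)
qed

lemma bracket_part: "u \<in> part L \<alpha> \<Longrightarrow> v \<in> part L \<beta> \<Longrightarrow> u \<cdot> v \<in> part L (\<alpha> + \<beta>)"
  using superalgebra by (auto simp: superalgebra_def)

lemma bracket_parity [simp]:
  "u \<in> L0 \<Longrightarrow> v \<in> L0 \<Longrightarrow> u \<cdot> v \<in> L0"
  "u \<in> L0 \<Longrightarrow> v \<in> L1 \<Longrightarrow> u \<cdot> v \<in> L1"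
  "u \<in> L1 \<Longrightarrow> v \<in> L0 \<Longrightarrow> u \<cdot> v \<in> L1"
  "u \<in> L1 \<Longrightarrow> v \<in> L1 \<Longrightarrow> u \<cdot> v \<in> L0"
  using bracket_part[of u 0 v 0] bracket_part[of u 0 v 1] bracket_part[of u 1 v 0] bracket_part[of u 1 v 1]
  by (simp_all add: part_def)

lemma parity_disjoint: "u \<in> L0 \<Longrightarrow> u \<in> L1 \<Longrightarrow> u = 0"
  using superalgebra by (auto simp: superalgebra_def)

lemma bilinear: "bilinear L"
  using superalgebra unfolding superalgebra_def bilinear_def by blast

lemma bracket_linear [simp]:
  assumes "u \<in> carrier L" "v \<in> carrier L"
  shows "w \<in> carrier L \<Longrightarrow> (u + w) \<cdot> v = u \<cdot> v + w \<cdot> v"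
    and "w \<in> carrier L \<Longrightarrow> u \<cdot> (v + w) = u \<cdot> v + u \<cdot> w"
    and "(c *s u) \<cdot> v = c *s (u \<cdot> v)"
    and "u \<cdot> (c *s v) = c *s (u \<cdot> v)"
  using bilinear assms by (auto simp: bilinear_def)

lemma bracket_linear' [simp]:
  assumes "u \<in> carrier L" "v \<in> carrier L"
  shows "w \<in> carrier L \<Longrightarrow> (u - w) \<cdot> v = u \<cdot> v - w \<cdot> v"
    and "w \<in> carrier L \<Longrightarrow> u \<cdot> (v - w) = u \<cdot> v - u \<cdot> w"
    and "(- u) \<cdot> v = - (u \<cdot> v)"
    and "u \<cdot> (- v) = - (u \<cdot> v)"
proof -
  have m: "- w = (- 1) *s w" for w by simp
  show neg: "(- u) \<cdot> v = - (u \<cdot> v)" "u \<cdot> (- v) = - (u \<cdot> v)"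
    unfolding m using assms by (simp_all del: vs.scale_minus_left)
  assume w: "w \<in> carrier L"
  have "(- w) \<cdot> v = - (w \<cdot> v)" "u \<cdot> (- w) = - (u \<cdot> w)"
    unfolding m using assms w by (simp_all del: vs.scale_minus_left)
  then show "(u - w) \<cdot> v = u \<cdot> v - w \<cdot> v" "u \<cdot> (v - w) = u \<cdot> v - u \<cdot> w"
    using bracket_linear(1)[of u v "- w"] bracket_linear(2)[of u v "- w"] assms w by simp_all
qed

lemma bracket_zero [simp]:
  assumes "u \<in> carrier L"
  shows "0 \<cdot> u = 0" "u \<cdot> 0 = 0"
  using bracket_linear'(1)[of u u u] bracket_linear'(2)[of u u u] assms by simp_all

lemmas bracket_sums = bracket_sum[OF vs.vector_space_axioms bilinear subspace_carrier]

lemma leibniz_homogeneous: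
  assumes "u \<in> carrier L" "v \<in> part L \<alpha>" "w \<in> part L \<beta>"
  shows "u \<cdot> (v \<cdot> w) = (u \<cdot> v) \<cdot> w - ((- 1) ^ (\<alpha> * \<beta>)) *s ((u \<cdot> w) \<cdot> v)"
  using leibniz assms unfolding leibniz_superalgebra_def by blast

lemma leibniz_odd:
  "u \<in> carrier L \<Longrightarrow> v \<in> L1 \<Longrightarrow> w \<in> L1 \<Longrightarrow> u \<cdot> (v \<cdot> w) = u \<cdot> v \<cdot> w + u \<cdot> w \<cdot> v"
  using leibniz_homogeneous[of u v 1 w 1] by (simp add: part_def)

lemma leibniz_even_odd:
  "u \<in> carrier L \<Longrightarrow> v \<in> L0 \<Longrightarrow> w \<in> L1 \<Longrightarrow> u \<cdot> (v \<cdot> w) = u \<cdot> v \<cdot> w - u \<cdot> w \<cdot> v"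
  using leibniz_homogeneous[of u v 0 w 1] by (simp add: part_def)

lemma leibniz_even:
  assumes "u \<in> carrier L" "v \<in> carrier L" "w \<in> L0"
  shows "u \<cdot> (v \<cdot> w) = u \<cdot> v \<cdot> w - u \<cdot> w \<cdot> v"
proof -
  obtain v0 v1 where "v0 \<in> L0" "v1 \<in> L1" "v = v0 + v1"
    using assms(2) by (rule carrier_cases)
  then show ?thesis
    using leibniz_homogeneous[of u v0 0 w 0] leibniz_homogeneous[of u v1 1 w 0] assms(1,3)
    by (simp add: part_def)
qed

end

section \<open>The chain of an odd generator\<close>

text \<open>The coordinate-free shape of $H(0,\dots,0)$ inside $L$: \<open>y\<close> plays the role of $y_1$ and \<open>e\<close> that of
$e_2$. The two step conditions say that $N_1$ is spanned by $y$ and $R^2N_1$, and $N_0$ by $e$ and $RN_1$;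
iterating them replaces every computation with coordinates. A frame is not unique: the normal forms below
are reached by changing $y$ and $e$.\<close>

locale frame = leibniz_over_ideal +
  fixes n :: nat and y e :: 'a
  assumes n3: "3 \<le> n"
    and y [simp]: "y \<in> L1" "y \<in> N"
    and e [simp]: "e \<in> L0" "e \<in> N"
    and e_nonzero: "e \<noteq> 0"
    and odd_step: "\<And>z. z \<in> L1 \<Longrightarrow> z \<in> N \<Longrightarrow>
          \<exists>c z'. z' \<in> L1 \<and> z' \<in> N \<and> z = c *s y + z' \<cdot> y \<cdot> y"
    and even_step: "\<And>z. z \<in> L0 \<Longrightarrow> z \<in> N \<Longrightarrow>
          \<exists>c z'. z' \<in> L1 \<and> z' \<in> N \<and> z = c *s e + z' \<cdot> y"
    and ey [simp]: "e \<cdot> y = 0"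
    and Ne [simp]: "\<And>z. z \<in> N \<Longrightarrow> z \<cdot> e = 0"
    and top: "right_pow L y (2 * n - 2) y \<noteq> 0"
    and stop: "\<And>z. z \<in> L1 \<Longrightarrow> z \<in> N \<Longrightarrow> right_pow L y (2 * n - 1) z = 0"
begin

abbreviation P where "P \<equiv> right_pow L y"

lemma P_simps [simp]: "P 0 u = u" "P (Suc k) u = P k u \<cdot> y"
  by (simp_all add: right_pow_def)

lemma P_add: "P (j + k) u = P j (P k u)"
  by (simp add: right_pow_def funpow_add)

lemma P_bracket: "P k (u \<cdot> y) = P k u \<cdot> y"
  using P_add[of k 1 u] P_add[of 1 k u] by (simp add: add.commute)

lemma P_two: "P k (u \<cdot> y \<cdot> y) = P (k + 2) u"
  by (simp add: P_bracket)

lemma P_closure [simp]: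
  "u \<in> N \<Longrightarrow> P k u \<in> N" "u \<in> carrier L \<Longrightarrow> P k u \<in> carrier L"
  by (induction k) auto

lemma P_parity [simp]:
  "u \<in> L1 \<Longrightarrow> P (2 * k) u \<in> L1"
  "u \<in> L0 \<Longrightarrow> P (2 * k) u \<in> L0"
  by (induction k) auto

lemma P_linear [simp]:
  assumes "u \<in> carrier L"
  shows "v \<in> carrier L \<Longrightarrow> P k (u + v) = P k u + P k v"
    and "v \<in> carrier L \<Longrightarrow> P k (u - v) = P k u - P k v"
    and "P k (- u) = - P k u"
    and "P k (c *s u) = c *s P k u"
  using assms by (induction k) auto

lemma P_zero [simp]: "P k 0 = 0"
  by (induction k) auto

lemma P_sum:
  assumes "finite A" "\<And>j. j \<in> A \<Longrightarrow> f j \<in> carrier L"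
  shows "P k (\<Sum>j\<in>A. c j *s f j) = (\<Sum>j\<in>A. c j *s P k (f j))"
  using assms by (induction A rule: finite_induct) auto

lemma P_vanish: "z \<in> L1 \<Longrightarrow> z \<in> N \<Longrightarrow> 2 * n - 1 \<le> k \<Longrightarrow> P k z = 0"
  using stop P_add[of "k - (2 * n - 1)" "2 * n - 1" z] by simp

text \<open>The coefficient of $y$ is the leading one: the highest power of $R$ that does not kill $y$ kills $R^2N_1$.\<close>

lemma lead_zero:
  assumes z: "z \<in> L1" "z \<in> N" and k: "k \<le> 2 * n - 2"
    and eq: "P k (c *s y + z \<cdot> y \<cdot> y) = 0"
  shows "c = 0"
proof -
  have "P (2 * n - 2) (c *s y + z \<cdot> y \<cdot> y) = P (2 * n - 2 - k) (P k (c *s y + z \<cdot> y \<cdot> y))"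
  proof -
    have "2 * n - 2 - k + k = 2 * n - 2" using k by simp
    then show ?thesis by (metis P_add)
  qed
  moreover have "P (2 * n - 2) (c *s y + z \<cdot> y \<cdot> y) = c *s P (2 * n - 2) y + P (2 * n - 2 + 2) z"
    using z by (subst P_linear) (auto simp: P_two)
  moreover have "P (2 * n - 2 + 2) z = 0" using z by (intro P_vanish) auto
  ultimately show ?thesis using eq top by simp
qed

lemma odd_expand:
  assumes "z \<in> L1" "z \<in> N"
  obtains c where "z = (\<Sum>k<n. c k *s P (2 * k) y)"
proof -
  have "\<exists>c z'. z' \<in> L1 \<and> z' \<in> N \<and> z = (\<Sum>k<m. c k *s P (2 * k) y) + P (2 * m) z'" for m
  proof (induction m)
    case 0
    then show ?case using assms by auto
  next
    case (Suc m)
    then obtain c z' where 1: "z' \<in> L1" "z' \<in> N" "z = (\<Sum>k<m. c k *s P (2 * k) y) + P (2 * m) z'"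
      by blast
    obtain d z'' where 2: "z'' \<in> L1" "z'' \<in> N" "z' = d *s y + z'' \<cdot> y \<cdot> y"
      using odd_step 1 by blast
    have "P (2 * m) z' = d *s P (2 * m) y + P (2 * Suc m) z''"
      using 2 by (simp add: P_two P_bracket)
    then have "z = (\<Sum>k<Suc m. (c(m := d)) k *s P (2 * k) y) + P (2 * Suc m) z''"
      using 1(3) by (simp add: algebra_simps)
    then show ?case using 2 by blast
  qed
  then obtain c z' where "z' \<in> L1" "z' \<in> N" "z = (\<Sum>k<n. c k *s P (2 * k) y) + P (2 * n) z'"
    by blast
  then show ?thesis using that P_vanish[of z' "2 * n"] by simp
qed

text \<open>For the coefficient with index $k$ apply $R^{2(n-1-k)}$: it sends $R^{2k}y$ to the last vector of the chain
and all later vectors to zero, and the earlier coefficients vanish by induction.\<close>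

lemma odd_independent:
  assumes "(\<Sum>k<n. c k *s P (2 * k) y) = 0" "k < n"
  shows "c k = 0"
  using assms(2)
proof (induction k rule: less_induct)
  case (less k)
  let ?j = "2 * (n - 1 - k)"
  have "0 = P ?j (\<Sum>i<n. c i *s P (2 * i) y)" using assms(1) by simp
  also have "\<dots> = (\<Sum>i<n. c i *s P ?j (P (2 * i) y))"
    by (subst P_sum) auto
  also have "\<dots> = (\<Sum>i<n. if i = k then c k *s P (2 * n - 2) y else 0)"
  proof (rule sum.cong)
    fix i assume "i \<in> {..<n}"
    consider "i < k" | "i = k" | "i > k" by linarith
    then show "c i *s P ?j (P (2 * i) y) = (if i = k then c k *s P (2 * n - 2) y else 0)"
    proof cases
      case 1
      then show ?thesis using less by simp
    next
      case 2
      then have "?j + 2 * i = 2 * n - 2" using less.prems by simp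
      then show ?thesis using 2 P_add[of ?j "2 * i" y] by simp
    next
      case 3
      then have "2 * n - 1 \<le> ?j + 2 * i" using less.prems by simp
      then have "P ?j (P (2 * i) y) = 0" using P_vanish[of y "?j + 2 * i"] P_add[of ?j "2 * i" y] by simp
      then show ?thesis using 3 by simp
    qed
  qed simp
  also have "\<dots> = c k *s P (2 * n - 2) y" using less.prems by simp
  finally show ?case using top by simp
qed

lemma even_independent:
  assumes "(\<Sum>k<n - 1. c k *s P (2 * k + 1) y) = 0" "k < n - 1"
  shows "c k = 0"
proof -
  define d where "d k = (if k = 0 then 0 else c (k - 1))" for k
  have "0 = (\<Sum>k<n - 1. c k *s P (2 * k + 1) y) \<cdot> y" using assms by simp
  also have "\<dots> = (\<Sum>k<n - 1. d (Suc k) *s P (2 * Suc k) y)"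
    by (subst bracket_sums(1)) (auto simp: d_def)
  also have "\<dots> = (\<Sum>k<Suc (n - 1). d k *s P (2 * k) y)"
    by (subst sum.lessThan_Suc_shift) (simp add: d_def)
  finally have "(\<Sum>k<n. d k *s P (2 * k) y) = 0" using n3 by simp
  then have "d (Suc k) = 0" by (rule odd_independent) (use assms in simp)
  then show ?thesis by (simp add: d_def)
qed

lemma expansion_bracket:
  "(\<Sum>k<n. c k *s P (2 * k) y) \<cdot> y = (\<Sum>k<n - 1. c k *s P (2 * k + 1) y)"
proof -
  obtain m where n: "n = Suc m" using n3 by (cases n) auto
  have "(\<Sum>k<n. c k *s P (2 * k) y) \<cdot> y = (\<Sum>k<n. c k *s P (2 * k + 1) y)"
    by (subst bracket_sums(1)) auto
  then show ?thesis
    using P_vanish[of y "2 * m + 1"] by (simp add: n)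
qed

text \<open>On the chain the kernel of $R$ is the line of the last vector $R^{2n-2}y$, and this vector is odd. So
$R$ is injective on the even elements $R z$; most identities below are cancelled by this rule.\<close>

lemma odd_kernel:
  assumes z: "z \<in> L1" "z \<in> N" and 0: "z \<cdot> y \<cdot> y = 0"
  shows "z \<cdot> y = 0"
proof -
  obtain c where c: "z = (\<Sum>k<n. c k *s P (2 * k) y)" using z by (rule odd_expand)
  have zy: "z \<cdot> y = (\<Sum>k<n - 1. c k *s P (2 * k + 1) y)"
    unfolding c by (rule expansion_bracket)
  define d where "d k = (if k = 0 then 0 else c (k - 1))" for k
  have "0 = z \<cdot> y \<cdot> y" using 0 by simp
  also have "\<dots> = (\<Sum>k<n - 1. d (Suc k) *s P (2 * Suc k) y)"
    unfolding zy by (subst bracket_sums(1)) (auto simp: d_def)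
  also have "\<dots> = (\<Sum>k<Suc (n - 1). d k *s P (2 * k) y)"
    by (subst sum.lessThan_Suc_shift) (simp add: d_def)
  finally have s: "(\<Sum>k<n. d k *s P (2 * k) y) = 0" using n3 by simp
  have "c k = 0" if "k < n - 1" for k
  proof -
    have "d (Suc k) = 0" by (rule odd_independent[OF s]) (use that in simp)
    then show ?thesis by (simp add: d_def)
  qed
  then show ?thesis unfolding zy by simp
qed

lemma yy_nonzero: "y \<cdot> y \<noteq> 0"
proof
  assume "y \<cdot> y = 0"
  then have "P 1 (1 *s y + 0 \<cdot> y \<cdot> y) = 0" by simp
  then have "(1 :: complex) = 0" using n3 by (intro lead_zero[of 0 1]) simp_all
  then show False by simp
qed

section \<open>The right annihilator\<close>

lemma bracket_yy: "u \<in> carrier L \<Longrightarrow> u \<cdot> (y \<cdot> y) = 2 *s (u \<cdot> y \<cdot> y)"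
  using leibniz_odd[of u y y] vs.scale_left_distrib[of 1 1 "u \<cdot> y \<cdot> y"] by simp

lemma annihilator_step:
  assumes "r \<in> L0 \<or> r \<in> L1" "\<And>v. v \<in> carrier L \<Longrightarrow> v \<cdot> r = 0" "u \<in> carrier L"
  shows "u \<cdot> (r \<cdot> y) = 0"
  using assms leibniz_odd[of u r y] leibniz_even_odd[of u r y] assms(2)[of "u \<cdot> y"] by auto

text \<open>The Leibniz identity is skew in its last two arguments for an even and an odd element, hence
$[u,[y,e_1]] = -[u,[e_1,y]]$ with $e_1=[y,y]$. But $[y,e_1]=2R^2y$ and $[e_1,y]=R^2y$, so that
$3[u,R^2y]=0$.\<close>

lemma annihilator_y: "u \<in> carrier L \<Longrightarrow> u \<cdot> (y \<cdot> y \<cdot> y) = 0"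
proof -
  assume u: "u \<in> carrier L"
  let ?w = "u \<cdot> (y \<cdot> y \<cdot> y)"
  have "u \<cdot> (y \<cdot> (y \<cdot> y)) = - ?w"
    using u leibniz_even[of u y "y \<cdot> y"] leibniz_even_odd[of u "y \<cdot> y" y] by simp
  moreover have "u \<cdot> (y \<cdot> (y \<cdot> y)) = 2 *s ?w"
    using u by (simp add: bracket_yy)
  ultimately have "3 *s ?w = 0"
    using vs.scale_left_distrib[of 2 1 ?w] by simp
  then show ?thesis by simp
qed

lemma annihilator_P: "u \<in> carrier L \<Longrightarrow> u \<cdot> P (2 * k + 2) y = 0"
proof (induction k arbitrary: u)
  case 0
  then show ?case using annihilator_y by (simp add: numeral_2_eq_2)
next
  case (Suc k)
  let ?r = "P (2 * k + 2) y"
  have r: "?r \<in> L1" using P_parity(1)[of y "k + 1"] by simp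
  have 1: "v \<cdot> (?r \<cdot> y) = 0" if "v \<in> carrier L" for v
    using annihilator_step[of ?r] r Suc.IH that by blast
  have "u \<cdot> (?r \<cdot> y \<cdot> y) = 0"
    using annihilator_step[of "?r \<cdot> y"] r 1 Suc.prems by simp
  then show ?case by simp
qed

lemma annihilator:
  assumes z: "z \<in> L1" "z \<in> N" and u: "u \<in> carrier L"
  shows "u \<cdot> (z \<cdot> y \<cdot> y) = 0"
proof -
  obtain c where c: "z = (\<Sum>k<n. c k *s P (2 * k) y)" using z by (rule odd_expand)
  have "z \<cdot> y \<cdot> y = (\<Sum>k<n. c k *s P (2 * k + 2) y)"
    unfolding c by (simp add: bracket_sums)
  then show ?thesis using u annihilator_P by (simp add: bracket_sums del: P_simps)
qed

lemma annihilator':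
  assumes z: "z \<in> L1" "z \<in> N" and u: "u \<in> carrier L"
  shows "u \<cdot> (z \<cdot> y \<cdot> y \<cdot> y) = 0"
  using annihilator_step[of "z \<cdot> y \<cdot> y" u] annihilator z u by simp

text \<open>Right multiplication by an even chain element sees only its $e_1$-component, and right multiplication by
$e_1$ is $2R^2$.\<close>

lemma bracket_right_even:
  assumes z: "z \<in> L1" "z \<in> N"
  obtains c where "\<And>u. u \<in> carrier L \<Longrightarrow> u \<cdot> (z \<cdot> y) = c *s (u \<cdot> y \<cdot> y)"
proof -
  obtain c z' where *: "z' \<in> L1" "z' \<in> N" "z = c *s y + z' \<cdot> y \<cdot> y"
    using odd_step z by blast
  have "u \<cdot> (z \<cdot> y) = (2 * c) *s (u \<cdot> y \<cdot> y)" if "u \<in> carrier L" for u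
    using * that annihilator'[of z' u] by (simp add: bracket_yy mult.commute)
  then show ?thesis by (rule that)
qed

end

section \<open>Enlarging the nilradical\<close>

context leibniz_over_ideal
begin

lemma restrict_simps [simp]:
  "scale (restrict L I) = scale L" "bracket (restrict L I) = bracket L"
  "even_part (restrict L I) = L0 \<inter> I" "odd_part (restrict L I) = L1 \<inter> I"
  by (simp_all add: restrict_def)

text \<open>If $z$ and $N$ both push a flag of $N$ down, the sum of $N$ and the line of $z$ is a nilpotent ideal: its
square lies in $N$, the top of the flag, and each further product goes one step down.\<close>

lemma in_radical_if_flag:
  assumes maximal: "\<And>M. nilpotent_ideal_over_square L M \<Longrightarrow> N \<subseteq> M \<Longrightarrow> M = N"
    and z: "z \<in> L0 \<or> z \<in> L1"
    and G: "\<And>i. vs.subspace (G i)" "N \<subseteq> G 0"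
    and GN: "\<And>i u m. u \<in> G i \<Longrightarrow> m \<in> N \<Longrightarrow> u \<in> N \<and> u \<cdot> m \<in> G (Suc i)"
    and Gz: "\<And>i u. u \<in> G i \<Longrightarrow> u \<cdot> z \<in> G (Suc i)"
    and stop: "G k \<subseteq> {0}"
  shows "z \<in> N"
proof -
  define M where "M = {m + c *s z | m c. m \<in> N}"
  have z': "z \<in> carrier L" using z by auto
  have NM: "m \<in> M" if "m \<in> N" for m
    using that unfolding M_def by (intro CollectI exI[of _ m] exI[of _ 0]) simp
  have zM: "z \<in> M"
    unfolding M_def by (intro CollectI exI[of _ 0] exI[of _ 1]) simp
  have subM: "vs.subspace M"
  proof (rule vs.subspaceI)
    show "0 \<in> M" by (simp add: NM)
  next
    fix u v assume "u \<in> M" "v \<in> M"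
    then obtain m c m' c' where "u = m + c *s z" "v = m' + c' *s z" "m \<in> N" "m' \<in> N"
      unfolding M_def by blast
    then show "u + v \<in> M"
      unfolding M_def by (intro CollectI exI[of _ "m + m'"] exI[of _ "c + c'"]) (simp add: algebra_simps)
  next
    fix c u assume "u \<in> M"
    then obtain m c' where "u = m + c' *s z" "m \<in> N"
      unfolding M_def by blast
    then show "c *s u \<in> M"
      unfolding M_def by (intro CollectI exI[of _ "c *s m"] exI[of _ "c * c'"]) (simp add: algebra_simps)
  qed
  have Mcar: "u \<in> carrier L" if "u \<in> M" for u
    using that z' unfolding M_def by auto
  have carM: "carrier (restrict L M) = M"
  proof (intro equalityI subsetI)
    fix u assume "u \<in> carrier (restrict L M)"
    then show "u \<in> M" unfolding carrier_def using vs.subspace_add[OF subM] by auto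
  next
    fix u assume "u \<in> M"
    then obtain m c where m: "m \<in> N" "u = m + c *s z" unfolding M_def by blast
    then obtain m0 m1 where m': "m0 \<in> L0" "m0 \<in> N" "m1 \<in> L1" "m1 \<in> N" "m = m0 + m1"
      by (metis N_cases)
    from z show "u \<in> carrier (restrict L M)"
    proof
      assume "z \<in> L0"
      then have "m0 + c *s z \<in> L0 \<inter> M" "m1 \<in> L1 \<inter> M"
        using m' NM unfolding M_def by auto
      then show ?thesis unfolding carrier_def restrict_simps m(2) m'(5)
        by (intro CollectI exI[of _ "m0 + c *s z"] exI[of _ m1]) (auto simp: algebra_simps)
    next
      assume "z \<in> L1"
      then have "m1 + c *s z \<in> L1 \<inter> M" "m0 \<in> L0 \<inter> M"
        using m' NM unfolding M_def by auto
      then show ?thesis unfolding carrier_def restrict_simps m(2) m'(5)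
        by (intro CollectI exI[of _ m0] exI[of _ "m1 + c *s z"]) (auto simp: algebra_simps)
    qed
  qed
  have id: "ideal L M"
    unfolding ideal_def using subM carM Mcar NM by simp
  have lc: "lower_central (restrict L M) (Suc i) \<subseteq> G i" for i
  proof (induction i)
    case 0
    have "bracket_span L M M \<subseteq> N"
      unfolding bracket_span_def
      by (intro vs.span_minimal[OF _ subspace_N]) (auto intro!: bracket_N Mcar)
    then show ?case using G(2) carM by (simp add: bracket_span_def)
  next
    case (Suc i)
    have "u \<cdot> v \<in> G (Suc i)" if u: "u \<in> G i" and v: "v \<in> M" for u v
    proof -
      obtain m c where m: "m \<in> N" "v = m + c *s z" using v unfolding M_def by blast
      then have "u \<cdot> v = u \<cdot> m + c *s (u \<cdot> z)"
        using GN[OF u m(1)] z' by simp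
      then show ?thesis
        using GN[OF u m(1)] Gz[OF u] G(1) by (simp add: vs.subspace_add vs.subspace_scale)
    qed
    then have "bracket_span L (lower_central (restrict L M) (Suc i)) M \<subseteq> G (Suc i)"
      unfolding bracket_span_def using Suc by (intro vs.span_minimal G(1)) blast
    then show ?case using carM by (simp add: bracket_span_def)
  qed
  have "0 \<in> lower_central (restrict L M) (Suc k)"
    by (simp add: bracket_span_def vs.span_zero)
  then have "lower_central (restrict L M) (Suc k) = {0}"
    using lc[of k] stop by blast
  then have "nilpotent (restrict L M)" unfolding nilpotent_def by blast
  moreover have "bracket_span L (carrier L) (carrier L) \<subseteq> M"
    using over NM by (auto simp: nilpotent_ideal_over_square_def)
  ultimately have "nilpotent_ideal_over_square L M"
    using id by (simp add: nilpotent_ideal_over_square_def)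
  then have "M = N" using maximal NM by blast
  then show ?thesis using zM by blast
qed

lemma derivation:
  "u \<in> carrier L \<Longrightarrow> v \<in> carrier L \<Longrightarrow> x \<in> L0 \<Longrightarrow> u \<cdot> v \<cdot> x = u \<cdot> (v \<cdot> x) + u \<cdot> x \<cdot> v"
  using leibniz_even[of u v x] by simp

end

context frame
begin

lemma P_vanish_N: "u \<in> N \<Longrightarrow> 2 * n \<le> k \<Longrightarrow> P k u = 0"
proof -
  assume "u \<in> N" and k: "2 * n \<le> k"
  then obtain u0 u1 where u: "u0 \<in> L0" "u0 \<in> N" "u1 \<in> L1" "u1 \<in> N" "u = u0 + u1"
    by (metis N_cases)
  obtain c z where z: "z \<in> L1" "z \<in> N" "u0 = c *s e + z \<cdot> y"
    using even_step u by blast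
  obtain j where j: "k = Suc j" using k n3 by (cases k) auto
  have "P k e = 0" using P_bracket[of j e] by (simp add: j)
  moreover have "P k (z \<cdot> y) = 0" using P_vanish[of z "Suc k"] k z by (simp add: P_bracket)
  moreover have "P k u1 = 0" using P_vanish[of u1 k] k u by simp
  ultimately show ?thesis using u z by simp
qed

lemma bracket_N_right:
  assumes "m \<in> N"
  obtains a b where "\<And>u. u \<in> N \<Longrightarrow> u \<cdot> m = a *s (u \<cdot> y) + b *s (u \<cdot> y \<cdot> y)"
proof -
  obtain m0 m1 where m: "m0 \<in> L0" "m0 \<in> N" "m1 \<in> L1" "m1 \<in> N" "m = m0 + m1"
    using assms by (rule N_cases)
  obtain c z where z: "z \<in> L1" "z \<in> N" "m0 = c *s e + z \<cdot> y"
    using even_step m by blast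
  obtain b where b: "\<And>u. u \<in> carrier L \<Longrightarrow> u \<cdot> (z \<cdot> y) = b *s (u \<cdot> y \<cdot> y)"
    using bracket_right_even[OF z(1,2)] by blast
  obtain a z' where z': "z' \<in> L1" "z' \<in> N" "m1 = a *s y + z' \<cdot> y \<cdot> y"
    using odd_step m by blast
  have "u \<cdot> m = a *s (u \<cdot> y) + b *s (u \<cdot> y \<cdot> y)" if "u \<in> N" for u
    using that z z' m b annihilator[of z' u] by simp
  then show ?thesis using that by blast
qed

text \<open>The flag used is $N$, $\mathbb C e+RN$, $RN$, $R^2N$, and so on. The line of $e$ has to come early, since an
odd element may send $y$ to a multiple of $e$ and $e$ back into $RN$.\<close>

lemma in_radical_if_lowers:
  assumes maximal: "\<And>M. nilpotent_ideal_over_square L M \<Longrightarrow> N \<subseteq> M \<Longrightarrow> M = N"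
    and z: "z \<in> L0 \<or> z \<in> L1"
    and all: "\<And>u. u \<in> N \<Longrightarrow> \<exists>c w. w \<in> N \<and> u \<cdot> z = c *s e + w \<cdot> y"
    and ez: "\<exists>w. w \<in> N \<and> e \<cdot> z = w \<cdot> y"
    and powers: "\<And>j u. u \<in> N \<Longrightarrow> \<exists>w. w \<in> N \<and> P (Suc j) u \<cdot> z = P (Suc (Suc j)) w"
  shows "z \<in> N"
proof -
  \<comment> \<open>The line of \<open>e\<close> is dropped after one step, so the exponent lags behind the index by one.\<close>
  define G where "G i = (if i = 0 then N else if i = 1 then {c *s e + u \<cdot> y | c u. u \<in> N} else P (i - 1) ` N)" for i
  have z': "z \<in> carrier L" using z by auto
  have sub: "vs.subspace (G i)" for i
  proof -
    consider "i = 0" | "i = 1" | "i \<ge> 2" by linarith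
    then show ?thesis
    proof cases
      case 1
      then show ?thesis using subspace_N by (simp add: G_def)
    next
      case 2
      then have Gi: "G i = {c *s e + u \<cdot> y | c u. u \<in> N}" by (simp add: G_def)
      show ?thesis unfolding Gi
      proof (rule vs.subspaceI)
        show "0 \<in> {c *s e + u \<cdot> y | c u. u \<in> N}"
          by (intro CollectI exI[of _ 0]) simp
      next
        fix u v assume "u \<in> {c *s e + u \<cdot> y | c u. u \<in> N}" "v \<in> {c *s e + u \<cdot> y | c u. u \<in> N}"
        then obtain c u' d v' where "u = c *s e + u' \<cdot> y" "v = d *s e + v' \<cdot> y" "u' \<in> N" "v' \<in> N" by blast
        then show "u + v \<in> {c *s e + u \<cdot> y | c u. u \<in> N}"
          by (intro CollectI exI[of _ "c + d"] exI[of _ "u' + v'"]) (simp add: algebra_simps)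
      next
        fix d u assume "u \<in> {c *s e + u \<cdot> y | c u. u \<in> N}"
        then obtain c u' where "u = c *s e + u' \<cdot> y" "u' \<in> N" by blast
        then show "d *s u \<in> {c *s e + u \<cdot> y | c u. u \<in> N}"
          by (intro CollectI exI[of _ "d * c"] exI[of _ "d *s u'"]) (simp add: algebra_simps)
      qed
    next
      case 3
      then have Gi: "G i = P (i - 1) ` N" by (simp add: G_def)
      show ?thesis unfolding Gi
      proof (rule vs.subspaceI)
        show "0 \<in> P (i - 1) ` N" by (intro image_eqI[of _ _ 0]) simp_all
      next
        fix u v assume "u \<in> P (i - 1) ` N" "v \<in> P (i - 1) ` N"
        then obtain u' v' where "u = P (i - 1) u'" "v = P (i - 1) v'" "u' \<in> N" "v' \<in> N" by blast
        then show "u + v \<in> P (i - 1) ` N"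
          by (intro image_eqI[of _ _ "u' + v'"]) simp_all
      next
        fix d u assume "u \<in> P (i - 1) ` N"
        then obtain u' where "u = P (i - 1) u'" "u' \<in> N" by blast
        then show "d *s u \<in> P (i - 1) ` N"
          by (intro image_eqI[of _ _ "d *s u'"]) simp_all
      qed
    qed
  qed
  have GN: "u \<in> N \<and> u \<cdot> m \<in> G (Suc i)" if u: "u \<in> G i" and m: "m \<in> N" for i u m
  proof -
    obtain a b where ab: "\<And>u. u \<in> N \<Longrightarrow> u \<cdot> m = a *s (u \<cdot> y) + b *s (u \<cdot> y \<cdot> y)"
      using bracket_N_right[OF m] by blast
    consider "i = 0" | "i = 1" | j where "i = Suc (Suc j)"
      by (metis One_nat_def not0_implies_Suc)
    then show ?thesis
    proof cases
      case 1
      then have "u \<in> N" using u by (simp add: G_def)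
      moreover from this have "u \<cdot> m = 0 *s e + (a *s u + b *s (u \<cdot> y)) \<cdot> y" using ab by simp
      ultimately show ?thesis using 1
        by (auto simp: G_def intro!: exI[of _ 0] exI[of _ "a *s u + b *s (u \<cdot> y)"])
    next
      case 2
      then obtain c u' where u': "u' \<in> N" "u = c *s e + u' \<cdot> y" using u by (auto simp: G_def)
      then have "u \<cdot> m = P 1 (P 1 (a *s u') + b *s P 2 u')" using ab[of u] by (simp add: numeral_2_eq_2)
      then have "u \<cdot> m = P 1 (a *s (u' \<cdot> y) + b *s (u' \<cdot> y \<cdot> y))" using u' by (simp add: numeral_2_eq_2)
      then show ?thesis using 2 u'
        by (auto simp: G_def intro!: image_eqI[of _ _ "a *s (u' \<cdot> y) + b *s (u' \<cdot> y \<cdot> y)"])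
    next
      case 3
      then obtain u' where u': "u' \<in> N" "u = P (Suc j) u'" using u by (auto simp: G_def)
      then have "u \<cdot> m = P (Suc (Suc j)) (a *s u' + b *s (u' \<cdot> y))" using ab[of u] by (simp add: P_bracket)
      then show ?thesis using 3 u'
        by (auto simp: G_def intro!: image_eqI[of _ _ "a *s u' + b *s (u' \<cdot> y)"])
    qed
  qed
  have Gz: "u \<cdot> z \<in> G (Suc i)" if u: "u \<in> G i" for i u
  proof -
    consider "i = 0" | "i = 1" | j where "i = Suc (Suc j)"
      by (metis One_nat_def not0_implies_Suc)
    then show ?thesis
    proof cases
      case 1
      then have "u \<in> N" using u by (simp add: G_def)
      then show ?thesis using 1 all[of u] by (simp add: G_def) metis
    next
      case 2
      then obtain c u' where u': "u' \<in> N" "u = c *s e + u' \<cdot> y" using u by (auto simp: G_def)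
      obtain w where w: "w \<in> N" "e \<cdot> z = w \<cdot> y" using ez by blast
      obtain w' where w': "w' \<in> N" "u' \<cdot> y \<cdot> z = w' \<cdot> y \<cdot> y" using powers[of u' 0] u' by auto
      have "u \<cdot> z = P 1 (c *s w + w' \<cdot> y)" using u' w w' z' by simp
      then show ?thesis using 2 w w'
        by (auto simp: G_def intro!: image_eqI[of _ _ "c *s w + w' \<cdot> y"])
    next
      case 3
      then obtain u' where u': "u' \<in> N" "u = P (Suc j) u'" using u by (auto simp: G_def)
      then obtain w where "w \<in> N" "u \<cdot> z = P (Suc (Suc j)) w" using powers by blast
      then show ?thesis using 3 by (auto simp: G_def simp del: P_simps)
    qed
  qed
  have start: "N \<subseteq> G 0" and stop: "G (2 * n + 1) \<subseteq> {0}"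
    using P_vanish_N n3 by (auto simp: G_def)
  show ?thesis
    by (rule in_radical_if_flag[where G = G and z = z and k = "2 * n + 1", OF maximal z sub start GN Gz stop])
qed

text \<open>An odd $z$ satisfies $[[u,y],z] = [u,[y,z]] - [[u,z],y]$, where $[y,z]$ is even and so acts on $N$ by a multiple
of $R^2$. Thus the action of $z$ on $RN$ is controlled by its action on $N$, with one more factor $R$. For
$[e,z]$ the same identity gives $R[e,z]=0$, which excludes a component along $y$.\<close>

lemma odd_in_radical:
  assumes maximal: "\<And>M. nilpotent_ideal_over_square L M \<Longrightarrow> N \<subseteq> M \<Longrightarrow> M = N"
    and z: "z \<in> L1"
  shows "z \<in> N"
proof -
  obtain s w where w: "w \<in> L1" "w \<in> N" "y \<cdot> z = s *s e + w \<cdot> y"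
    using even_step[of "y \<cdot> z"] z by auto
  obtain c where c: "\<And>u. u \<in> carrier L \<Longrightarrow> u \<cdot> (w \<cdot> y) = c *s (u \<cdot> y \<cdot> y)"
    using bracket_right_even[OF w(1,2)] by blast
  have yz: "u \<cdot> y \<cdot> z = c *s (u \<cdot> y \<cdot> y) - u \<cdot> z \<cdot> y" if "u \<in> N" for u
  proof -
    have "u \<cdot> (y \<cdot> z) = u \<cdot> y \<cdot> z + u \<cdot> z \<cdot> y" using leibniz_odd[of u y z] that z by simp
    moreover have "u \<cdot> (y \<cdot> z) = c *s (u \<cdot> y \<cdot> y)" using that w c by simp
    ultimately show ?thesis by simp
  qed
  have ez: "\<exists>w. w \<in> N \<and> e \<cdot> z = w \<cdot> y"
  proof -
    have 0: "e \<cdot> z \<cdot> y = 0" using yz[of e] z by simp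
    obtain d w' where w': "w' \<in> L1" "w' \<in> N" "e \<cdot> z = d *s y + w' \<cdot> y \<cdot> y"
      using odd_step[of "e \<cdot> z"] z by auto
    have "P 1 (d *s y + w' \<cdot> y \<cdot> y) = 0" using 0 unfolding w'(3)[symmetric] by simp
    then have "d = 0" using n3 by (intro lead_zero[OF w'(1,2), of 1]) simp_all
    then show ?thesis using w' by (intro exI[of _ "w' \<cdot> y"]) simp
  qed
  have all: "\<exists>c w. w \<in> N \<and> u \<cdot> z = c *s e + w \<cdot> y" if uN: "u \<in> N" for u
  proof -
    obtain u0 u1 where u: "u0 \<in> L0" "u0 \<in> N" "u1 \<in> L1" "u1 \<in> N" "u = u0 + u1"
      using uN by (rule N_cases)
    obtain d v where v: "v \<in> L1" "v \<in> N" "u0 = d *s e + v \<cdot> y"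
      using even_step u by blast
    obtain a v' where v': "v' \<in> L1" "v' \<in> N" "u1 = a *s y + v' \<cdot> y \<cdot> y"
      using odd_step u by blast
    obtain w' where w': "w' \<in> N" "e \<cdot> z = w' \<cdot> y" using ez by blast
    let ?q = "d *s w' + c *s (v \<cdot> y) - v \<cdot> z + a *s w + c *s (v' \<cdot> y \<cdot> y) - v' \<cdot> y \<cdot> z"
    have "u \<cdot> z = d *s (w' \<cdot> y) + (v \<cdot> y \<cdot> z) + a *s (s *s e + w \<cdot> y) + (v' \<cdot> y \<cdot> y \<cdot> z)"
      using u v v' w w' z by (simp add: algebra_simps)
    also have "\<dots> = (a * s) *s e + ?q \<cdot> y"
      using u v v' w w' z yz[of v] yz[of "v' \<cdot> y"] by (simp add: algebra_simps)
    finally have "u \<cdot> z = (a * s) *s e + ?q \<cdot> y" .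
    moreover have "?q \<in> N" using u v v' w w' z by simp
    ultimately show ?thesis by blast
  qed
  have "\<exists>w. w \<in> N \<and> P (Suc j) u \<cdot> z = P (Suc (Suc j)) w" if u: "u \<in> N" for j u
  proof (induction j)
    case 0
    obtain d w where w: "w \<in> N" "u \<cdot> z = d *s e + w \<cdot> y" using all u by blast
    then have "P (Suc 0) u \<cdot> z = P (Suc (Suc 0)) (c *s u - w)"
      using yz[OF u] u by simp
    then show ?case using u w by (intro exI[of _ "c *s u - w"]) simp
  next
    case (Suc j)
    then obtain w where w: "w \<in> N" "P (Suc j) u \<cdot> z = P (Suc (Suc j)) w" by blast
    have "P (Suc (Suc j)) u \<cdot> z = P (Suc (Suc (Suc j))) (c *s u - w)"
      using yz[of "P (Suc j) u"] u w by simp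
    then show ?case using u w by (intro exI[of _ "c *s u - w"]) simp
  qed
  then show ?thesis using in_radical_if_lowers[OF maximal _ all ez] z by blast
qed

section \<open>Weights of even elements\<close>

text \<open>The action of an even element modulo lower terms of the chain. That the weights on the two sides of $y$ are
opposite is forced by the Leibniz identity.\<close>

definition weights :: "'a \<Rightarrow> complex \<Rightarrow> complex \<Rightarrow> complex \<Rightarrow> bool" where
  "weights x \<alpha> \<beta> \<epsilon> \<longleftrightarrow>
     (\<exists>z. z \<in> L1 \<and> z \<in> N \<and> y \<cdot> x = \<alpha> *s y + z \<cdot> y \<cdot> y) \<and>
     (\<exists>z. z \<in> L1 \<and> z \<in> N \<and> x \<cdot> y = - (\<alpha> *s y) + z \<cdot> y \<cdot> y) \<and>
     e \<cdot> x = \<beta> *s e \<and> x \<cdot> e = \<epsilon> *s e"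

text \<open>$x$ acts as a derivation and the tail $R^2z$ of $[y,x]$ annihilates, so $x$ commutes with $R$ up to $\alpha R$.
Hence $R^k y$ has weight $(k+1)\alpha$ modulo lower terms.\<close>

lemma right_commute:
  assumes x: "x \<in> L0" and yx: "y \<cdot> x = \<alpha> *s y + z \<cdot> y \<cdot> y"
    and z: "z \<in> L1" "z \<in> N" and u: "u \<in> carrier L"
  shows "u \<cdot> y \<cdot> x = u \<cdot> x \<cdot> y + \<alpha> *s (u \<cdot> y)"
  using derivation[of u y x] annihilator[OF z u] x z u by (simp add: yx add.commute)

lemma right_commute_P:
  assumes x: "x \<in> L0" and yx: "y \<cdot> x = \<alpha> *s y + z \<cdot> y \<cdot> y"
    and z: "z \<in> L1" "z \<in> N" and u: "u \<in> carrier L"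
  shows "P k u \<cdot> x = P k (u \<cdot> x) + (of_nat k * \<alpha>) *s P k u"
  by (induction k) (use right_commute[OF x yx z] x u in \<open>simp_all add: algebra_simps\<close>)

text \<open>The sum $[x,y]+[y,x]$ is a right annihilator, so $[y,\cdot]$ kills it and the weights on $y$ are opposite.
Both $[e,x]$ and $[x,e]$ are killed by $R$, because $[e,y]=0$; an even element of $N$ killed by $R$ lies on
the line of $e$.\<close>

lemma weights_exist:
  assumes x: "x \<in> L0"
  obtains \<alpha> \<beta> \<epsilon> where "weights x \<alpha> \<beta> \<epsilon>"
proof -
  obtain \<alpha> z where z: "z \<in> L1" "z \<in> N" and yx: "y \<cdot> x = \<alpha> *s y + z \<cdot> y \<cdot> y"
    using odd_step[of "y \<cdot> x"] x by auto
  obtain b z' where z': "z' \<in> L1" "z' \<in> N" and xy: "x \<cdot> y = b *s y + z' \<cdot> y \<cdot> y"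
    using odd_step[of "x \<cdot> y"] x by auto
  have "y \<cdot> (x \<cdot> y) + y \<cdot> (y \<cdot> x) = 0"
    using leibniz_even_odd[of y x y] leibniz_even[of y y x] x by simp
  then have "(b + \<alpha>) *s (y \<cdot> y) = 0"
    using annihilator[OF z, of y] annihilator[OF z', of y] z z'
    by (simp add: xy yx vs.scale_left_distrib)
  then have b: "b = - \<alpha>" using yy_nonzero by (simp add: eq_neg_iff_add_eq_0)
  obtain \<beta> v where v: "v \<in> L1" "v \<in> N" and ex: "e \<cdot> x = \<beta> *s e + v \<cdot> y"
    using even_step[of "e \<cdot> x"] x by auto
  have "e \<cdot> x \<cdot> y = 0" using right_commute[OF x yx z, of e] x by simp
  then have "v \<cdot> y = 0" using odd_kernel[OF v] v by (simp add: ex)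
  moreover obtain \<epsilon> v' where v': "v' \<in> L1" "v' \<in> N" and xe: "x \<cdot> e = \<epsilon> *s e + v' \<cdot> y"
    using even_step[of "x \<cdot> e"] x by auto
  have "x \<cdot> e \<cdot> y = 0" using leibniz_even_odd[of x e y] x by simp
  then have "v' \<cdot> y = 0" using odd_kernel[OF v'] v' by (simp add: xe)
  ultimately have "weights x \<alpha> \<beta> \<epsilon>"
    unfolding weights_def using z z' yx xy ex xe b by auto
  then show ?thesis using that by blast
qed

text \<open>Expanding $[x,[x,e]]$ by the Leibniz identity, with $[[x,x],e]=0$, gives $\varepsilon^2=-\varepsilon\beta$.\<close>

lemma weights_left:
  assumes x: "x \<in> L0" and w: "weights x \<alpha> \<beta> \<epsilon>"
  shows "\<epsilon> = 0 \<or> \<epsilon> = - \<beta>"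
proof -
  have "x \<cdot> (x \<cdot> e) = x \<cdot> x \<cdot> e - x \<cdot> e \<cdot> x" using leibniz_even[of x x e] x by simp
  then have "(\<epsilon> * (\<epsilon> + \<beta>)) *s e = 0"
    using w x by (simp add: weights_def algebra_simps)
  then show ?thesis using e_nonzero by (simp add: eq_neg_iff_add_eq_0)
qed

lemma weights_linear:
  assumes x: "x \<in> L0" "x' \<in> L0" and w: "weights x \<alpha> \<beta> \<epsilon>" "weights x' \<alpha>' \<beta>' \<epsilon>'"
  shows "weights (x + c *s x') (\<alpha> + c * \<alpha>') (\<beta> + c * \<beta>') (\<epsilon> + c * \<epsilon>')"
proof -
  obtain z v where 1: "z \<in> L1" "z \<in> N" "y \<cdot> x = \<alpha> *s y + z \<cdot> y \<cdot> y"
      "v \<in> L1" "v \<in> N" "x \<cdot> y = - (\<alpha> *s y) + v \<cdot> y \<cdot> y"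
    using w(1) unfolding weights_def by blast
  obtain z' v' where 2: "z' \<in> L1" "z' \<in> N" "y \<cdot> x' = \<alpha>' *s y + z' \<cdot> y \<cdot> y"
      "v' \<in> L1" "v' \<in> N" "x' \<cdot> y = - (\<alpha>' *s y) + v' \<cdot> y \<cdot> y"
    using w(2) unfolding weights_def by blast
  show ?thesis
    unfolding weights_def
  proof (intro conjI)
    show "\<exists>u. u \<in> L1 \<and> u \<in> N \<and> y \<cdot> (x + c *s x') = (\<alpha> + c * \<alpha>') *s y + u \<cdot> y \<cdot> y"
      using 1 2 x by (intro exI[of _ "z + c *s z'"]) (simp add: algebra_simps)
    show "\<exists>u. u \<in> L1 \<and> u \<in> N \<and> (x + c *s x') \<cdot> y = - ((\<alpha> + c * \<alpha>') *s y) + u \<cdot> y \<cdot> y"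
      using 1(1,2,4,5) 2(1,2,4,5) x by (intro exI[of _ "v + c *s v'"]) (simp add: 1(6) 2(6) algebra_simps)
  qed (use w x in \<open>simp_all add: weights_def algebra_simps\<close>)
qed

lemma weights_N:
  assumes m: "m \<in> N" "m \<in> L0"
  shows "weights m 0 0 0"
proof -
  obtain a b where ab: "\<And>u. u \<in> N \<Longrightarrow> u \<cdot> m = a *s (u \<cdot> y) + b *s (u \<cdot> y \<cdot> y)"
    using bracket_N_right[OF m(1)] by blast
  have "a *s (y \<cdot> y) = y \<cdot> m - b *s (y \<cdot> y \<cdot> y)" using ab[of y] by simp
  also have "\<dots> \<in> L1" using m by simp
  finally have "a *s (y \<cdot> y) = 0" by (intro parity_disjoint) simp_all
  then have "a = 0" using yy_nonzero by simp
  then have "y \<cdot> m = 0 *s y + (b *s y) \<cdot> y \<cdot> y" using ab[of y] by simp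
  moreover obtain c z where z: "z \<in> L1" "z \<in> N" "m = c *s e + z \<cdot> y"
    using even_step m by blast
  moreover have "e \<cdot> m = 0" using ab[of e] by simp
  ultimately have "m \<cdot> y = - (0 *s y) + z \<cdot> y \<cdot> y" "m \<cdot> e = 0 *s e" "e \<cdot> m = 0 *s e"
    "z \<in> L1" "z \<in> N" "y \<cdot> m = 0 *s y + (b *s y) \<cdot> y \<cdot> y"
    using m(1) by simp_all
  then show ?thesis
    unfolding weights_def using y vs.subspace_scale[OF subspace_odd] vs.subspace_scale[OF subspace_N] by metis
qed

text \<open>With $\alpha=0$ the action of $x$ commutes with $R$, so it is determined by $[y,x]\in R^2N$ and $[e,x]=0$, and
lowers the whole flag.\<close>

lemma even_in_radical:
  assumes maximal: "\<And>M. nilpotent_ideal_over_square L M \<Longrightarrow> N \<subseteq> M \<Longrightarrow> M = N"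
    and x: "x \<in> L0" and w: "weights x 0 0 \<epsilon>"
  shows "x \<in> N"
proof -
  obtain z where z: "z \<in> L1" "z \<in> N" "y \<cdot> x = 0 *s y + z \<cdot> y \<cdot> y"
    using w unfolding weights_def by blast
  have ex: "e \<cdot> x = 0" using w unfolding weights_def by simp
  note comm = right_commute_P[OF x z(3,1,2)]
  have all: "\<exists>c w. w \<in> N \<and> u \<cdot> x = c *s e + w \<cdot> y" if uN: "u \<in> N" for u
  proof -
    obtain u0 u1 where u: "u0 \<in> L0" "u0 \<in> N" "u1 \<in> L1" "u1 \<in> N" "u = u0 + u1"
      using uN by (rule N_cases)
    obtain d v where v: "v \<in> L1" "v \<in> N" "u0 = d *s e + v \<cdot> y"
      using even_step u by blast
    obtain a v' where v': "v' \<in> L1" "v' \<in> N" "u1 = a *s y + v' \<cdot> y \<cdot> y"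
      using odd_step u by blast
    have "v' \<cdot> y \<cdot> y \<cdot> x = v' \<cdot> x \<cdot> y \<cdot> y" "v \<cdot> y \<cdot> x = v \<cdot> x \<cdot> y"
      using comm[of v' 2] comm[of v 1] v v' by (simp_all add: numeral_2_eq_2)
    then have "u \<cdot> x = 0 *s e + (v \<cdot> x + a *s (z \<cdot> y) + v' \<cdot> x \<cdot> y) \<cdot> y"
      using u v v' z x ex by simp
    moreover have "v \<cdot> x + a *s (z \<cdot> y) + v' \<cdot> x \<cdot> y \<in> N" using v v' z x by simp
    ultimately show ?thesis by blast
  qed
  have powers: "\<exists>w. w \<in> N \<and> P (Suc j) u \<cdot> x = P (Suc (Suc j)) w" if u: "u \<in> N" for j u
  proof -
    obtain d w where w: "w \<in> N" "u \<cdot> x = d *s e + w \<cdot> y" using all u by blast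
    have "P (Suc j) e = 0" using P_bracket[of j e] by simp
    then have "P (Suc j) u \<cdot> x = P (Suc (Suc j)) w"
      using comm[of u "Suc j"] u w P_bracket[of "Suc j" w] by (simp del: P_simps) (simp add: P_bracket)
    then show ?thesis using w by blast
  qed
  have "\<exists>w. w \<in> N \<and> e \<cdot> x = w \<cdot> y" using ex by (intro exI[of _ 0]) simp
  then show ?thesis using in_radical_if_lowers[OF maximal _ all _ powers] x by blast
qed

end

section \<open>Normal forms of the complement\<close>

context frame
begin

lemma even_kernel:
  assumes z: "z \<in> L0" "z \<in> N" and 0: "z \<cdot> y = 0"
  obtains \<xi> where "z = \<xi> *s e"
proof -
  obtain c v where v: "v \<in> L1" "v \<in> N" "z = c *s e + v \<cdot> y"
    using even_step z by blast
  then have "v \<cdot> y = 0" using odd_kernel[OF v(1,2)] 0 by simp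
  then show ?thesis using that[of c] v by simp
qed

lemma bracket_new_generator:
  assumes w: "w \<in> L1" "w \<in> N" and u: "u \<in> carrier L"
  shows "u \<cdot> (y + w \<cdot> y \<cdot> y) = u \<cdot> y"
    and "u \<cdot> (y + w \<cdot> y \<cdot> y) \<cdot> (y + w \<cdot> y \<cdot> y) = u \<cdot> y \<cdot> y"
proof -
  have R: "v \<cdot> (y + w \<cdot> y \<cdot> y) = v \<cdot> y" if "v \<in> carrier L" for v
    using annihilator[OF w that] that w by simp
  show "u \<cdot> (y + w \<cdot> y \<cdot> y) = u \<cdot> y" using u by (rule R)
  show "u \<cdot> (y + w \<cdot> y \<cdot> y) \<cdot> (y + w \<cdot> y \<cdot> y) = u \<cdot> y \<cdot> y"
    using R[OF u] R[of "u \<cdot> y"] u by simp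
qed

text \<open>Adding to the generator an element of $R^2N_1$ does not change right multiplication by it, since $R^2N_1$
annihilates. So the powers of $R$ are the same, and only the step condition for odd elements has to be
rewritten.\<close>

lemma change_chain:
  assumes w: "w \<in> L1" "w \<in> N"
  shows "frame L N n (y + w \<cdot> y \<cdot> y) e"
proof -
  let ?y = "y + w \<cdot> y \<cdot> y"
  note R = bracket_new_generator(1)[OF w] and RR = bracket_new_generator(2)[OF w]
  have pow: "right_pow L ?y k u = P k u" if "u \<in> carrier L" for k u
  proof (induction k)
    case (Suc k)
    have "right_pow L ?y (Suc k) u = right_pow L ?y k u \<cdot> ?y" by (simp add: right_pow_def)
    also have "\<dots> = P k u \<cdot> y" unfolding Suc.IH using R that by simp
    finally show ?case by simp
  qed (simp add: right_pow_def)
  show ?thesis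
  proof unfold_locales
    show "?y \<in> L1" "?y \<in> N" using w by simp_all
    show "3 \<le> n" "e \<in> L0" "e \<in> N" "e \<noteq> 0" using n3 e_nonzero by simp_all
    show "e \<cdot> ?y = 0" by (simp add: R)
    show "z \<cdot> e = 0" if "z \<in> N" for z using that by simp
    show "\<exists>c z'. z' \<in> L1 \<and> z' \<in> N \<and> z = c *s ?y + z' \<cdot> ?y \<cdot> ?y"
      if z: "z \<in> L1" "z \<in> N" for z
    proof -
      obtain c z' where z': "z' \<in> L1" "z' \<in> N" "z = c *s y + z' \<cdot> y \<cdot> y"
        using odd_step z by blast
      have "z = c *s ?y + (z' - c *s w) \<cdot> ?y \<cdot> ?y"
        using z' w by (subst RR) (simp_all add: algebra_simps)
      then show ?thesis using z' w by (intro exI[of _ c] exI[of _ "z' - c *s w"]) simp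
    qed
    show "\<exists>c z'. z' \<in> L1 \<and> z' \<in> N \<and> z = c *s e + z' \<cdot> ?y"
      if z: "z \<in> L0" "z \<in> N" for z
    proof -
      obtain c z' where "z' \<in> L1" "z' \<in> N" "z = c *s e + z' \<cdot> y"
        using even_step z by blast
      then have "z' \<in> L1 \<and> z' \<in> N \<and> z = c *s e + z' \<cdot> ?y"
        using R[of z'] by simp
      then show ?thesis by blast
    qed
    show "right_pow L ?y (2 * n - 1) z = 0" if "z \<in> L1" "z \<in> N" for z
      using that stop by (simp add: pow)
    have "P (2 * n - 2 + 2) w = 0" using w by (intro P_vanish) auto
    then have "P (2 * n - 2) ?y = P (2 * n - 2) y" using w by (simp add: P_bracket)
    then show "right_pow L ?y (2 * n - 2) ?y \<noteq> 0" using top w by (simp add: pow)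
  qed
qed

lemma change_split:
  assumes c: "c \<noteq> 0"
  shows "frame L N n y (c *s e)"
proof unfold_locales
  show "\<exists>d z'. z' \<in> L1 \<and> z' \<in> N \<and> z = d *s c *s e + z' \<cdot> y"
    if z: "z \<in> L0" "z \<in> N" for z
  proof -
    obtain d z' where "z' \<in> L1" "z' \<in> N" "z = d *s e + z' \<cdot> y"
      using even_step z by blast
    then show ?thesis using c by (intro exI[of _ "d / c"] exI[of _ z']) simp
  qed
qed (use n3 odd_step top stop e_nonzero c in simp_all)

text \<open>Successive approximation: an error $R^{2m}v$ has leading term $cR^{2m}y$, and since $R^{2m}y$ has weight $2m+1$,
subtracting $\frac{c}{2m}R^{2m}y$ from the current vector cancels it. The powers of $R$ run out after finitely
many steps.\<close>

lemma eigenvector: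
  assumes x: "x \<in> L0" and z: "z \<in> L1" "z \<in> N" and yx: "y \<cdot> x = 1 *s y + z \<cdot> y \<cdot> y"
  obtains w where "w \<in> L1" "w \<in> N" "(y + w \<cdot> y \<cdot> y) \<cdot> x = y + w \<cdot> y \<cdot> y"
proof -
  have "\<exists>w v. w \<in> L1 \<and> w \<in> N \<and> v \<in> L1 \<and> v \<in> N \<and>
      (y + w \<cdot> y \<cdot> y) \<cdot> x = y + w \<cdot> y \<cdot> y + P (2 * Suc m) v" for m
  proof (induction m)
    case 0
    show ?case by (rule exI[of _ 0], rule exI[of _ z]) (use z x yx in \<open>simp add: numeral_2_eq_2\<close>)
  next
    case (Suc m)
    then obtain w v where w: "w \<in> L1" "w \<in> N" and v: "v \<in> L1" "v \<in> N"
      and eq: "(y + w \<cdot> y \<cdot> y) \<cdot> x = y + w \<cdot> y \<cdot> y + P (2 * Suc m) v" by blast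
    obtain c v' where v': "v' \<in> L1" "v' \<in> N" "v = c *s y + v' \<cdot> y \<cdot> y"
      using odd_step v by blast
    define k where "k = 2 * Suc m"
    define d where "d = c / of_nat k"
    have k: "of_nat k \<noteq> (0::complex)" by (simp only: of_nat_eq_0_iff k_def) simp
    have Pk: "P (2 * m) y \<cdot> y \<cdot> y = P k y" by (simp add: k_def)
    have Pkx: "P k y \<cdot> x = (of_nat k + 1) *s P k y + P (2 * Suc (Suc m)) z"
    proof -
      have "P k y \<cdot> x = P k (y \<cdot> x) + of_nat k *s P k y"
        using right_commute_P[OF x yx z, of y k] by simp
      moreover have "P k (y \<cdot> x) = P k y + P (k + 2) z"
        unfolding yx using z by (simp add: P_two)
      moreover have "2 * Suc (Suc m) = k + 2" by (simp add: k_def)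
      ultimately show ?thesis by (simp add: vs.scale_left_distrib del: P_simps)
    qed
    define w' where "w' = w - d *s P (2 * m) y"
    have w': "w' \<in> L1" "w' \<in> N" using w by (simp_all add: w'_def)
    have w'yy: "y + w' \<cdot> y \<cdot> y = (y + w \<cdot> y \<cdot> y) - d *s P k y"
      using w Pk by (simp add: w'_def)
    have Pv: "P k v = c *s P k y + P (2 * Suc (Suc m)) v'"
      using v' by (simp add: k_def P_bracket)
    have "(y + w' \<cdot> y \<cdot> y) \<cdot> x = (y + w \<cdot> y \<cdot> y) \<cdot> x - d *s (P k y \<cdot> x)"
      unfolding w'yy using x w by (simp add: k_def)
    also have "\<dots> = y + w \<cdot> y \<cdot> y + P k v - d *s ((of_nat k + 1) *s P k y + P (2 * Suc (Suc m)) z)"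
      unfolding eq Pkx by (simp only: k_def)
    also have "\<dots> = (y + w \<cdot> y \<cdot> y - d *s P k y) + (P (2 * Suc (Suc m)) v' - d *s P (2 * Suc (Suc m)) z)
        + (c - d * of_nat k) *s P k y"
      unfolding Pv by (simp add: algebra_simps del: P_simps)
    also have "\<dots> = y + w' \<cdot> y \<cdot> y + P (2 * Suc (Suc m)) (v' - d *s z)"
      unfolding w'yy using k v' z by (simp add: d_def del: P_simps)
    finally have "(y + w' \<cdot> y \<cdot> y) \<cdot> x = y + w' \<cdot> y \<cdot> y + P (2 * Suc (Suc m)) (v' - d *s z)" .
    moreover have "v' - d *s z \<in> L1" "v' - d *s z \<in> N" using v' z by simp_all
    ultimately show ?case using w' by blast
  qed
  then obtain w v where w: "w \<in> L1" "w \<in> N" and v: "v \<in> L1" "v \<in> N"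
    and eq: "(y + w \<cdot> y \<cdot> y) \<cdot> x = y + w \<cdot> y \<cdot> y + P (2 * Suc n) v" by blast
  have "P (2 * Suc n) v = 0" using v by (intro P_vanish) auto
  then show ?thesis using that w eq by simp
qed

lemma cube_zero: "x \<in> L0 \<Longrightarrow> x \<cdot> (x \<cdot> x) = 0"
  using leibniz_even[of x x x] by simp

text \<open>Expanding $[x,[x,y]]$ shows that $R[x,x]=0$, so $[x,x]=\xi e$; then $[x,[x,x]]=0$ reads $\xi\varepsilon=0$.\<close>

lemma square_split:
  assumes x: "x \<in> L0" and xy: "x \<cdot> y = - (\<alpha> *s y)"
    and yx: "\<alpha> *s (y \<cdot> x) = \<alpha> *s \<alpha> *s y" and xe: "x \<cdot> e = \<epsilon> *s e"
  obtains \<xi> where "x \<cdot> x = \<xi> *s e" "\<xi> * \<epsilon> = 0"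
proof -
  have "x \<cdot> (x \<cdot> y) = x \<cdot> x \<cdot> y - x \<cdot> y \<cdot> x"
    using leibniz_even_odd[of x x y] x by simp
  then have "x \<cdot> x \<cdot> y = 0" using x yx by (simp add: xy)
  then obtain \<xi> where xi: "x \<cdot> x = \<xi> *s e"
    using even_kernel[of "x \<cdot> x"] x by auto
  moreover have "(\<xi> * \<epsilon>) *s e = 0" using cube_zero[OF x] x by (simp add: xi xe)
  ultimately show ?thesis using that e_nonzero by auto
qed

text \<open>Write $[x,y]=-y+R^2z$. Passing from $x$ to $x-Rz$ removes the tail, but if $z$ has a component $by$ it also
changes $[y,x]$, since $y$ is moved by right multiplication with $Ry$. The proof shows that $b=0$:
expanding $[x,[x,y]]$ gives $[x,x]=\xi e+R([z,x]+z)$, which has $e_1$-component $2b$, and then $[x,[x,x]]=0$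
has $e_1$-component $-4b$.\<close>

lemma normalise_diagonal:
  assumes x: "x \<in> L0" and w: "weights x 1 \<beta> \<epsilon>" and yx: "y \<cdot> x = y"
  obtains x' where "x' \<in> L0" "x - x' \<in> N" "weights x' 1 \<beta> \<epsilon>" "y \<cdot> x' = y" "x' \<cdot> y = - y"
proof -
  obtain z where z: "z \<in> L1" "z \<in> N" and xy: "x \<cdot> y = - y + z \<cdot> y \<cdot> y"
    using w unfolding weights_def by auto
  have xe: "x \<cdot> e = \<epsilon> *s e" using w unfolding weights_def by blast
  have yx1: "y \<cdot> x = 1 *s y + 0 \<cdot> y \<cdot> y" using yx by simp
  have comm: "u \<cdot> y \<cdot> y \<cdot> x = (u \<cdot> x + 2 *s u) \<cdot> y \<cdot> y" if "u \<in> carrier L" for u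
    using right_commute_P[OF x yx1 _ _ that, of 2] that x by (simp add: numeral_2_eq_2)
  obtain b z2 where z2: "z2 \<in> L1" "z2 \<in> N" and zb: "z = b *s y + z2 \<cdot> y \<cdot> y"
    using odd_step z by blast
  obtain \<xi> v where v: "v \<in> L1" "v \<in> N" and xx: "x \<cdot> x = \<xi> *s e + v \<cdot> y"
    using even_step[of "x \<cdot> x"] x by auto
  have "x \<cdot> (x \<cdot> y) = x \<cdot> x \<cdot> y - x \<cdot> y \<cdot> x"
    using leibniz_even_odd[of x x y] x by simp
  moreover have "x \<cdot> (x \<cdot> y) = - (x \<cdot> y)"
    using annihilator[OF z, of x] x z by (simp add: xy)
  ultimately have "x \<cdot> x \<cdot> y - x \<cdot> y \<cdot> x = - (x \<cdot> y)" by metis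
  then have "x \<cdot> x \<cdot> y = x \<cdot> y \<cdot> x - x \<cdot> y" by (simp add: diff_eq_eq)
  also have "\<dots> = (z \<cdot> x + z) \<cdot> y \<cdot> y"
    using x z comm[of z] vs.scale_left_distrib[of 1 1 "z \<cdot> y \<cdot> y"] by (simp add: xy yx)
  finally have "v \<cdot> y \<cdot> y = (z \<cdot> x + z) \<cdot> y \<cdot> y" using v by (simp add: xx)
  then have "(v - (z \<cdot> x + z)) \<cdot> y = 0"
    using v z x by - (rule odd_kernel; simp)
  then have vy: "v \<cdot> y = (z \<cdot> x + z) \<cdot> y" using v z x by simp
  have "z \<cdot> x + z = (2 * b) *s y + (z2 \<cdot> x + 3 *s z2) \<cdot> y \<cdot> y"
  proof -
    have "z \<cdot> x = b *s y + (z2 \<cdot> x + 2 *s z2) \<cdot> y \<cdot> y"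
      using comm[of z2] z2 x by (simp add: zb yx)
    moreover have "(2 * b) *s y = b *s y + b *s y" "3 *s (z2 \<cdot> y \<cdot> y) = 2 *s (z2 \<cdot> y \<cdot> y) + z2 \<cdot> y \<cdot> y"
      using vs.scale_left_distrib[of b b y] vs.scale_left_distrib[of 2 1 "z2 \<cdot> y \<cdot> y"] by simp_all
    ultimately show ?thesis using z2 x by (simp add: zb)
  qed
  then have "x \<cdot> (v \<cdot> y) = (2 * b) *s (x \<cdot> (y \<cdot> y))"
    unfolding vy using z2 x annihilator'[of "z2 \<cdot> x + 3 *s z2" x] by simp
  also have "\<dots> = (4 * b) *s (((- 1) *s y + z \<cdot> y \<cdot> y) \<cdot> y)"
    using x z by (simp add: bracket_yy xy)
  finally have "0 = (\<xi> * \<epsilon>) *s e + (4 * b) *s (((- 1) *s y + z \<cdot> y \<cdot> y) \<cdot> y)"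
    using cube_zero[OF x] x v xe by (simp add: xx)
  then have "0 = ((\<xi> * \<epsilon>) *s e + (4 * b) *s (((- 1) *s y + z \<cdot> y \<cdot> y) \<cdot> y)) \<cdot> y" by simp
  then have "(4 * b) *s P 2 ((- 1) *s y + z \<cdot> y \<cdot> y) = 0"
    using z by (simp add: numeral_2_eq_2)
  \<comment> \<open>The multiple of \<open>e\<close> disappears under \<open>R\<close>, and the leading term that is left is \<open>-4b R\<^sup>2y\<close>.\<close>
  then have b: "b = 0"
  proof -
    have "2 \<le> 2 * n - 2" using n3 by linarith
    then have "P 2 ((- 1) *s y + z \<cdot> y \<cdot> y) \<noteq> 0"
      using lead_zero[OF z, of 2 "- 1"] by fastforce
    then show ?thesis
      using \<open>(4 * b) *s P 2 ((- 1) *s y + z \<cdot> y \<cdot> y) = 0\<close> unfolding vs.scale_eq_0_iff by simp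
  qed
  define x' where "x' = x - z \<cdot> y"
  have x': "x' \<in> L0" "x - x' \<in> N" using x z by (simp_all add: x'_def)
  moreover have "weights x' 1 \<beta> \<epsilon>"
    using weights_linear[OF x _ w weights_N, of "z \<cdot> y" "-1"] z by (simp add: x'_def)
  moreover have "y \<cdot> x' = y"
    using annihilator'[of z2 y] z2 z x by (simp add: x'_def yx) (simp add: zb b)
  moreover have "x' \<cdot> y = - y" using x z by (simp add: x'_def xy)
  ultimately show ?thesis using that by blast
qed

lemma normalise_nilpotent:
  assumes x: "x \<in> L0" and w: "weights x 0 \<beta> \<epsilon>"
  obtains x' where "x' \<in> L0" "x - x' \<in> N" "weights x' 0 \<beta> \<epsilon>" "x' \<cdot> y = 0"
proof -
  obtain z where z: "z \<in> L1" "z \<in> N" and xy: "x \<cdot> y = z \<cdot> y \<cdot> y"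
    using w unfolding weights_def by auto
  have "weights (x - z \<cdot> y) 0 \<beta> \<epsilon>"
    using weights_linear[OF x _ w weights_N, of "z \<cdot> y" "-1"] z by simp
  then show ?thesis using that[of "x - z \<cdot> y"] x z by (simp add: xy)
qed

text \<open>On $R N_1$ the element $x$ acts with the nonzero eigenvalues $2, 4, 6, \dots$, hence injectively.\<close>

lemma diagonal_kernel:
  assumes x: "x \<in> L0" "y \<cdot> x = y" and v: "v \<in> L1" "v \<in> N" and 0: "v \<cdot> y \<cdot> x = 0"
  shows "v \<cdot> y = 0"
proof -
  have yx: "y \<cdot> x = 1 *s y + 0 \<cdot> y \<cdot> y" using x(2) by simp
  obtain c where c: "v = (\<Sum>k<n. c k *s P (2 * k) y)" using v by (rule odd_expand)
  have eigen: "P (2 * k) y \<cdot> y \<cdot> x = (2 * of_nat k + 2) *s (P (2 * k) y \<cdot> y)" for k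
  proof -
    have "P (Suc (2 * k)) y \<cdot> x = 1 *s P (Suc (2 * k)) y + of_nat (Suc (2 * k)) *s P (Suc (2 * k)) y"
      using right_commute_P[OF x(1) yx, of y "Suc (2 * k)"] x(2) by (simp del: P_simps)
    also have "\<dots> = (1 + of_nat (Suc (2 * k))) *s P (Suc (2 * k)) y"
      by (rule vs.scale_left_distrib[symmetric])
    also have "1 + of_nat (Suc (2 * k)) = 2 * of_nat k + (2 :: complex)" by simp
    finally show ?thesis by simp
  qed
  have "v \<cdot> y \<cdot> x = (\<Sum>k<n. (c k * (2 * of_nat k + 2)) *s P (2 * k) y) \<cdot> y"
    unfolding c using x(1) by (simp add: bracket_sums eigen)
  then have sum0: "(\<Sum>k<n - 1. (c k * (2 * of_nat k + 2)) *s P (2 * k + 1) y) = 0"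
    using 0 unfolding expansion_bracket by simp
  have "c k = 0" if "k < n - 1" for k
  proof -
    have "c k * (2 * of_nat k + 2) = 0" using even_independent[OF sum0 that] .
    moreover have "2 * of_nat k + 2 = (of_nat (2 * k + 2) :: complex)" by simp
    moreover have "of_nat (2 * k + 2) \<noteq> (0 :: complex)" by (simp only: of_nat_eq_0_iff)
    ultimately show ?thesis by (metis mult_eq_0_iff)
  qed
  then show ?thesis unfolding c expansion_bracket by simp
qed

text \<open>For two generators with weights $(1,0)$ and $(0,1)$ the Leibniz identity leaves no freedom beyond multiples of
$e$. The tail $R^2z$ of $[y,x_2]$ vanishes because $[x_1,x_2]$ equals $-Rz$ modulo $e$, while $[x_1,[x_2,x_1]]$
shows that $x_1$ annihilates $Rz$ from the right.\<close>

lemma pair_relations: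
  assumes x1: "x1 \<in> L0" "y \<cdot> x1 = y" "x1 \<cdot> y = - y" "weights x1 1 0 \<epsilon>1"
    and x2: "x2 \<in> L0" "x2 \<cdot> y = 0" "weights x2 0 1 \<epsilon>2"
  obtains \<eta>12 \<eta>21 \<xi>2 where "y \<cdot> x2 = 0" "\<epsilon>1 = 0" "\<epsilon>2 = 0 \<or> \<epsilon>2 = - 1" "x1 \<cdot> x1 = 0" "x2 \<cdot> x2 = \<xi>2 *s e" "\<xi>2 * \<epsilon>2 = 0"
    "x1 \<cdot> x2 = \<eta>12 *s e" "x2 \<cdot> x1 = \<eta>21 *s e" "\<eta>12 * \<epsilon>2 = \<eta>21"
proof -
  have e1: "\<epsilon>1 = 0" using weights_left[OF x1(1,4)] by simp
  have e2: "\<epsilon>2 = 0 \<or> \<epsilon>2 = - 1" using weights_left[OF x2(1,3)] by simp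
  have ex: "e \<cdot> x1 = 0" "x1 \<cdot> e = 0" "e \<cdot> x2 = e" "x2 \<cdot> e = \<epsilon>2 *s e"
    using x1(4) x2(3) e1 by (simp_all add: weights_def)
  obtain z where z: "z \<in> L1" "z \<in> N" and yx2: "y \<cdot> x2 = z \<cdot> y \<cdot> y"
    using x2(3) unfolding weights_def by auto
  obtain \<xi>1 where xi1: "x1 \<cdot> x1 = \<xi>1 *s e"
    using square_split[OF x1(1), of 1] x1 ex by auto
  obtain \<xi>2 where xi2: "x2 \<cdot> x2 = \<xi>2 *s e" "\<xi>2 * \<epsilon>2 = 0"
    using square_split[OF x2(1), of 0] x2 ex by auto
  \<comment> \<open>The mixed products are determined modulo \<open>e\<close> by their products with \<open>y\<close>.\<close>
  have "x2 \<cdot> (x1 \<cdot> y) = x2 \<cdot> x1 \<cdot> y - x2 \<cdot> y \<cdot> x1" using leibniz_even_odd[of x2 x1 y] x1 x2 by simp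
  then have "x2 \<cdot> x1 \<cdot> y = 0" using x1 x2 by simp
  then obtain \<eta>21 where eta21: "x2 \<cdot> x1 = \<eta>21 *s e"
    using even_kernel[of "x2 \<cdot> x1"] x1 x2 by auto
  have "x1 \<cdot> (x2 \<cdot> y) = x1 \<cdot> x2 \<cdot> y - x1 \<cdot> y \<cdot> x2" using leibniz_even_odd[of x1 x2 y] x1 x2 by simp
  then have x12y: "x1 \<cdot> x2 \<cdot> y = - (z \<cdot> y \<cdot> y)" using x1 x2 yx2 by (simp add: eq_neg_iff_add_eq_0)
  obtain \<eta>12 v where v: "v \<in> L1" "v \<in> N" and x12: "x1 \<cdot> x2 = \<eta>12 *s e + v \<cdot> y"
    using even_step[of "x1 \<cdot> x2"] x1 x2 by auto
  have "(v + z) \<cdot> y = 0" using x12y v z by - (rule odd_kernel; simp add: x12)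
  then have vz: "v \<cdot> y = - (z \<cdot> y)" using v z by (simp add: eq_neg_iff_add_eq_0)
  \<comment> \<open>Comparing \<open>e\<close> with the image of \<open>R\<close>, both sides of this identity vanish separately.\<close>
  have "x1 \<cdot> (x2 \<cdot> x1) = x1 \<cdot> x2 \<cdot> x1 - x1 \<cdot> x1 \<cdot> x2" using leibniz_even[of x1 x2 x1] x1 x2 by simp
  then have vx_split: "v \<cdot> y \<cdot> x1 = \<xi>1 *s e" using v x1 x2 ex by (simp add: eta21 xi1 x12)
  moreover have "v \<cdot> y \<cdot> x1 = v \<cdot> x1 \<cdot> y + v \<cdot> y"
    using right_commute[OF x1(1), of 1 0 v] x1(2) v by simp
  ultimately have eq: "\<xi>1 *s e = (v \<cdot> x1 + v) \<cdot> y" using v x1 by simp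
  have "(v \<cdot> x1 + v) \<cdot> y \<cdot> y = 0" unfolding eq[symmetric] by simp
  then have "(v \<cdot> x1 + v) \<cdot> y = 0" using v x1 by - (rule odd_kernel; simp)
  then have xi10: "x1 \<cdot> x1 = 0" and vx: "v \<cdot> y \<cdot> x1 = 0"
    using eq vx_split xi1 by simp_all
  have vy0: "v \<cdot> y = 0" by (rule diagonal_kernel[OF x1(1,2) v vx])
  have "x2 \<cdot> (x1 \<cdot> x2) = x2 \<cdot> x1 \<cdot> x2 - x2 \<cdot> x2 \<cdot> x1" using leibniz_even[of x2 x1 x2] x1 x2 by simp
  then have "(\<eta>12 * \<epsilon>2) *s e = \<eta>21 *s e"
    using x1 x2 ex by (simp add: x12 vy0 xi2 eta21)
  then have "\<eta>12 * \<epsilon>2 = \<eta>21" using e_nonzero by (metis vs.scale_right_imp_eq)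
  then show ?thesis
    using that[of \<xi>2 \<eta>12 \<eta>21] e1 e2 xi10 xi2 eta21 vz vy0 x12 yx2 z by simp
qed

end

section \<open>From normal forms to multiplication tables\<close>

context frame
begin

text \<open>The vector $y_i$; the factor comes from $[[y_i,y_1],y_1]=\frac12 y_{i+1}$. Since $[y_{i-1},y_1]=e_i$ for
$i\ge3$ and $[y_1,y_1]=e_1$, the even basis vectors other than $e_2$ are images of these under $R$.\<close>

definition Yv :: "nat \<Rightarrow> 'a" where
  "Yv i = (2 ^ (i - 1)) *s P (2 * (i - 1)) y"

fun basis_vector :: "(nat \<Rightarrow> 'a) \<Rightarrow> gen \<Rightarrow> 'a" where
  "basis_vector x (E i) = (if i = 2 then e else Yv (if i = 1 then 1 else i - 1) \<cdot> y)"
| "basis_vector x (Y i) = Yv i"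
| "basis_vector x (X k) = x k"

lemma Yv_closure [simp]: "Yv i \<in> L1" "Yv i \<in> N"
  by (simp_all add: Yv_def)

lemma Yv_one: "Yv 1 = y" "Yv (Suc 0) = y"
  by (simp_all add: Yv_def)

lemma Yv_Suc: "1 \<le> i \<Longrightarrow> Yv (Suc i) = 2 *s (Yv i \<cdot> y \<cdot> y)"
  by (cases i) (simp_all add: Yv_def)

lemma Yv_half: "1 \<le> i \<Longrightarrow> Yv i \<cdot> y \<cdot> y = (1 / 2) *s Yv (Suc i)"
  by (simp add: Yv_Suc)

lemma Yv_last: "Yv n \<cdot> y = 0" "Yv (Suc n) = 0"
proof -
  obtain m where n: "n = Suc m" using n3 by (cases n) auto
  show "Yv n \<cdot> y = 0" using P_vanish[of y "2 * m + 1"] by (simp add: Yv_def n)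
  then show "Yv (Suc n) = 0" using n3 by (simp add: Yv_Suc)
qed

lemma Yv_annihilates:
  assumes "2 \<le> i" "u \<in> carrier L"
  shows "u \<cdot> Yv i = 0" "u \<cdot> (Yv i \<cdot> y) = 0"
proof -
  obtain j where i: "i = Suc (Suc j)" using assms(1) by (metis One_nat_def Suc_1 Suc_le_D Suc_le_mono le_add1 plus_1_eq_Suc)
  have "Yv i = 2 *s (Yv (Suc j) \<cdot> y \<cdot> y)" unfolding i by (rule Yv_Suc) simp
  then show "u \<cdot> Yv i = 0" "u \<cdot> (Yv i \<cdot> y) = 0"
    using annihilator[of "Yv (Suc j)" u] annihilator'[of "Yv (Suc j)" u] assms(2) by simp_all
qed

text \<open>By \<open>right_commute\<close> each step along the chain raises the weight by $2\alpha$ and shifts the tail of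
$[y,x]$ by one index; the term that would pass beyond $y_n$ is zero.\<close>

lemma Yv_bracket:
  assumes x: "x \<in> L0" and yx: "y \<cdot> x = \<alpha> *s y + (\<Sum>j = 2..n. a j *s Yv j)"
    and i: "1 \<le> i" "i \<le> n"
  shows "Yv i \<cdot> x = ((2 * of_nat i - 1) * \<alpha>) *s Yv i + (\<Sum>j = i + 1..n. a (j + 1 - i) *s Yv j)"
    and "Yv i \<cdot> y \<cdot> x = (2 * of_nat i * \<alpha>) *s (Yv i \<cdot> y) + (\<Sum>j = i + 1..n. a (j + 1 - i) *s (Yv j \<cdot> y))"
proof -
  have yx': "\<exists>z. z \<in> L1 \<and> z \<in> N \<and> y \<cdot> x = \<alpha> *s y + z \<cdot> y \<cdot> y"
  proof -
    have "(\<Sum>j = 2..n. a j *s Yv j) = (\<Sum>j = 2..n. (2 * a j) *s Yv (j - 1)) \<cdot> y \<cdot> y"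
    proof -
      have "(\<Sum>j = 2..n. (2 * a j) *s Yv (j - 1)) \<cdot> y \<cdot> y = (\<Sum>j = 2..n. (2 * a j) *s (Yv (j - 1) \<cdot> y \<cdot> y))"
        by (simp add: bracket_sums)
      also have "\<dots> = (\<Sum>j = 2..n. a j *s Yv j)"
        by (intro sum.cong) (auto simp: Yv_half)
      finally show ?thesis by simp
    qed
    then show ?thesis using yx by (intro exI[of _ "\<Sum>j = 2..n. (2 * a j) *s Yv (j - 1)"]) simp
  qed
  then obtain z where z: "z \<in> L1" "z \<in> N" "y \<cdot> x = \<alpha> *s y + z \<cdot> y \<cdot> y" by blast
  note comm = right_commute[OF x z(3,1,2)]
  have comm2: "u \<cdot> y \<cdot> y \<cdot> x = u \<cdot> x \<cdot> y \<cdot> y + (2 * \<alpha>) *s (u \<cdot> y \<cdot> y)" if "u \<in> carrier L" for u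
    using right_commute_P[OF x z(3,1,2) that, of 2] by (simp add: numeral_2_eq_2)
  show 1: "Yv i \<cdot> x = ((2 * of_nat i - 1) * \<alpha>) *s Yv i + (\<Sum>j = i + 1..n. a (j + 1 - i) *s Yv j)"
    using i
  proof (induction i rule: nat_induct_at_least)
    case base
    then show ?case using yx by (simp add: Yv_one numeral_2_eq_2)
  next
    case (Suc i)
    have sums: "2 *s ((\<Sum>j = i + 1..n. a (j + 1 - i) *s Yv j) \<cdot> y \<cdot> y) = (\<Sum>j = Suc i + 1..n. a (j + 1 - Suc i) *s Yv j)"
    proof -
      have "2 *s ((\<Sum>j = i + 1..n. a (j + 1 - i) *s Yv j) \<cdot> y \<cdot> y)
          = (\<Sum>j = i + 1..n. a (j + 1 - i) *s (2 *s (Yv j \<cdot> y \<cdot> y)))"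
        by (simp add: bracket_sums vs.scale_sum_right mult.commute)
      also have "\<dots> = (\<Sum>j = i + 1..n. a (Suc j + 1 - Suc i) *s Yv (Suc j))"
        by (intro sum.cong) (auto simp: Yv_Suc)
      also have "\<dots> = (\<Sum>j = Suc i + 1..Suc n. a (j + 1 - Suc i) *s Yv j)"
        using sum.shift_bounds_cl_Suc_ivl[of "\<lambda>j. a (j + 1 - Suc i) *s Yv j" "i + 1" n] by simp
      also have "\<dots> = (\<Sum>j = Suc i + 1..n. a (j + 1 - Suc i) *s Yv j)"
        using Suc.prems by (simp add: Yv_last)
      finally show ?thesis .
    qed
    have "Yv (Suc i) \<cdot> x = 2 *s (Yv i \<cdot> x \<cdot> y \<cdot> y) + (2 * \<alpha>) *s Yv (Suc i)"
      using Suc.hyps x comm2[of "Yv i"] by (simp add: Yv_Suc vs.scale_right_distrib mult.commute)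
    also have "Yv i \<cdot> x = ((2 * of_nat i - 1) * \<alpha>) *s Yv i + (\<Sum>j = i + 1..n. a (j + 1 - i) *s Yv j)"
      using Suc by simp
    also have "2 *s ((((2 * of_nat i - 1) * \<alpha>) *s Yv i + (\<Sum>j = i + 1..n. a (j + 1 - i) *s Yv j)) \<cdot> y \<cdot> y) + (2 * \<alpha>) *s Yv (Suc i)
        = ((2 * of_nat i - 1) * \<alpha>) *s Yv (Suc i) + 2 *s ((\<Sum>j = i + 1..n. a (j + 1 - i) *s Yv j) \<cdot> y \<cdot> y) + (2 * \<alpha>) *s Yv (Suc i)"
      using Suc.hyps by (simp add: Yv_Suc vs.scale_right_distrib mult.commute)
    also have "\<dots> = ((2 * of_nat (Suc i) - 1) * \<alpha>) *s Yv (Suc i) + (\<Sum>j = Suc i + 1..n. a (j + 1 - Suc i) *s Yv j)"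
    proof -
      have "(2 * of_nat (Suc i) - 1) * \<alpha> = (2 * of_nat i - 1) * \<alpha> + 2 * \<alpha>" by (simp add: algebra_simps)
      then show ?thesis unfolding sums by (simp add: vs.scale_left_distrib)
    qed
    finally show ?case .
  qed
  have "Yv i \<cdot> y \<cdot> x = Yv i \<cdot> x \<cdot> y + \<alpha> *s (Yv i \<cdot> y)" using comm[of "Yv i"] by simp
  also have "Yv i \<cdot> x \<cdot> y = ((2 * of_nat i - 1) * \<alpha>) *s (Yv i \<cdot> y) + (\<Sum>j = i + 1..n. a (j + 1 - i) *s (Yv j \<cdot> y))"
    unfolding 1 by (simp add: bracket_sums)
  finally show "Yv i \<cdot> y \<cdot> x = (2 * of_nat i * \<alpha>) *s (Yv i \<cdot> y) + (\<Sum>j = i + 1..n. a (j + 1 - i) *s (Yv j \<cdot> y))"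
    by (simp add: algebra_simps)
qed

lemma sum_Y: "(\<Sum>i = 1..n. c i *s Yv i) = (\<Sum>k<n. (c (Suc k) * 2 ^ k) *s P (2 * k) y)"
proof -
  have "(\<Sum>i = 1..n. c i *s Yv i) = (\<Sum>i\<in>Suc ` {..<n}. c i *s Yv i)"
    by (rule sum.cong) (simp_all add: image_Suc_lessThan)
  also have "\<dots> = (\<Sum>k<n. c (Suc k) *s Yv (Suc k))"
    by (subst sum.reindex) simp_all
  finally show ?thesis by (simp add: Yv_def)
qed

text \<open>The chain vectors among the $e_i$ have the indices $1,3,4,\dots,n$, since $e_2$ is split off; the $k$-th of
them, counted from $0$, is $R^{2k+1}y$ up to a factor.\<close>

lemma sum_E:
  "(\<Sum>i = 1..n. c i *s basis_vector x (E i))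
     = c 2 *s e + (\<Sum>k<n - 1. (c (if k = 0 then 1 else k + 2) * 2 ^ k) *s P (2 * k + 1) y)"
proof -
  have split: "{1..n} = insert 2 ((\<lambda>k. if k = 0 then 1 else k + 2) ` {..<n - 1})"
  proof (intro equalityI subsetI)
    fix i assume i: "i \<in> {1..n}"
    consider "i = 1" | "i = 2" | "i \<ge> 3" using i by force
    then show "i \<in> insert 2 ((\<lambda>k. if k = 0 then 1 else k + 2) ` {..<n - 1})"
    proof cases
      case 3
      then show ?thesis using i by (intro insertI2 image_eqI[of _ _ "i - 2"]) auto
    qed (use n3 in \<open>auto intro!: image_eqI[of _ _ 0]\<close>)
  qed (use n3 in auto)
  have inj: "inj_on (\<lambda>k. if k = 0 then 1 else k + 2) {..<n - 1}"
    by (auto simp: inj_on_def)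
  have "(\<Sum>i = 1..n. c i *s basis_vector x (E i)) = c 2 *s e +
      (\<Sum>i\<in>(\<lambda>k. if k = 0 then 1 else k + 2) ` {..<n - 1}. c i *s basis_vector x (E i))"
    unfolding split by (subst sum.insert) auto
  also have "(\<Sum>i\<in>(\<lambda>k. if k = 0 then 1 else k + 2) ` {..<n - 1}. c i *s basis_vector x (E i))
      = (\<Sum>k<n - 1. (c (if k = 0 then 1 else k + 2) * 2 ^ k) *s P (2 * k + 1) y)"
    unfolding sum.reindex[OF inj] by (intro sum.cong) (auto simp: Yv_def)
  finally show ?thesis .
qed

lemma E_independent:
  assumes "c *s e + (\<Sum>k<n - 1. d k *s P (2 * k + 1) y) = 0"
  shows "c = 0" "k < n - 1 \<Longrightarrow> d k = 0"
proof -
  let ?z = "\<Sum>k<n. d k *s P (2 * k) y"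
  have z: "?z \<in> L1" "?z \<in> N" by simp_all
  have zy: "?z \<cdot> y = - (c *s e)"
    unfolding expansion_bracket using assms by (simp add: eq_neg_iff_add_eq_0 add.commute)
  then have "?z \<cdot> y = 0" using z by - (rule odd_kernel, simp_all)
  then show "c = 0" using zy e_nonzero by simp
  show "k < n - 1 \<Longrightarrow> d k = 0"
    using \<open>?z \<cdot> y = 0\<close> unfolding expansion_bracket by (rule even_independent)
qed

text \<open>The relations of the $x_k$ with $y$, $e$ and each other determine the complete table: products with $y_j$,
$j\ge2$, and $e_i$, $i\ge3$, on the right vanish by the annihilator, those with $e_1$ on the right are $2R^2$,
and the action of $x_k$ from the right propagates along the chain.\<close>

lemma isomorphic_extension:
  fixes x :: "nat \<Rightarrow> 'a"
  assumes fin: "finite (gens D)"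
    and x: "\<And>k. k \<in> gens D \<Longrightarrow> x k \<in> L0"
    and yx: "\<And>k. k \<in> gens D \<Longrightarrow> y \<cdot> x k = chain_weight D k *s y + (\<Sum>j = 2..n. shift D k j *s Yv j)"
    and xy: "\<And>k. k \<in> gens D \<Longrightarrow> x k \<cdot> y = - (chain_weight D k *s y)"
    and ex: "\<And>k. k \<in> gens D \<Longrightarrow> e \<cdot> x k = split_weight D k *s e"
    and xe: "\<And>k. k \<in> gens D \<Longrightarrow> x k \<cdot> e = left_weight D k *s e"
    and xx: "\<And>k l. k \<in> gens D \<Longrightarrow> l \<in> gens D \<Longrightarrow> x k \<cdot> x l = square D k l *s e"
    and odd: "L1 \<subseteq> N"
    and even: "\<And>u. u \<in> L0 \<Longrightarrow> \<exists>c. u - (\<Sum>k\<in>gens D. c k *s x k) \<in> N"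
    and indep: "\<And>c. (\<Sum>k\<in>gens D. c k *s x k) \<in> N \<Longrightarrow> \<forall>k\<in>gens D. c k = 0"
  shows "isomorphic L (extension_algebra n D)"
proof -
  let ?B0 = "E ` {1..n} \<union> X ` gens D" and ?B1 = "Y ` {1..n}"
  let ?b = "basis_vector x"
  define T where "T p q = nil_table n p q + extension_table n D p q" for p q
  have E0: "?b (E i) \<in> L0" "?b (E i) \<in> N" for i by simp_all
  have sum0: "(\<Sum>p\<in>?B0. c p *s ?b p) = (\<Sum>i = 1..n. c (E i) *s ?b (E i)) + (\<Sum>k\<in>gens D. c (X k) *s x k)" for c
    using fin by (subst sum.union_disjoint) (auto simp: sum.reindex inj_on_def simp del: basis_vector.simps(1))
  have sum1: "(\<Sum>p\<in>?B1. c p *s ?b p) = (\<Sum>i = 1..n. c (Y i) *s Yv i)" for c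
    by (simp add: sum.reindex inj_on_def)
  show ?thesis
    unfolding extension_algebra_def T_def[symmetric]
  proof (rule isomorphic_from_table[of L ?B0 ?B1 T ?b])
    show "vector_space (scale L)" "bilinear L" by (fact vs.vector_space_axioms bilinear)+
    show "finite ?B0" "finite ?B1" "?B0 \<inter> ?B1 = {}" using fin by auto
    show "keys (T p q) \<subseteq> ?B0 \<union> ?B1" if "p \<in> ?B0 \<union> ?B1" "q \<in> ?B0 \<union> ?B1" for p q
      unfolding T_def using keys_table[OF n3 that] .
  next
    fix c assume 0: "(\<Sum>p\<in>?B0 \<union> ?B1. c p *s ?b p) = 0"
    have split: "(\<Sum>p\<in>?B0 \<union> ?B1. c p *s ?b p) = (\<Sum>p\<in>?B0. c p *s ?b p) + (\<Sum>p\<in>?B1. c p *s ?b p)"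
      using fin by (intro sum.union_disjoint) auto
    have p0: "(\<Sum>p\<in>?B0. c p *s ?b p) \<in> L0" using x by (auto intro!: closure_sum)
    have p1: "(\<Sum>p\<in>?B1. c p *s ?b p) \<in> L1" by (auto intro!: closure_sum)
    have "(\<Sum>p\<in>?B0. c p *s ?b p) = - (\<Sum>p\<in>?B1. c p *s ?b p)"
      using 0 unfolding split by (simp add: eq_neg_iff_add_eq_0)
    then have "(\<Sum>p\<in>?B0. c p *s ?b p) = 0" using p0 p1 by (intro parity_disjoint) simp_all
    moreover from this have "(\<Sum>p\<in>?B1. c p *s ?b p) = 0" using 0 unfolding split by simp
    ultimately have even0: "(\<Sum>i = 1..n. c (E i) *s ?b (E i)) + (\<Sum>k\<in>gens D. c (X k) *s x k) = 0"
      and odd0: "(\<Sum>i = 1..n. c (Y i) *s Yv i) = 0"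
      unfolding sum0 sum1 by blast+
    have "(\<Sum>k\<in>gens D. c (X k) *s x k) = - (\<Sum>i = 1..n. c (E i) *s ?b (E i))"
      using even0 by (simp add: eq_neg_iff_add_eq_0 add.commute del: basis_vector.simps(1))
    also have "\<dots> \<in> N" using E0(2) by (intro closure closure_sum)
    finally have cX: "\<forall>k\<in>gens D. c (X k) = 0" by (rule indep)
    then have "(\<Sum>i = 1..n. c (E i) *s ?b (E i)) = 0" using even0 by simp
    note cE = E_independent[OF this[unfolded sum_E]]
    have "c (E i) = 0" if i: "i \<in> {1..n}" for i
    proof -
      consider "i = 1" | "i = 2" | "i \<ge> 3" using i by force
      then show ?thesis
      proof cases
        case 1
        then show ?thesis using cE(2)[of 0] n3 by simp
      next
        case 2
        then show ?thesis using cE(1) by simp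
      next
        case 3
        then have "i - 2 < n - 1" "i - 2 \<noteq> 0" "i - 2 + 2 = i" using i by auto
        then show ?thesis using cE(2)[of "i - 2"] by simp
      qed
    qed
    moreover have "c (Y i) = 0" if "i \<in> {1..n}" for i
    proof -
      have "i - 1 < n" "Suc (i - 1) = i" using that by auto
      then show ?thesis using odd_independent[OF odd0[unfolded sum_Y], of "i - 1"] by simp
    qed
    ultimately show "\<forall>p\<in>?B0 \<union> ?B1. c p = 0" using cX by blast
  next
    show "L0 = range (\<lambda>c. \<Sum>p\<in>?B0. c p *s ?b p)"
    proof (intro equalityI subsetI)
      fix u assume u: "u \<in> L0"
      obtain c where c: "u - (\<Sum>k\<in>gens D. c k *s x k) \<in> N" using even[OF u] by blast
      moreover have "u - (\<Sum>k\<in>gens D. c k *s x k) \<in> L0" using u x by simp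
      ultimately obtain d z where z: "z \<in> L1" "z \<in> N" and eq: "u - (\<Sum>k\<in>gens D. c k *s x k) = d *s e + z \<cdot> y"
        using even_step by blast
      obtain f where f: "z = (\<Sum>k<n. f k *s P (2 * k) y)" using z by (rule odd_expand)
      define h where "h p = (case p of E i \<Rightarrow> if i = 2 then d else if i = 1 then f 0 else f (i - 2) / 2 ^ (i - 2)
           | Y i \<Rightarrow> 0 | X k \<Rightarrow> c k)" for p
      have "(\<Sum>i = 1..n. h (E i) *s ?b (E i)) = d *s e + z \<cdot> y"
        unfolding sum_E f expansion_bracket by (auto simp: h_def intro!: sum.cong)
      moreover have "(\<Sum>k\<in>gens D. h (X k) *s x k) = (\<Sum>k\<in>gens D. c k *s x k)" by (simp add: h_def)
      ultimately have "u = (\<Sum>p\<in>?B0. h p *s ?b p)"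
        unfolding sum0 eq[symmetric] by simp
      then show "u \<in> range (\<lambda>c. \<Sum>p\<in>?B0. c p *s ?b p)" by blast
    next
      fix u assume "u \<in> range (\<lambda>c. \<Sum>p\<in>?B0. c p *s ?b p)"
      then show "u \<in> L0" using x by (auto intro!: closure_sum)
    qed
  next
    show "L1 = range (\<lambda>c. \<Sum>p\<in>?B1. c p *s ?b p)"
    proof (intro equalityI subsetI)
      fix u assume "u \<in> L1"
      then obtain f where f: "u = (\<Sum>k<n. f k *s P (2 * k) y)" using odd odd_expand by blast
      define h where "h p = (case p of Y i \<Rightarrow> f (i - 1) / 2 ^ (i - 1) | _ \<Rightarrow> 0)" for p
      have "u = (\<Sum>p\<in>?B1. h p *s ?b p)"
        unfolding sum1 sum_Y f by (auto simp: h_def intro!: sum.cong)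
      then show "u \<in> range (\<lambda>c. \<Sum>p\<in>?B1. c p *s ?b p)" by blast
    next
      fix u assume "u \<in> range (\<lambda>c. \<Sum>p\<in>?B1. c p *s ?b p)"
      then show "u \<in> L1" by (auto intro!: closure_sum)
    qed
  next
    fix p q assume pq: "p \<in> ?B0 \<union> ?B1" "q \<in> ?B0 \<union> ?B1"
    \<comment> \<open>\<open>ev\<close> evaluates an entry of the table in \<open>L\<close>.\<close>
    define ev where "ev w = (\<Sum>r\<in>?B0 \<union> ?B1. lookup w r *s ?b r)" for w
    have finB: "finite (?B0 \<union> ?B1)" using fin by auto
    have ev_add: "ev (v + w) = ev v + ev w" for v w
      by (simp add: ev_def lookup_add vs.scale_left_distrib sum.distrib)
    have ev_zero: "ev 0 = 0" by (simp add: ev_def)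
    have ev_single: "ev (single r c) = c *s ?b r" if "r \<in> ?B0 \<union> ?B1" for r c
    proof -
      have "ev (single r c) = (\<Sum>s\<in>?B0 \<union> ?B1. if s = r then c *s ?b r else 0)"
        unfolding ev_def by (intro sum.cong) (auto simp: lookup_single when_def)
      then show ?thesis using that finB by (simp add: sum.delta)
    qed
    have ev_E: "ev (single (E i) c) = c *s ?b (E i)" if "1 \<le> i" "i \<le> n" for i c
      using that by (intro ev_single) simp
    have ev_Y: "ev (single (Y i) c) = c *s Yv i" if "1 \<le> i" "i \<le> n" for i c
      using that ev_single[of "Y i" c] by simp
    have ev_sumE: "ev (\<Sum>j = k..n. single (E j) (c j)) = (\<Sum>j = k..n. c j *s ?b (E j))" if "1 \<le> k" for k c
      using that
    proof -
      have "ev (\<Sum>j\<in>A. single (E j) (c j)) = (\<Sum>j\<in>A. c j *s ?b (E j))" if "finite A" "A \<subseteq> {1..n}" for A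
        using that by (induction A rule: finite_induct) (auto simp: ev_zero ev_add ev_E simp del: basis_vector.simps(1))
      then show ?thesis using that by simp
    qed
    have ev_sumY: "ev (\<Sum>j = k..n. single (Y j) (c j)) = (\<Sum>j = k..n. c j *s Yv j)" if "1 \<le> k" for k c
    proof -
      have "ev (\<Sum>j\<in>A. single (Y j) (c j)) = (\<Sum>j\<in>A. c j *s Yv j)" if "finite A" "A \<subseteq> {1..n}" for A
        using that by (induction A rule: finite_induct) (auto simp: ev_zero ev_add ev_Y)
      then show ?thesis using that by simp
    qed
    note ev = ev_add ev_zero ev_E ev_Y ev_sumE ev_sumY
    have bE1: "?b (E 1) = y \<cdot> y" "?b (E 2) = e" by (simp_all add: Yv_one)
    have bE3: "?b (E i) = Yv (i - 1) \<cdot> y" if "3 \<le> i" for i using that by simp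
    have bEy: "?b (E i) \<cdot> y = (if i = 1 then (1 / 2) *s Yv 2 else if i = 2 then 0 else (1 / 2) *s Yv i)" if "1 \<le> i" for i
      using that Yv_half[of 1] Yv_half[of "i - 1"] by (auto simp: Yv_one numeral_2_eq_2)
    have RE: "u \<cdot> ?b (E j) = (if j = 1 then 2 *s (u \<cdot> y \<cdot> y) else 0)" if uj: "u \<in> N" "1 \<le> j" for u j
    proof -
      consider "j = 1" | "j = 2" | "j \<ge> 3" using uj by force
      then show ?thesis
      proof cases
        case 3
        then have "2 \<le> j - 1" by simp
        then show ?thesis using Yv_annihilates(2)[of "j - 1" u] uj 3 by simp
      qed (use uj bracket_yy[of u] in \<open>simp_all add: Yv_one\<close>)
    qed
    have RY: "u \<cdot> Yv j = (if j = 1 then u \<cdot> y else 0)" if "u \<in> carrier L" "1 \<le> j" for u j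
      using Yv_annihilates(1)[of j u] that by (cases "j = 1") (auto simp: Yv_one)
    have "?b p \<cdot> ?b q = ev (T p q)"
    proof (cases p; cases q)
      fix i j assume p: "p = E i" and q: "q = E j"
      then have ij: "1 \<le> i" "i \<le> n" "1 \<le> j" using pq by auto
      have "?b p \<cdot> ?b q = (if j = 1 then 2 *s (?b (E i) \<cdot> y \<cdot> y) else 0)"
        unfolding p q by (rule RE) (use ij E0 in simp_all)
      also have "\<dots> = ev (T p q)"
      proof -
        consider "i = 1" | "i = 2" | "3 \<le> i" "i < n" | "i = n" "3 \<le> n" using ij n3 by linarith
        then show ?thesis
        proof cases
          case 1
          then show ?thesis using bEy[of 1] n3 bE3[of 3] unfolding T_def p q by (auto simp: ev simp del: basis_vector.simps(1))
        next
          case 2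
          then show ?thesis using n3 unfolding T_def p q by (auto simp: ev)
        next
          case 3
          then show ?thesis using bEy[of i] bE3[of "i + 1"] unfolding T_def p q by (auto simp: ev simp del: basis_vector.simps(1))
        next
          case 4
          then show ?thesis using bEy[of i] unfolding T_def p q by (auto simp: ev Yv_last simp del: basis_vector.simps(1))
        qed
      qed
      finally show ?thesis .
    next
      fix i j assume p: "p = E i" and q: "q = Y j"
      then have ij: "1 \<le> i" "i \<le> n" "1 \<le> j" "j \<le> n" using pq by auto
      have "?b p \<cdot> ?b q = (if j = 1 then ?b (E i) \<cdot> y else 0)"
        unfolding p q basis_vector.simps(2) by (rule RY) (use ij E0 in simp_all)
      then show ?thesis using bEy[of i] ij n3 unfolding T_def p q by (auto simp: ev simp del: basis_vector.simps(1))
    next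
      fix i k assume p: "p = E i" and q: "q = X k"
      then have ik: "1 \<le> i" "i \<le> n" "k \<in> gens D" using pq by auto
      note YB = Yv_bracket(2)[OF x[OF ik(3)] yx[OF ik(3)]]
      consider "i = 1" | "i = 2" | "3 \<le> i" using ik by linarith
      then show ?thesis
      proof cases
        case 1
        have "(\<Sum>j = 2..n. shift D k j *s (Yv j \<cdot> y)) = (\<Sum>j = 2..n. shift D k (Suc j - 1) *s ?b (E (Suc j)))"
          by (intro sum.cong) auto
        also have "\<dots> = (\<Sum>j = Suc 2..Suc n. shift D k (j - 1) *s ?b (E j))"
          by (rule sum.shift_bounds_cl_Suc_ivl[symmetric])
        also have "\<dots> = (\<Sum>j = 3..n. shift D k (j - 1) *s ?b (E j))"
          using n3 by (simp add: Yv_last numeral_3_eq_3 del: basis_vector.simps(1)) (simp add: Yv_last)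
        finally have "(\<Sum>j = 2..n. shift D k j *s (Yv j \<cdot> y)) = (\<Sum>j = 3..n. shift D k (j - 1) *s ?b (E j))" .
        then show ?thesis
          using YB[of 1] n3 unfolding T_def p q 1
          by (simp add: ev Yv_one numeral_2_eq_2 del: basis_vector.simps(1)) (simp add: Yv_one)
      next
        case 2
        then show ?thesis using n3 ex ik unfolding T_def p q by (simp add: ev)
      next
        case 3
        have "(\<Sum>j = i - 1 + 1..n. shift D k (j + 1 - (i - 1)) *s (Yv j \<cdot> y))
           = (\<Sum>j = i..n. shift D k (Suc j + 1 - i) *s ?b (E (Suc j)))"
          using 3 by (intro sum.cong) (auto simp: Suc_diff_le)
        also have "\<dots> = (\<Sum>j = Suc i..Suc n. shift D k (j + 1 - i) *s ?b (E j))"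
          by (rule sum.shift_bounds_cl_Suc_ivl[symmetric])
        also have "\<dots> = (\<Sum>j = i + 1..n. shift D k (j + 1 - i) *s ?b (E j))"
          using n3 ik by (simp del: basis_vector.simps(1)) (simp add: Yv_last)
        finally have s: "(\<Sum>j = i - 1 + 1..n. shift D k (j + 1 - (i - 1)) *s (Yv j \<cdot> y))
            = (\<Sum>j = i + 1..n. shift D k (j + 1 - i) *s ?b (E j))" .
        have "?b p \<cdot> ?b q = (2 * of_nat (i - 1) * chain_weight D k) *s ?b (E i) + (\<Sum>j = i + 1..n. shift D k (j + 1 - i) *s ?b (E j))"
          using YB[of "i - 1", unfolded s] 3 ik unfolding p q by (simp del: basis_vector.simps(1)) simp
        also have "of_nat (i - 1) = (of_nat i - 1 :: complex)" using 3 by (simp add: of_nat_diff)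
        finally show ?thesis
          using 3 ik unfolding T_def p q by (simp add: ev del: basis_vector.simps(1))
      qed
    next
      fix i j assume p: "p = Y i" and q: "q = E j"
      then have ij: "1 \<le> i" "i \<le> n" "1 \<le> j" using pq by auto
      have "?b p \<cdot> ?b q = (if j = 1 then 2 *s (Yv i \<cdot> y \<cdot> y) else 0)"
        unfolding p q basis_vector.simps(2) by (rule RE) (use ij in simp_all)
      then show ?thesis using Yv_half[of i] ij Yv_last unfolding T_def p q
        by (cases "i = n") (auto simp: ev simp del: basis_vector.simps(1))
    next
      fix i j assume p: "p = Y i" and q: "q = Y j"
      then have ij: "1 \<le> i" "i \<le> n" "1 \<le> j" "j \<le> n" using pq by auto
      have "?b p \<cdot> ?b q = (if j = 1 then Yv i \<cdot> y else 0)"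
        unfolding p q basis_vector.simps(2) by (rule RY) (use ij in simp_all)
      then show ?thesis using ij n3 bE1 bE3[of "i + 1"] Yv_last unfolding T_def p q
        by (cases "i = n"; cases "i = 1") (auto simp: ev Yv_one simp del: basis_vector.simps(1))
    next
      fix i k assume p: "p = Y i" and q: "q = X k"
      then have ik: "1 \<le> i" "i \<le> n" "k \<in> gens D" using pq by auto
      then show ?thesis
        using Yv_bracket(1)[OF x[OF ik(3)] yx[OF ik(3)] ik(1,2)] unfolding T_def p q by (simp add: ev)
    next
      fix k i assume p: "p = X k" and q: "q = E i"
      then have ik: "1 \<le> i" "i \<le> n" "k \<in> gens D" using pq by auto
      consider "i = 1" | "i = 2" | "3 \<le> i" using ik by linarith
      then show ?thesis
      proof cases
        case 1
        then show ?thesis using n3 bracket_yy[of "x k"] x xy ik unfolding T_def p q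
          by (simp add: ev Yv_one)
      next
        case 2
        then show ?thesis using xe ik unfolding T_def p q by (simp add: ev)
      next
        case 3
        then show ?thesis using Yv_annihilates(2)[of "i - 1" "x k"] x ik unfolding T_def p q by (simp add: ev)
      qed
    next
      fix k i assume p: "p = X k" and q: "q = Y i"
      then have ik: "1 \<le> i" "i \<le> n" "k \<in> gens D" using pq by auto
      then show ?thesis using RY[of "x k" i] x xy unfolding T_def p q by (simp add: ev Yv_one)
    next
      fix k l assume p: "p = X k" and q: "q = X l"
      then have "k \<in> gens D" "l \<in> gens D" using pq by auto
      then show ?thesis using xx n3 unfolding T_def p q by (simp add: ev)
    qed
    then show "?b p \<cdot> ?b q = (\<Sum>r\<in>?B0 \<union> ?B1. lookup (T p q) r *s ?b r)"
      unfolding ev_def .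
  qed
qed

end

section \<open>Classification over a frame\<close>

context frame
begin

lemma weights_unique:
  assumes x: "x \<in> L0" and w: "weights x \<alpha> \<beta> \<epsilon>" and w': "weights x \<alpha>' \<beta>' \<epsilon>'"
  shows "\<alpha> = \<alpha>'" "\<beta> = \<beta>'" "\<epsilon> = \<epsilon>'"
proof -
  obtain z where z: "z \<in> L1" "z \<in> N" "y \<cdot> x = \<alpha> *s y + z \<cdot> y \<cdot> y"
    using w unfolding weights_def by blast
  obtain z' where z': "z' \<in> L1" "z' \<in> N" "y \<cdot> x = \<alpha>' *s y + z' \<cdot> y \<cdot> y"
    using w' unfolding weights_def by blast
  have "(\<alpha> - \<alpha>') *s y + (z - z') \<cdot> y \<cdot> y = (\<alpha> *s y + z \<cdot> y \<cdot> y) - (\<alpha>' *s y + z' \<cdot> y \<cdot> y)"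
    using z(1,2) z'(1,2) by (simp add: algebra_simps)
  also have "\<dots> = 0" unfolding z(3)[symmetric] z'(3)[symmetric] by simp
  finally have "\<alpha> - \<alpha>' = 0" using z z' by (intro lead_zero[of "z - z'" 0]) simp_all
  then show "\<alpha> = \<alpha>'" by simp
  have "\<beta> *s e = \<beta>' *s e" "\<epsilon> *s e = \<epsilon>' *s e" using w w' unfolding weights_def by metis+
  then show "\<beta> = \<beta>'" "\<epsilon> = \<epsilon>'" using e_nonzero by simp_all
qed

lemma weights_scale:
  assumes "x \<in> L0" "weights x \<alpha> \<beta> \<epsilon>"
  shows "weights (c *s x) (c * \<alpha>) (c * \<beta>) (c * \<epsilon>)"
  using weights_linear[OF _ assms(1) weights_N assms(2), of 0 c] by simp

lemma weights_modulo_N: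
  assumes x: "x \<in> L0" "weights x \<alpha> \<beta> \<epsilon>" and x': "x' \<in> L0" "x - x' \<in> N"
  shows "weights x' \<alpha> \<beta> \<epsilon>"
  using weights_linear[OF x(1) _ x(2) weights_N[OF x'(2)], of "- 1"] x x' by simp

text \<open>The tails absorb the change of the generator, because they are only required to lie in $R^2N_1$.\<close>

lemma weights_change_chain:
  assumes w: "w \<in> L1" "w \<in> N" and x: "x \<in> L0" "weights x \<alpha> \<beta> \<epsilon>"
  shows "frame.weights L N (y + w \<cdot> y \<cdot> y) e x \<alpha> \<beta> \<epsilon>"
proof -
  let ?y = "y + w \<cdot> y \<cdot> y"
  interpret F: frame L N n ?y e using w by (rule change_chain)
  note R = bracket_new_generator(1)[OF w] and RR = bracket_new_generator(2)[OF w]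
  obtain z v where z: "z \<in> L1" "z \<in> N" "y \<cdot> x = \<alpha> *s y + z \<cdot> y \<cdot> y"
      and v: "v \<in> L1" "v \<in> N" "x \<cdot> y = - (\<alpha> *s y) + v \<cdot> y \<cdot> y"
    using x(2) unfolding weights_def by blast
  have "w \<cdot> y \<cdot> y \<cdot> x = w \<cdot> x \<cdot> y \<cdot> y + (2 * \<alpha>) *s (w \<cdot> y \<cdot> y)"
    using right_commute_P[OF x(1) z(3,1,2), of w 2] w by (simp add: numeral_2_eq_2)
  moreover have "(2 * \<alpha>) *s (w \<cdot> y \<cdot> y) = \<alpha> *s (w \<cdot> y \<cdot> y) + \<alpha> *s (w \<cdot> y \<cdot> y)"
    using vs.scale_left_distrib[of \<alpha> \<alpha>] by simp
  ultimately have "?y \<cdot> x = \<alpha> *s ?y + (z + w \<cdot> x + \<alpha> *s w) \<cdot> ?y \<cdot> ?y"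
    using z w x by (subst RR) (simp_all add: algebra_simps)
  moreover have "z + w \<cdot> x + \<alpha> *s w \<in> L1" "z + w \<cdot> x + \<alpha> *s w \<in> N"
    using z w x by simp_all
  moreover have "x \<cdot> ?y = - (\<alpha> *s ?y) + (v + \<alpha> *s w) \<cdot> ?y \<cdot> ?y"
    using v w x R[of x] by (subst RR) (simp_all add: algebra_simps)
  moreover have "v + \<alpha> *s w \<in> L1" "v + \<alpha> *s w \<in> N" using v w by simp_all
  ultimately show ?thesis
    using x(2) unfolding F.weights_def weights_def by blast
qed

lemma shift_expand:
  assumes z: "z \<in> L1" "z \<in> N"
  obtains a where "z \<cdot> y \<cdot> y = (\<Sum>j = 2..n. a j *s Yv j)"
proof -
  obtain c where c: "z = (\<Sum>k<n. c k *s P (2 * k) y)" using z by (rule odd_expand)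
  have "z \<cdot> y \<cdot> y = (\<Sum>k<n. c k *s P (2 * k + 2) y)"
    unfolding c by (simp add: bracket_sums)
  also have "\<dots> = (\<Sum>k<n. (c (k + 2 - 2) / 2 ^ (k + 2 - 1)) *s Yv (k + 2))"
    by (simp add: Yv_def)
  also have "\<dots> = (\<Sum>j = 0 + 2..<n + 2. (c (j - 2) / 2 ^ (j - 1)) *s Yv j)"
    unfolding sum.shift_bounds_nat_ivl lessThan_atLeast0 ..
  also have "{0 + 2..<n + 2} = insert (Suc n) {2..n}" using n3 by auto
  also have "(\<Sum>j\<in>insert (Suc n) {2..n}. (c (j - 2) / 2 ^ (j - 1)) *s Yv j)
      = (\<Sum>j = 2..n. (c (j - 2) / 2 ^ (j - 1)) *s Yv j)"
    by (simp add: Yv_last)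
  finally show ?thesis by (rule that[of "\<lambda>j. c (j - 2) / 2 ^ (j - 1)"])
qed

end

locale maximal_frame = frame +
  assumes maximal: "\<And>M. nilpotent_ideal_over_square L M \<Longrightarrow> N \<subseteq> M \<Longrightarrow> M = N"
begin

lemma odd_N: "L1 \<subseteq> N"
  using odd_in_radical[OF maximal] by blast

lemma even_N: "x \<in> L0 \<Longrightarrow> weights x 0 0 \<epsilon> \<Longrightarrow> x \<in> N"
  using even_in_radical[OF maximal] .

text \<open>After \<open>pair_relations\<close> the remaining constants are removed by $x_1-\eta_{12}e$ and $x_2-\xi_2e$: if
$\varepsilon_2=0$ then also $\eta_{21}=0$, and if $\varepsilon_2=-1$ then $\eta_{21}=-\eta_{12}$ and $\xi_2=0$.\<close>

lemma pair_model:
  assumes x1: "x1 \<in> L0" "y \<cdot> x1 = y" "weights x1 1 0 \<epsilon>1"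
    and x2: "x2 \<in> L0" "weights x2 0 1 \<epsilon>2"
  shows "isomorphic L (model n MH1 a) \<or> isomorphic L (model n MH2 a)"
proof -
  obtain u1 where u1: "u1 \<in> L0" "y \<cdot> u1 = y" "u1 \<cdot> y = - y" "weights u1 1 0 \<epsilon>1"
    using normalise_diagonal[OF x1(1,3,2)] by blast
  obtain u2 where u2: "u2 \<in> L0" "u2 \<cdot> y = 0" "weights u2 0 1 \<epsilon>2"
    using normalise_nilpotent[OF x2] by blast
  obtain \<eta>12 \<eta>21 \<xi>2 where r: "y \<cdot> u2 = 0" "\<epsilon>1 = 0" "\<epsilon>2 = 0 \<or> \<epsilon>2 = - 1" "u1 \<cdot> u1 = 0" "u2 \<cdot> u2 = \<xi>2 *s e"
    "\<xi>2 * \<epsilon>2 = 0" "u1 \<cdot> u2 = \<eta>12 *s e" "u2 \<cdot> u1 = \<eta>21 *s e" "\<eta>12 * \<epsilon>2 = \<eta>21"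
    using pair_relations[OF u1 u2] by metis
  have ex: "e \<cdot> u1 = 0" "u1 \<cdot> e = 0" "e \<cdot> u2 = e" "u2 \<cdot> e = \<epsilon>2 *s e"
    using u1(4) u2(3) r(2) by (simp_all add: weights_def)
  define v1 where "v1 = u1 - \<eta>12 *s e"
  define v2 where "v2 = u2 - \<xi>2 *s e"
  have v: "v1 \<in> L0" "v2 \<in> L0" using u1 u2 by (simp_all add: v1_def v2_def)
  have w: "weights v1 1 0 0" "weights v2 0 1 \<epsilon>2"
    using weights_modulo_N[OF u1(1,4) v(1)] weights_modulo_N[OF u2(1,3) v(2)] r(2)
    by (simp_all add: v1_def v2_def)
  have prods: "y \<cdot> v1 = y" "v1 \<cdot> y = - y" "y \<cdot> v2 = 0" "v2 \<cdot> y = 0"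
    "e \<cdot> v1 = 0" "v1 \<cdot> e = 0" "e \<cdot> v2 = e" "v2 \<cdot> e = \<epsilon>2 *s e"
    "v1 \<cdot> v1 = 0" "v1 \<cdot> v2 = 0" "v2 \<cdot> v1 = 0" "v2 \<cdot> v2 = 0"
    unfolding v1_def v2_def using u1 u2 r ex by (auto simp: mult.commute)
  let ?x = "\<lambda>k. if k = (1::nat) then v1 else v2"
  define m where "m = (if \<epsilon>2 = 0 then MH1 else MH2)"
  have "isomorphic L (extension_algebra n (data_of m a))"
  proof (rule isomorphic_extension[where x = ?x])
    fix u assume u: "u \<in> L0"
    then obtain \<alpha> \<beta> \<epsilon> where wu: "weights u \<alpha> \<beta> \<epsilon>" using weights_exist by blast
    have "weights (u + (- \<alpha>) *s v1) 0 \<beta> \<epsilon>"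
      using weights_linear[OF u v(1) wu w(1), of "- \<alpha>"] by simp
    then have "weights (u + (- \<alpha>) *s v1 + (- \<beta>) *s v2) 0 0 (\<epsilon> - \<beta> * \<epsilon>2)"
      using weights_linear[OF _ v(2) _ w(2), of "u + (- \<alpha>) *s v1" 0 \<beta> \<epsilon> "- \<beta>"] u v by simp
    then have "u + (- \<alpha>) *s v1 + (- \<beta>) *s v2 \<in> N"
      by (intro even_N) (use u v in simp_all)
    then show "\<exists>c. u - (\<Sum>k\<in>gens (data_of m a). c k *s ?x k) \<in> N"
      by (intro exI[of _ "\<lambda>k. if k = 1 then \<alpha> else \<beta>"]) (simp add: m_def algebra_simps)
  next
    fix c assume N: "(\<Sum>k\<in>gens (data_of m a). c k *s ?x k) \<in> N"
    have "(\<Sum>k\<in>gens (data_of m a). c k *s ?x k) = c 1 *s v1 + c 2 *s v2" by (simp add: m_def)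
    then have N': "c 1 *s v1 + c 2 *s v2 \<in> N" using N by simp
    have wc: "weights (c 1 *s v1 + c 2 *s v2) (c 1) (c 2) (c 2 * \<epsilon>2)"
      using weights_linear[OF _ v(2) weights_scale[OF v(1) w(1)] w(2), of "c 1" "c 2"] v by simp
    have mem: "c 1 *s v1 + c 2 *s v2 \<in> L0" using v by simp
    have "weights (c 1 *s v1 + c 2 *s v2) 0 0 0" using N' mem by (rule weights_N)
    then have "c 1 = 0" "c 2 = 0"
      using weights_unique(1,2)[OF mem wc] by blast+
    then show "\<forall>k\<in>gens (data_of m a). c k = 0" by (simp add: m_def)
  qed (use v prods r(3) odd_N in \<open>auto simp: m_def split: if_splits\<close>)
  then show ?thesis unfolding model_eq m_def by (auto split: if_splits)
qed

text \<open>The hypothesis on \<open>u\<close> says that $(\alpha,\beta)$ takes values on a line; hence subtracting a multiple of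
$x$ from $u$ makes both weights vanish, and the difference lies in $N$.\<close>

lemma single_model:
  assumes x: "x \<in> L0" and w: "weights x \<alpha> \<beta> \<epsilon>" and nz: "\<alpha> \<noteq> 0 \<or> \<beta> \<noteq> 0"
    and gen: "\<And>u \<alpha>' \<beta>' \<epsilon>'. u \<in> L0 \<Longrightarrow> weights u \<alpha>' \<beta>' \<epsilon>' \<Longrightarrow> \<exists>c. \<alpha>' = c * \<alpha> \<and> \<beta>' = c * \<beta>"
    and D: "gens D = {1}" "chain_weight D 1 = \<alpha>" "split_weight D 1 = \<beta>" "left_weight D 1 = \<epsilon>"
    and yx: "y \<cdot> x = \<alpha> *s y + (\<Sum>j = 2..n. shift D 1 j *s Yv j)"
    and xy: "x \<cdot> y = - (\<alpha> *s y)" and xx: "x \<cdot> x = square D 1 1 *s e"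
  shows "isomorphic L (extension_algebra n D)"
proof (rule isomorphic_extension[where x = "\<lambda>_. x"])
  fix u assume u: "u \<in> L0"
  then obtain \<alpha>' \<beta>' \<epsilon>' where wu: "weights u \<alpha>' \<beta>' \<epsilon>'" using weights_exist by blast
  then obtain c where c: "\<alpha>' = c * \<alpha>" "\<beta>' = c * \<beta>" using gen u by blast
  have "weights (u + (- c) *s x) 0 0 (\<epsilon>' - c * \<epsilon>)"
    using weights_linear[OF u x wu w, of "- c"] by (simp add: c)
  then have "u + (- c) *s x \<in> N" by (intro even_N) (use u x in simp_all)
  then show "\<exists>c. u - (\<Sum>k\<in>gens D. c k *s x) \<in> N"
    by (intro exI[of _ "\<lambda>_. c"]) (simp add: D)
next
  fix c :: "nat \<Rightarrow> complex" assume "(\<Sum>k\<in>gens D. c k *s x) \<in> N"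
  then have "c 1 *s x \<in> N" by (simp add: D)
  moreover have mem: "c 1 *s x \<in> L0" using x by simp
  ultimately have "weights (c 1 *s x) 0 0 0" by (rule weights_N)
  then have "c 1 * \<alpha> = 0" "c 1 * \<beta> = 0"
    using weights_unique(1,2)[OF mem weights_scale[OF x w]] by blast+
  then show "\<forall>k\<in>gens D. c k = 0" using nz by (auto simp: D)
qed (use x w D yx xy xx odd_N in \<open>auto simp: weights_def\<close>)

text \<open>Here $[x,x]=\xi e$ with $\xi\varepsilon=0$. For $\varepsilon=-\beta\ne0$ the square is zero. For $\varepsilon=0\ne\beta$
it is removed by $x-\frac{\xi}{\beta}e$. For $\varepsilon=\beta=0$ a nonzero square stays, and
rescaling $e$ to $\xi e$ leads to $H_3$.\<close>

lemma diagonal_model: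
  assumes x: "x \<in> L0" "y \<cdot> x = y" and w: "weights x 1 \<beta> \<epsilon>"
    and only: "\<And>u \<beta>' \<epsilon>'. u \<in> L0 \<Longrightarrow> weights u 0 \<beta>' \<epsilon>' \<Longrightarrow> \<beta>' = 0"
  shows "\<exists>m a. admissible m \<and> isomorphic L (model n m a)"
proof -
  obtain u where u: "u \<in> L0" "weights u 1 \<beta> \<epsilon>" "y \<cdot> u = y" "u \<cdot> y = - y"
    using normalise_diagonal[OF x(1) w x(2)] by blast
  have eu: "e \<cdot> u = \<beta> *s e" "u \<cdot> e = \<epsilon> *s e" using u(2) by (simp_all add: weights_def)
  obtain \<xi> where xi: "u \<cdot> u = \<xi> *s e" "\<xi> * \<epsilon> = 0"
    using square_split[OF u(1), of 1 \<epsilon>] u eu by auto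
  have gen: "\<exists>c. \<alpha>' = c * 1 \<and> \<beta>' = c * \<beta>"
    if v: "v \<in> L0" "weights v \<alpha>' \<beta>' \<epsilon>'" for v \<alpha>' \<beta>' \<epsilon>'
  proof -
    have "weights (v + (- \<alpha>') *s u) 0 (\<beta>' - \<alpha>' * \<beta>) (\<epsilon>' - \<alpha>' * \<epsilon>)"
      using weights_linear[OF v(1) u(1) v(2) u(2), of "- \<alpha>'"] by simp
    then have "\<beta>' - \<alpha>' * \<beta> = 0" by (rule only[rotated]) (use u v in simp)
    then show ?thesis by simp
  qed
  consider "\<epsilon> = - \<beta>" "\<beta> \<noteq> 0" | "\<epsilon> = 0" "\<beta> \<noteq> 0" | "\<epsilon> = 0" "\<beta> = 0" "\<xi> = 0" | "\<epsilon> = 0" "\<beta> = 0" "\<xi> \<noteq> 0"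
    using weights_left[OF x(1) w] by (cases "\<beta> = 0"; cases "\<xi> = 0") auto
  then show ?thesis
  proof cases
    case 1
    then have "\<xi> = 0" using xi by simp
    then have "isomorphic L (extension_algebra n (data_of (H1 \<beta>) (\<lambda>_. 0)))"
      using u xi 1 by (intro single_model[OF u(1,2) _ gen]) auto
    then show ?thesis using 1 unfolding model_eq[symmetric] by (intro exI[of _ "H1 \<beta>"]) auto
  next
    case 2
    define v where "v = u - (\<xi> / \<beta>) *s e"
    have v: "v \<in> L0" "y \<cdot> v = y" "v \<cdot> y = - y" "v \<cdot> v = 0"
      using u eu xi 2 by (simp_all add: v_def)
    have wv: "weights v 1 \<beta> \<epsilon>" using weights_modulo_N[OF u(1,2) v(1)] by (simp add: v_def)
    have "isomorphic L (extension_algebra n (data_of (H2 \<beta>) (\<lambda>_. 0)))"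
      using v 2 by (intro single_model[OF v(1) wv _ gen]) auto
    then show ?thesis unfolding model_eq[symmetric] by (intro exI[of _ "H2 \<beta>"]) auto
  next
    case 3
    have "isomorphic L (extension_algebra n (data_of (H2 0) (\<lambda>_. 0)))"
      using u xi 3 by (intro single_model[OF u(1,2) _ gen]) auto
    then show ?thesis unfolding model_eq[symmetric] by (intro exI[of _ "H2 0"]) auto
  next
    case 4
    interpret F: frame L N n y "\<xi> *s e" using 4 by (intro change_split)
    interpret F: maximal_frame L N n y "\<xi> *s e" using maximal by unfold_locales
    have weq: "F.weights v \<alpha>' \<beta>' \<epsilon>' \<longleftrightarrow> weights v \<alpha>' \<beta>' \<epsilon>'" if "v \<in> L0" for v \<alpha>' \<beta>' \<epsilon>'
    proof -
      have "\<xi> *s a = c *s \<xi> *s b \<longleftrightarrow> a = c *s b" for a b c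
        using 4 by (metis vs.scale_left_commute vs.scale_cancel_left)
      then show ?thesis using that unfolding F.weights_def weights_def by simp
    qed
    have "isomorphic L (extension_algebra n (data_of H3 (\<lambda>_. 0)))"
    proof (rule F.single_model[OF u(1)])
      show "F.weights u 1 \<beta> \<epsilon>" using u weq by simp
      show "\<exists>c. \<alpha>' = c * 1 \<and> \<beta>' = c * \<beta>" if "v \<in> L0" "F.weights v \<alpha>' \<beta>' \<epsilon>'" for v \<alpha>' \<beta>' \<epsilon>'
        using gen that weq by blast
    qed (use u xi 4 in auto)
    then show ?thesis unfolding model_eq[symmetric] by (intro exI[of _ H3]) auto
  qed
qed

text \<open>With $\alpha=0$ there is no eigenvector to pass to: the tail of $[y,x]$ gives the parameters $a_j$. The square
$\xi e$ is removed by $x-\xi e$ if $\varepsilon=0$; if $\varepsilon=-1$ it vanishes by $\xi\varepsilon=0$, so only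
$\gamma=0$ occurs.\<close>

lemma shift_model:
  assumes x: "x \<in> L0" and w: "weights x 0 1 \<epsilon>"
    and only: "\<And>u \<alpha>' \<beta>' \<epsilon>'. u \<in> L0 \<Longrightarrow> weights u \<alpha>' \<beta>' \<epsilon>' \<Longrightarrow> \<alpha>' = 0"
  shows "\<exists>m a. admissible m \<and> isomorphic L (model n m a)"
proof -
  obtain u where u: "u \<in> L0" "weights u 0 1 \<epsilon>" "u \<cdot> y = 0"
    using normalise_nilpotent[OF x w] by blast
  have eu: "e \<cdot> u = e" "u \<cdot> e = \<epsilon> *s e" using u(2) by (simp_all add: weights_def)
  obtain \<xi> where xi: "u \<cdot> u = \<xi> *s e" "\<xi> * \<epsilon> = 0"
    using square_split[OF u(1), of 0 \<epsilon>] u eu by auto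
  have gen: "\<exists>c. \<alpha>' = c * 0 \<and> \<beta>' = c * 1"
    if v: "v \<in> L0" "weights v \<alpha>' \<beta>' \<epsilon>'" for v \<alpha>' \<beta>' \<epsilon>'
    using only[OF v] by simp
  define v where "v = u - \<xi> *s e"
  have v: "v \<in> L0" "v \<cdot> y = 0" using u by (simp_all add: v_def)
  have wv: "weights v 0 1 \<epsilon>" using weights_modulo_N[OF u(1,2) v(1)] by (simp add: v_def)
  obtain z where z: "z \<in> L1" "z \<in> N" "y \<cdot> v = z \<cdot> y \<cdot> y"
    using wv unfolding weights_def by auto
  obtain a where a: "y \<cdot> v = (\<Sum>j = 2..n. a j *s Yv j)"
    using shift_expand[OF z(1,2)] z(3) by metis
  have vv: "v \<cdot> v = 0" using u eu xi by (simp add: v_def)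
  consider "\<epsilon> = 0" | "\<epsilon> = - 1" using weights_left[OF x w] by blast
  then show ?thesis
  proof cases
    case 1
    have "isomorphic L (extension_algebra n (data_of H4 a))"
      using v vv a 1 by (intro single_model[OF v(1) wv _ gen]) auto
    then show ?thesis unfolding model_eq[symmetric] by (intro exI[of _ H4]) auto
  next
    case 2
    have "isomorphic L (extension_algebra n (data_of (H5 0) a))"
      using v vv a 2 by (intro single_model[OF v(1) wv _ gen]) auto
    then show ?thesis unfolding model_eq[symmetric] by (intro exI[of _ "H5 0"]) auto
  qed
qed

text \<open>The three cases are: no weight $\alpha$ occurs; both weights occur independently; $\alpha$ occurs and
determines $\beta$. In the last two the generator is first replaced by an eigenvector. With two generators
this is done for the one of weights $(1,0)$.\<close>

lemma classification:
  assumes nonnil: "\<not> L0 \<subseteq> N"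
  shows "\<exists>m a. admissible m \<and> isomorphic L (model n m a)"
proof (cases "\<exists>x \<alpha> \<beta> \<epsilon>. x \<in> L0 \<and> weights x \<alpha> \<beta> \<epsilon> \<and> \<alpha> \<noteq> 0")
  case False
  obtain x where x: "x \<in> L0" "x \<notin> N" using nonnil by blast
  obtain \<alpha> \<beta> \<epsilon> where w: "weights x \<alpha> \<beta> \<epsilon>" using weights_exist[OF x(1)] by blast
  have "\<alpha> = 0" using False x w by blast
  moreover from this have "\<beta> \<noteq> 0" using even_N x w by blast
  ultimately have "weights ((1 / \<beta>) *s x) 0 1 ((1 / \<beta>) * \<epsilon>)"
    using weights_scale[OF x(1) w, of "1 / \<beta>"] by simp
  then show ?thesis using shift_model[of "(1 / \<beta>) *s x"] x False by fastforce
next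
  case True
  then obtain x0 \<alpha>0 \<beta>0 \<epsilon>0 where x0: "x0 \<in> L0" "weights x0 \<alpha>0 \<beta>0 \<epsilon>0" "\<alpha>0 \<noteq> 0" by blast
  define x where "x = (1 / \<alpha>0) *s x0"
  have x: "x \<in> L0" using x0 by (simp add: x_def)
  have wx: "weights x 1 (\<beta>0 / \<alpha>0) (\<epsilon>0 / \<alpha>0)"
    using weights_scale[OF x0(1,2), of "1 / \<alpha>0"] x0(3) by (simp add: x_def)
  show ?thesis
  proof (cases "\<exists>u \<beta> \<epsilon>. u \<in> L0 \<and> weights u 0 \<beta> \<epsilon> \<and> \<beta> \<noteq> 0")
    case True
    then obtain u0 \<beta> \<epsilon> where u0: "u0 \<in> L0" "weights u0 0 \<beta> \<epsilon>" "\<beta> \<noteq> 0" by blast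
    define x2 where "x2 = (1 / \<beta>) *s u0"
    have x2: "x2 \<in> L0" using u0 by (simp add: x2_def)
    have wx2: "weights x2 0 1 (\<epsilon> / \<beta>)"
      using weights_scale[OF u0(1,2), of "1 / \<beta>"] u0(3) by (simp add: x2_def)
    define x1 where "x1 = x + (- (\<beta>0 / \<alpha>0)) *s x2"
    have x1: "x1 \<in> L0" using x x2 by (simp add: x1_def)
    obtain \<epsilon>1 where wx1: "weights x1 1 0 \<epsilon>1"
      using weights_linear[OF x x2 wx wx2, of "- (\<beta>0 / \<alpha>0)"] by (auto simp: x1_def)
    obtain z where z: "z \<in> L1" "z \<in> N" "y \<cdot> x1 = 1 *s y + z \<cdot> y \<cdot> y"
      using wx1 unfolding weights_def by blast
    obtain w where w: "w \<in> L1" "w \<in> N" and eig: "(y + w \<cdot> y \<cdot> y) \<cdot> x1 = y + w \<cdot> y \<cdot> y"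
      using eigenvector[OF x1 z] by blast
    interpret F: frame L N n "y + w \<cdot> y \<cdot> y" e using w by (rule change_chain)
    interpret F: maximal_frame L N n "y + w \<cdot> y \<cdot> y" e using maximal by unfold_locales
    show ?thesis
      using F.pair_model[OF x1 eig weights_change_chain[OF w x1 wx1] x2 weights_change_chain[OF w x2 wx2], of "\<lambda>_. 0"]
      by (metis admissible.simps(3,4))
  next
    case False
    obtain z where z: "z \<in> L1" "z \<in> N" "y \<cdot> x = 1 *s y + z \<cdot> y \<cdot> y"
      using wx unfolding weights_def by blast
    obtain w where w: "w \<in> L1" "w \<in> N" and eig: "(y + w \<cdot> y \<cdot> y) \<cdot> x = y + w \<cdot> y \<cdot> y"
      using eigenvector[OF x z] by blast
    interpret F: frame L N n "y + w \<cdot> y \<cdot> y" e using w by (rule change_chain)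
    interpret F: maximal_frame L N n "y + w \<cdot> y \<cdot> y" e using maximal by unfold_locales
    show ?thesis
    proof (rule F.diagonal_model[OF x eig weights_change_chain[OF w x wx]])
      fix u \<beta>' \<epsilon>' assume u: "u \<in> L0" "F.weights u 0 \<beta>' \<epsilon>'"
      obtain \<alpha>'' \<beta>'' \<epsilon>'' where wu: "weights u \<alpha>'' \<beta>'' \<epsilon>''" using weights_exist[OF u(1)] by blast
      then have "F.weights u \<alpha>'' \<beta>'' \<epsilon>''" using weights_change_chain[OF w u(1)] by blast
      then have "\<alpha>'' = 0" "\<beta>'' = \<beta>'" using F.weights_unique[OF u(1)] u(2) by blast+
      then show "\<beta>' = 0" using False u(1) wu by blast
    qed
  qed
qed

end

section \<open>The frame of the nilradical\<close>

lemma lookup_bracket_single: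
  assumes "finite B0" "finite B1" "q \<in> B0 \<union> B1"
  shows "lookup (bracket (from_table B0 B1 T) u (single q c)) r
       = c * (\<Sum>p \<in> B0 \<union> B1. lookup u p * lookup (T p q) r)"
    and "lookup (bracket (from_table B0 B1 T) (single q c) u) r
       = c * (\<Sum>p \<in> B0 \<union> B1. lookup u p * lookup (T q p) r)"
proof -
  let ?B = "B0 \<union> B1"
  have fin: "finite ?B" using assms by simp
  have "lookup (bracket (from_table B0 B1 T) u (single q c)) r
      = (\<Sum>p \<in> ?B. \<Sum>q' \<in> ?B. if q' = q then c * (lookup u p * lookup (T p q) r) else 0)"
    unfolding lookup_bracket_from_table by (intro sum.cong refl) (auto simp: lookup_single when_def)
  then show "lookup (bracket (from_table B0 B1 T) u (single q c)) r
       = c * (\<Sum>p \<in> ?B. lookup u p * lookup (T p q) r)"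
    using assms(3) fin by (simp add: sum.delta sum_distrib_left del: Un_iff)
  have "lookup (bracket (from_table B0 B1 T) (single q c) u) r
      = (\<Sum>p' \<in> ?B. if p' = q then (\<Sum>p \<in> ?B. c * (lookup u p * lookup (T q p) r)) else 0)"
    unfolding lookup_bracket_from_table by (intro sum.cong refl) (auto simp: lookup_single when_def mult.assoc)
  then show "lookup (bracket (from_table B0 B1 T) (single q c) u) r
       = c * (\<Sum>p \<in> ?B. lookup u p * lookup (T q p) r)"
    using assms(3) fin by (simp add: sum.delta sum_distrib_left del: Un_iff)
qed

lemma sum_basis:
  assumes "finite K"
  shows "(\<Sum>p \<in> (E ` {1..n} \<union> X ` K) \<union> Y ` {1..n}. f p) = (\<Sum>i = 1..n. f (E i)) + (\<Sum>k\<in>K. f (X k)) + (\<Sum>i = 1..n. f (Y i))"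
proof -
  have "(\<Sum>p \<in> (E ` {1..n} \<union> X ` K) \<union> Y ` {1..n}. f p) = sum f (E ` {1..n}) + sum f (X ` K) + sum f (Y ` {1..n})"
    using assms by (subst sum.union_disjoint, auto)+
  then show ?thesis by (simp add: sum.reindex inj_on_def)
qed

lemma lookup_bracket_Y1:
  assumes n: "n \<ge> 3" and fin: "finite (gens D)"
  shows "lookup (bracket (extension_algebra n D) u (single (Y 1) 1)) r =
    (case r of
       E i \<Rightarrow> if i = 1 then lookup u (Y 1) else if 3 \<le> i \<and> i \<le> n then lookup u (Y (i - 1)) else 0
     | Y i \<Rightarrow> if i = 1 then - (\<Sum>k\<in>gens D. chain_weight D k * lookup u (X k))
              else if i = 2 then lookup u (E 1) / 2
              else if 3 \<le> i \<and> i \<le> n then lookup u (E i) / 2 else 0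
     | X k \<Rightarrow> 0)"
proof -
  have L: "lookup (bracket (extension_algebra n D) u (single (Y 1) 1)) r
      = (\<Sum>i = 1..n. lookup u (E i) * lookup (nil_table n (E i) (Y 1)) r)
      + (\<Sum>k\<in>gens D. lookup u (X k) * lookup (extension_table n D (X k) (Y 1)) r)
      + (\<Sum>i = 1..n. lookup u (Y i) * lookup (nil_table n (Y i) (Y 1)) r)"
  proof -
    have "finite (E ` {1..n} \<union> X ` gens D)" "finite (Y ` {1..n})"
      and "Y 1 \<in> (E ` {1..n} \<union> X ` gens D) \<union> Y ` {1..n}" using n fin by auto
    note brackets = lookup_bracket_single(1)[OF this]
    show ?thesis
      unfolding extension_algebra_def brackets sum_basis[OF fin] lookup_add by simp
  qed
  show ?thesis
  proof (cases r)
    case (E i)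
    have "(\<Sum>j = 1..n. lookup u (Y j) * lookup (nil_table n (Y j) (Y 1)) r)
      = (\<Sum>j = 1..n. if j = (if i = 1 then 1 else i - 1) then
            (if i = 1 then lookup u (Y 1) else if 3 \<le> i \<and> i \<le> n then lookup u (Y (i - 1)) else 0) else 0)"
      using n by (intro sum.cong) (auto simp: E lookup_single when_def)
    also have "\<dots> = (if i = 1 then lookup u (Y 1) else if 3 \<le> i \<and> i \<le> n then lookup u (Y (i - 1)) else 0)"
      using n by (subst sum.delta) auto
    finally show ?thesis
      unfolding L by (simp add: E lookup_single when_def if_distrib[of "\<lambda>v. lookup v _"] cong: if_cong)
  next
    case (Y i)
    have "(\<Sum>j = 1..n. lookup u (E j) * lookup (nil_table n (E j) (Y 1)) r)
      = (\<Sum>j = 1..n. if j = (if i = 2 then 1 else i) then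
            (if i = 2 then lookup u (E 1) / 2 else if 3 \<le> i \<and> i \<le> n then lookup u (E i) / 2 else 0) else 0)"
      using n by (intro sum.cong) (auto simp: Y lookup_single when_def)
    also have "\<dots> = (if i = 2 then lookup u (E 1) / 2 else if 3 \<le> i \<and> i \<le> n then lookup u (E i) / 2 else 0)"
      using n by (subst sum.delta) auto
    finally have 1: "(\<Sum>j = 1..n. lookup u (E j) * lookup (nil_table n (E j) (Y 1)) r) = \<dots>" .
    have 2: "(\<Sum>j = 1..n. lookup u (Y j) * lookup (nil_table n (Y j) (Y 1)) r) = 0"
      by (intro sum.neutral) (auto simp: Y lookup_single when_def)
    have 3: "(\<Sum>k\<in>gens D. lookup u (X k) * lookup (extension_table n D (X k) (Y 1)) r)
        = (if i = 1 then - (\<Sum>k\<in>gens D. chain_weight D k * lookup u (X k)) else 0)"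
      by (auto simp: Y lookup_single when_def mult.commute simp flip: sum_negf intro!: sum.cong)
    show ?thesis unfolding L 1 2 3 by (simp add: Y)
  next
    case (X k)
    have 1: "lookup (nil_table n (E j) (Y 1)) r = 0" "lookup (nil_table n (Y j) (Y 1)) r = 0"
      "lookup (extension_table n D (X l) (Y 1)) r = 0" for j l
      by (auto simp: X lookup_single when_def)
    show ?thesis unfolding L 1 by (simp add: X)
  qed
qed

text \<open>With no additional generators the common table is that of $H(0,\dots,0)$.\<close>

abbreviation nil_data :: extension where
  "nil_data \<equiv> \<lparr>gens = {}, chain_weight = (\<lambda>_. 0), split_weight = (\<lambda>_. 0), left_weight = (\<lambda>_. 0),
     shift = (\<lambda>_ _. 0), square = (\<lambda>_ _. 0)\<rparr>"

lemma H_zero_eq: "H_zero n = extension_algebra n nil_data"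
  unfolding H_zero_def extension_algebra_def by (auto intro!: from_table_cong)

lemma scale_H_zero [simp]: "scale (H_zero n) = smul"
  by (simp add: H_zero_def)

lemma H_zero_bracket:
  assumes "n \<ge> 3"
  shows "lookup (bracket (H_zero n) u (single (Y 1) 1)) (E i) =
      (if i = 1 then lookup u (Y 1) else if 3 \<le> i \<and> i \<le> n then lookup u (Y (i - 1)) else 0)"
    and "lookup (bracket (H_zero n) u (single (Y 1) 1)) (Y i) =
      (if i = 2 then lookup u (E 1) / 2 else if 3 \<le> i \<and> i \<le> n then lookup u (E i) / 2 else 0)"
    and "lookup (bracket (H_zero n) u (single (Y 1) 1)) (X k) = 0"
  unfolding H_zero_eq using assms by (simp_all add: lookup_bracket_Y1 del: One_nat_def)

lemma H_zero_parts:
  "u \<in> even_part (H_zero n) \<longleftrightarrow> keys u \<subseteq> E ` {1..n}"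
  "u \<in> odd_part (H_zero n) \<longleftrightarrow> keys u \<subseteq> Y ` {1..n}"
  by (simp_all add: H_zero_def)

lemma carrier_H_zero: "carrier (H_zero n) = {u. keys u \<subseteq> E ` {1..n} \<union> Y ` {1..n}}"
  unfolding H_zero_def by (rule carrier_from_table) auto

lemma H_zero_closed:
  assumes "n \<ge> 3"
  shows "carrier_closed (H_zero n)"
  unfolding H_zero_eq extension_algebra_def
  by (intro carrier_closed_from_table keys_table assms) auto

lemma keys_odd_lookup: "keys u \<subseteq> Y ` A \<Longrightarrow> lookup u (E i) = 0"
  "keys u \<subseteq> Y ` A \<Longrightarrow> lookup u (X i) = 0"
  "keys u \<subseteq> Y ` A \<Longrightarrow> i \<notin> A \<Longrightarrow> lookup u (Y i) = 0"
  by (auto simp: keys_subset_iff)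

lemma keys_even_lookup: "keys u \<subseteq> E ` A \<Longrightarrow> lookup u (Y i) = 0"
  "keys u \<subseteq> E ` A \<Longrightarrow> lookup u (X i) = 0"
  "keys u \<subseteq> E ` A \<Longrightarrow> i \<notin> A \<Longrightarrow> lookup u (E i) = 0"
  by (auto simp: keys_subset_iff)

text \<open>In coordinates $R^2$ is half the shift $y_i\mapsto y_{i+1}$ on the odd part.\<close>

lemma H_zero_even_power:
  assumes n: "n \<ge> 3" and z: "keys z \<subseteq> Y ` {1..n}"
  defines "w \<equiv> \<lambda>m. right_pow (H_zero n) (single (Y 1) 1) (2 * m) z"
  shows "lookup (w m) (E i) = 0"
    and "lookup (w m) (Y i) = (if m < i \<and> i \<le> n then lookup z (Y (i - m)) / 2 ^ m else 0)"
proof -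
  have "(\<forall>i. lookup (w m) (E i) = 0) \<and>
      (\<forall>i. lookup (w m) (Y i) = (if m < i \<and> i \<le> n then lookup z (Y (i - m)) / 2 ^ m else 0))"
  proof (induction m)
    case 0
    then show ?case using z by (auto simp: w_def right_pow_def keys_odd_lookup)
  next
    case (Suc m)
    have "w (Suc m) = bracket (H_zero n) (bracket (H_zero n) (w m) (single (Y 1) 1)) (single (Y 1) 1)"
      by (simp add: w_def right_pow_def)
    then show ?case using Suc n by (auto simp: H_zero_bracket[unfolded One_nat_def] Suc_diff_le)
  qed
  then show "lookup (w m) (E i) = 0"
    and "lookup (w m) (Y i) = (if m < i \<and> i \<le> n then lookup z (Y (i - m)) / 2 ^ m else 0)"
    by blast+
qed

lemma H_zero_frame:
  assumes n: "n \<ge> 3"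
  defines "y \<equiv> single (Y 1) 1" and "e \<equiv> single (E 2) 1"
  shows "z \<in> odd_part (H_zero n) \<Longrightarrow> \<exists>c z'. z' \<in> odd_part (H_zero n) \<and>
        z = smul c y + bracket (H_zero n) (bracket (H_zero n) z' y) y"
    and "z \<in> even_part (H_zero n) \<Longrightarrow> \<exists>c z'. z' \<in> odd_part (H_zero n) \<and> z = smul c e + bracket (H_zero n) z' y"
    and "bracket (H_zero n) e y = 0" and "bracket (H_zero n) z e = 0"
    and "right_pow (H_zero n) y (2 * n - 2) y \<noteq> 0"
    and "z \<in> odd_part (H_zero n) \<Longrightarrow> right_pow (H_zero n) y (2 * n - 1) z = 0"
proof -
  note br = H_zero_bracket[OF n, folded y_def]
  have ly: "lookup y p = (if p = Y 1 then 1 else 0)" for p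
    by (auto simp: y_def lookup_single when_def)
  show "\<exists>c z'. z' \<in> odd_part (H_zero n) \<and> z = smul c y + bracket (H_zero n) (bracket (H_zero n) z' y) y"
    if "z \<in> odd_part (H_zero n)"
  proof -
    have z: "keys z \<subseteq> Y ` {1..n}" using that by (simp add: H_zero_parts)
    define z' where "z' = (\<Sum>j = 1..n - 1. single (Y j) (2 * lookup z (Y (j + 1))))"
    have l: "lookup z' (Y j) = (if 1 \<le> j \<and> j \<le> n - 1 then 2 * lookup z (Y (j + 1)) else 0)"
      "lookup z' (E j) = 0" "lookup z' (X j) = 0" for j
      by (auto simp: z'_def)
    have "z' \<in> odd_part (H_zero n)"
      unfolding H_zero_parts keys_subset_iff
    proof (intro allI impI)
      fix p assume "p \<notin> Y ` {1..n}"
      then show "lookup z' p = 0" by (cases p) (auto simp: l)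
    qed
    moreover have "z = smul (lookup z (Y 1)) y + bracket (H_zero n) (bracket (H_zero n) z' y) y"
    proof (rule poly_mapping_eqI)
      fix p show "lookup z p = lookup (smul (lookup z (Y 1)) y + bracket (H_zero n) (bracket (H_zero n) z' y) y) p"
        using z n by (cases p) (auto simp: lookup_add ly br l keys_odd_lookup numeral_2_eq_2)
    qed
    ultimately show ?thesis by blast
  qed
  show "\<exists>c z'. z' \<in> odd_part (H_zero n) \<and> z = smul c e + bracket (H_zero n) z' y"
    if "z \<in> even_part (H_zero n)"
  proof -
    have z: "keys z \<subseteq> E ` {1..n}" using that by (simp add: H_zero_parts)
    define z' where "z' = (\<Sum>j = 1..n - 1. single (Y j) (lookup z (E (if j = 1 then 1 else j + 1))))"
    have l: "lookup z' (Y j) = (if 1 \<le> j \<and> j \<le> n - 1 then lookup z (E (if j = 1 then 1 else j + 1)) else 0)"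
      "lookup z' (E j) = 0" "lookup z' (X j) = 0" for j
      by (auto simp: z'_def)
    have "z' \<in> odd_part (H_zero n)"
      unfolding H_zero_parts keys_subset_iff
    proof (intro allI impI)
      fix p assume "p \<notin> Y ` {1..n}"
      then show "lookup z' p = 0" by (cases p) (auto simp: l)
    qed
    moreover have "z = smul (lookup z (E 2)) e + bracket (H_zero n) z' y"
    proof (rule poly_mapping_eqI)
      fix p show "lookup z p = lookup (smul (lookup z (E 2)) e + bracket (H_zero n) z' y) p"
      proof (cases p)
        case (E i)
        consider "i = 0" | "i = 1" | "i = 2" | "3 \<le> i" "i \<le> n" | "n < i" by linarith
        then show ?thesis using z n
          by cases (auto simp: E lookup_add e_def lookup_single when_def br l keys_even_lookup)
      qed (use z n in \<open>auto simp: lookup_add e_def lookup_single when_def br l keys_even_lookup\<close>)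
    qed
    ultimately show ?thesis by blast
  qed
  show "bracket (H_zero n) e y = 0"
  proof (rule poly_mapping_eqI)
    fix p show "lookup (bracket (H_zero n) e y) p = lookup 0 p"
      by (cases p) (auto simp: br e_def lookup_single when_def)
  qed
  have z2: "nil_table n p (E 2) = 0" for p by (cases p) auto
  show "bracket (H_zero n) z e = 0"
    using n by (intro poly_mapping_eqI) (simp add: H_zero_def e_def lookup_bracket_single z2)
  have "keys y \<subseteq> Y ` {1..n}" using n by (auto simp: y_def)
  then have "lookup (right_pow (H_zero n) y (2 * (n - 1)) y) (Y n) \<noteq> 0"
    unfolding y_def using n by (subst H_zero_even_power(2)) (auto simp: lookup_single)
  moreover have "2 * (n - 1) = 2 * n - 2" by simp
  ultimately show "right_pow (H_zero n) y (2 * n - 2) y \<noteq> 0" by auto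
  show "right_pow (H_zero n) y (2 * n - 1) z = 0" if "z \<in> odd_part (H_zero n)"
  proof -
    have z: "keys z \<subseteq> Y ` {1..n}" using that by (simp add: H_zero_parts)
    have "2 * n - 1 = Suc (2 * (n - 1))" using n by simp
    then have "right_pow (H_zero n) y (2 * n - 1) z = bracket (H_zero n) (right_pow (H_zero n) y (2 * (n - 1)) z) y"
      by (simp add: right_pow_def)
    also have "\<dots> = 0"
    proof (rule poly_mapping_eqI)
      fix p show "lookup (bracket (H_zero n) (right_pow (H_zero n) y (2 * (n - 1)) z) y) p = lookup 0 p"
        using n z H_zero_even_power[OF n z, folded y_def, of "n - 1"]
        by (cases p) (auto simp: br)
    qed
    finally show ?thesis .
  qed
qed

text \<open>The given isomorphism carries the frame of $H(0,\dots,0)$ to one of $N$. If $N$ contained the even part, it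
would contain the odd part as well, and $L=N$ would be nilpotent.\<close>

theorem extension_is_model:
  fixes L :: "('a::ab_group_add) superalgebra"
  assumes n: "n \<ge> 3" and L: "leibniz_superalgebra L" and nonnil: "\<not> nilpotent L"
    and N: "is_nilradical L N" and iso: "isomorphic (restrict L N) (H_zero n)"
  shows "\<exists>m a. admissible m \<and> isomorphic L (model n m a)"
proof -
  let ?H = "H_zero n" and ?M = "restrict L N"
  define y0 e0 :: vec where y0: "y0 = single (Y 1) 1" and e0: "e0 = single (E 2) 1"
  note H_frame = H_zero_frame[OF n, folded y0 e0]
  interpret leibniz_over_ideal L N
    using L N by unfold_locales (simp_all add: is_nilradical_def)
  have carM: "carrier ?M = N" using ideal_N by (simp add: ideal_def)
  have "carrier_closed ?M" "parts_in_carrier ?M"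
    unfolding carrier_closed_def parts_in_carrier_def carM by auto
  then obtain g where g: "is_isomorphism g ?H ?M"
    using isomorphic_sym[OF _ _ iso] unfolding isomorphic_iff by blast
  have gb: "bij_betw g (carrier ?H) N" and ge: "g ` even_part ?H = even_part L \<inter> N"
    and go: "g ` odd_part ?H = odd_part L \<inter> N"
    and gadd: "\<And>u v. u \<in> carrier ?H \<Longrightarrow> v \<in> carrier ?H \<Longrightarrow> g (u + v) = g u + g v"
    and gscale: "\<And>c u. u \<in> carrier ?H \<Longrightarrow> g (smul c u) = c *s g u"
    and gbr: "\<And>u v. u \<in> carrier ?H \<Longrightarrow> v \<in> carrier ?H \<Longrightarrow> g (bracket ?H u v) = g u \<cdot> g v"
    using g carM by (auto simp: is_isomorphism_def)
  have closed: "0 \<in> carrier ?H" "\<And>u v. u \<in> carrier ?H \<Longrightarrow> v \<in> carrier ?H \<Longrightarrow> u + v \<in> carrier ?H"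
    "\<And>u v. u \<in> carrier ?H \<Longrightarrow> v \<in> carrier ?H \<Longrightarrow> bracket ?H u v \<in> carrier ?H"
    "\<And>c u. u \<in> carrier ?H \<Longrightarrow> smul c u \<in> carrier ?H"
    using H_zero_closed[OF n] by (simp_all add: carrier_closed_def)
  have g0: "g 0 = 0" using gadd[OF closed(1,1)] by simp
  have inj: "g u = 0 \<longleftrightarrow> u = 0" if "u \<in> carrier ?H" for u
    using gb that closed(1) g0 unfolding bij_betw_def inj_on_def by metis
  have parts: "u \<in> carrier ?H" if "u \<in> even_part ?H \<or> u \<in> odd_part ?H" for u
    using that by (auto simp: H_zero_parts carrier_H_zero)
  have y: "y0 \<in> odd_part ?H" "y0 \<in> carrier ?H" and e: "e0 \<in> even_part ?H" "e0 \<in> carrier ?H"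
    using n by (auto simp: H_zero_parts carrier_H_zero y0 e0)
  have pow: "right_pow ?H y0 k u \<in> carrier ?H \<and> g (right_pow ?H y0 k u) = right_pow L (g y0) k (g u)"
    if "u \<in> carrier ?H" for k u
    by (induction k) (use that closed(3) gbr y in \<open>simp_all add: right_pow_def\<close>)
  interpret frame L N n "g y0" "g e0"
  proof unfold_locales
    show "3 \<le> n" by (rule n)
    show "g y0 \<in> odd_part L" "g y0 \<in> N" "g e0 \<in> even_part L" "g e0 \<in> N"
      using y e go ge by blast+
    have "lookup e0 (E 2) \<noteq> 0" by (simp add: e0)
    then have "e0 \<noteq> 0" by force
    then show "g e0 \<noteq> 0" using inj e by simp
    show "\<exists>c z'. z' \<in> odd_part L \<and> z' \<in> N \<and> z = c *s g y0 + z' \<cdot> g y0 \<cdot> g y0"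
      if z: "z \<in> odd_part L" "z \<in> N" for z
    proof -
      obtain u where u: "u \<in> odd_part ?H" "z = g u" using z go by blast
      then obtain c v where v: "v \<in> odd_part ?H" "u = smul c y0 + bracket ?H (bracket ?H v y0) y0"
        using H_frame(1) by blast
      then have "z = c *s g y0 + g v \<cdot> g y0 \<cdot> g y0"
        using u(2) y parts[of v] by (simp add: gadd gscale gbr closed)
      then show ?thesis using v(1) go by blast
    qed
    show "\<exists>c z'. z' \<in> odd_part L \<and> z' \<in> N \<and> z = c *s g e0 + z' \<cdot> g y0"
      if z: "z \<in> even_part L" "z \<in> N" for z
    proof -
      obtain u where u: "u \<in> even_part ?H" "z = g u" using z ge by blast
      then obtain c v where v: "v \<in> odd_part ?H" "u = smul c e0 + bracket ?H v y0"
        using H_frame(2) by blast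
      then have "z = c *s g e0 + g v \<cdot> g y0"
        using u(2) y e parts[of v] by (simp add: gadd gscale gbr closed)
      then show ?thesis using v(1) go by blast
    qed
    show "g e0 \<cdot> g y0 = 0" using gbr[OF e(2) y(2)] H_frame(3) g0 by simp
    show "z \<cdot> g e0 = 0" if zN: "z \<in> N" for z
    proof -
      obtain u where "u \<in> carrier ?H" "z = g u" using zN gb by (auto simp: bij_betw_def)
      then show ?thesis using gbr[OF _ e(2), of u] H_frame(4) g0 by simp
    qed
    show "right_pow L (g y0) (2 * n - 2) (g y0) \<noteq> 0"
      using pow[OF y(2)] inj H_frame(5) by metis
    show "right_pow L (g y0) (2 * n - 1) z = 0" if z: "z \<in> odd_part L" "z \<in> N" for z
    proof -
      obtain u where u: "u \<in> odd_part ?H" "z = g u" using z go by blast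
      then show ?thesis using pow[of u "2 * n - 1"] parts[of u] H_frame(6)[OF u(1)] g0 by simp
    qed
  qed
  interpret maximal_frame L N n "g y0" "g e0"
    using N by unfold_locales (auto simp: is_nilradical_def)
  have "\<not> even_part L \<subseteq> N"
  proof
    assume "even_part L \<subseteq> N"
    then have "carrier L = N"
      using odd_N by (auto elim!: carrier_cases simp: subset_iff)
    then have "lower_central ?M k = lower_central L k" for k
      by (induction k) (simp_all add: carM bracket_span_def)
    then have "nilpotent L"
      using over by (simp add: nilpotent_ideal_over_square_def nilpotent_def)
    then show False using nonnil by contradiction
  qed
  then show ?thesis by (rule classification)
qed

section \<open>Invariants separating the models\<close>

text \<open>In the models \<open>odd_socle\<close> is the line of $y_n$. The vectors \<open>split_vector\<close> are the nonzero multiples of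
$e_2$; the last condition excludes the generators $x$ that kill the odd part as well, because
$[e_2,x]=e_2$ is not a multiple of $x$.\<close>

definition odd_socle :: "('a::ab_group_add) superalgebra \<Rightarrow> 'a set" where
  "odd_socle L = {v \<in> odd_part L. \<forall>w \<in> odd_part L. bracket L v w = 0}"

definition even_annihilator :: "('a::ab_group_add) superalgebra \<Rightarrow> 'a set" where
  "even_annihilator L = {v \<in> even_part L. \<forall>w \<in> odd_part L. bracket L v w = 0}"

definition split_vector :: "('a::ab_group_add) superalgebra \<Rightarrow> 'a \<Rightarrow> bool" where
  "split_vector L e \<longleftrightarrow>
     e \<in> even_annihilator L \<and> e \<noteq> 0 \<and> (\<forall>w \<in> even_annihilator L. \<exists>r. bracket L w e = scale L r e)"

definition weight_set :: "('a::ab_group_add) superalgebra \<Rightarrow> (complex \<times> complex \<times> complex) set" where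
  "weight_set L = {(s, t, r). \<exists>u \<in> even_part L. \<exists>v \<in> odd_socle L. \<exists>e. v \<noteq> 0 \<and> split_vector L e \<and>
     bracket L v u = scale L s v \<and> bracket L e u = scale L t e \<and> bracket L u e = scale L r e}"

definition split_square :: "('a::ab_group_add) superalgebra \<Rightarrow> bool" where
  "split_square L \<longleftrightarrow> (\<exists>u \<in> even_part L. split_vector L (bracket L u u))"

lemma invariants_subset:
  assumes L: "carrier_closed L" "parts_in_carrier L" and f: "is_isomorphism f L M"
  shows "weight_set L \<subseteq> weight_set M" and "split_square L \<Longrightarrow> split_square M"
proof -
  have inj: "inj_on f (carrier L)" and f0: "f ` even_part L = even_part M" and f1: "f ` odd_part L = odd_part M"
    and fadd: "\<And>u v. u \<in> carrier L \<Longrightarrow> v \<in> carrier L \<Longrightarrow> f (u + v) = f u + f v"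
    and fs: "\<And>c u. u \<in> carrier L \<Longrightarrow> f (scale L c u) = scale M c (f u)"
    and fb: "\<And>u v. u \<in> carrier L \<Longrightarrow> v \<in> carrier L \<Longrightarrow> f (bracket L u v) = bracket M (f u) (f v)"
    using f by (auto simp: is_isomorphism_def bij_betw_def)
  have p: "u \<in> carrier L" if "u \<in> even_part L \<or> u \<in> odd_part L" for u
    using that L by (auto simp: parts_in_carrier_def)
  have z: "0 \<in> carrier L" using L by (simp add: carrier_closed_def)
  have zero: "f 0 = 0" using fadd[OF z z] by simp
  have nz: "f u \<noteq> 0" if "u \<in> carrier L" "u \<noteq> 0" for u
    using inj that z zero by (metis inj_onD)
  have soc: "f v \<in> odd_socle M" if "v \<in> odd_socle L" for v
    using that fb p zero unfolding odd_socle_def f1[symmetric] by (auto, metis)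
  have ann: "f ` even_annihilator L = even_annihilator M"
  proof (intro equalityI subsetI)
    fix v assume "v \<in> f ` even_annihilator L"
    then show "v \<in> even_annihilator M"
      using fb p zero unfolding even_annihilator_def f1[symmetric] f0[symmetric] by (auto, metis)
  next
    fix v assume v: "v \<in> even_annihilator M"
    then obtain u where u: "u \<in> even_part L" "v = f u" unfolding even_annihilator_def f0[symmetric] by blast
    have "bracket L u w = 0" if w: "w \<in> odd_part L" for w
    proof -
      have "f (bracket L u w) = 0" using v u w fb p f1 unfolding even_annihilator_def by auto
      moreover have "bracket L u w \<in> carrier L" using L p u w by (simp add: carrier_closed_def)
      ultimately show ?thesis using nz by blast
    qed
    then show "v \<in> f ` even_annihilator L" using u unfolding even_annihilator_def by blast
  qed
  have split: "split_vector M (f e)" if e: "split_vector L e" for e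
  proof -
    have ein: "e \<in> carrier L" using e p by (auto simp: split_vector_def even_annihilator_def)
    have "\<exists>r. bracket M w (f e) = scale M r (f e)" if w: "w \<in> even_annihilator M" for w
    proof -
      obtain w' where w': "w' \<in> even_annihilator L" "w = f w'" using w ann by blast
      then obtain r where "bracket L w' e = scale L r e" using e by (auto simp: split_vector_def)
      moreover have "w' \<in> carrier L" using w' p by (auto simp: even_annihilator_def)
      ultimately have "bracket M w (f e) = scale M r (f e)" using fb[of w' e] fs[of e r] ein w' by simp
      then show ?thesis ..
    qed
    then show ?thesis using e nz[OF ein] ann unfolding split_vector_def by blast
  qed
  show "weight_set L \<subseteq> weight_set M"
  proof
    fix x assume "x \<in> weight_set L"
    then obtain s t r u v e where x: "x = (s, t, r)" and u: "u \<in> even_part L" and v: "v \<in> odd_socle L" "v \<noteq> 0"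
      and e: "split_vector L e" and b: "bracket L v u = scale L s v" "bracket L e u = scale L t e" "bracket L u e = scale L r e"
      unfolding weight_set_def by blast
    have car: "u \<in> carrier L" "v \<in> carrier L" "e \<in> carrier L"
      using u v e p by (auto simp: odd_socle_def split_vector_def even_annihilator_def)
    have "bracket M (f v) (f u) = scale M s (f v)" "bracket M (f e) (f u) = scale M t (f e)"
      "bracket M (f u) (f e) = scale M r (f e)"
      using car b by (simp_all flip: fb add: fs)
    moreover have "f u \<in> even_part M" using u f0 by blast
    ultimately show "x \<in> weight_set M"
      using soc[OF v(1)] nz[OF car(2) v(2)] split[OF e] unfolding weight_set_def x by blast
  qed
  show "split_square M" if S: "split_square L"
  proof -
    obtain u where "u \<in> even_part L" "split_vector L (bracket L u u)" using S by (auto simp: split_square_def)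
    then show ?thesis using split fb[of u u] p f0 unfolding split_square_def by fastforce
  qed
qed

lemma invariants_eq:
  assumes "carrier_closed L" "parts_in_carrier L" "carrier_closed M" "parts_in_carrier M" and iso: "isomorphic L M"
  shows "weight_set L = weight_set M" and "split_square L \<longleftrightarrow> split_square M"
  using invariants_subset iso isomorphic_sym[OF assms(1,2) iso] assms(1-4)
  unfolding isomorphic_iff by (metis subset_antisym)+

locale extension_model =
  fixes n :: nat and D :: extension
  assumes n3: "3 \<le> n" and fin: "finite (gens D)"
begin

abbreviation A where "A \<equiv> extension_algebra n D"
abbreviation B where "B \<equiv> (E ` {1..n} \<union> X ` gens D) \<union> Y ` {1..n}"

lemma parts:
  "u \<in> even_part A \<longleftrightarrow> keys u \<subseteq> E ` {1..n} \<union> X ` gens D"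
  "u \<in> odd_part A \<longleftrightarrow> keys u \<subseteq> Y ` {1..n}"
  by (simp_all add: extension_algebra_def)

lemma scale_A [simp]: "scale A = smul"
  by (simp add: extension_algebra_def)

lemma closed_graded: "carrier_closed A" "parts_in_carrier A"
  unfolding extension_algebra_def
  by (intro carrier_closed_from_table parts_in_carrier_from_table keys_table n3; use fin in simp)+

lemma even_lookup:
  assumes "u \<in> even_part A"
  shows "lookup u (Y i) = 0" "i \<notin> {1..n} \<Longrightarrow> lookup u (E i) = 0"
    "k \<notin> gens D \<Longrightarrow> lookup u (X k) = 0"
  using assms unfolding parts keys_subset_iff by blast+

lemma odd_lookup:
  assumes "u \<in> odd_part A"
  shows "lookup u (E i) = 0" "i \<notin> {1..n} \<Longrightarrow> lookup u (Y i) = 0"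
    "lookup u (X k) = 0"
  using assms unfolding parts keys_subset_iff by blast+

definition tab :: table where
  "tab p q = nil_table n p q + extension_table n D p q"

lemma tab_simps:
  "tab (E i) (E 2) = 0" "tab (Y i) (E 2) = 0" "tab (X k) (E 2) = single (E 2) (left_weight D k)"
  "tab (E 2) (E j) = 0" "tab (E 2) (Y j) = 0" "tab (E 2) (X k) = single (E 2) (split_weight D k)"
  "tab (Y n) (E j) = 0" "tab (Y n) (Y j) = 0"
  "tab (Y n) (X k) = single (Y n) ((2 * of_nat n - 1) * chain_weight D k)"
  using n3 by (auto simp: tab_def)

lemma tab_lookup_E2:
  "lookup (tab (E i) (E j)) (E 2) = 0"
  "1 \<le> i \<Longrightarrow> lookup (tab (E i) (X k)) (E 2) = (if i = 2 then split_weight D k else 0)"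
  "lookup (tab (X k) (E j)) (E 2) = (if j = 2 then left_weight D k else 0)"
  "lookup (tab (X k) (X l)) (E 2) = square D k l"
  by (auto simp: tab_def lookup_add lookup_single when_def)

lemma lookup_bracket:
  "lookup (bracket A u v) r =
     (\<Sum>p \<in> B. \<Sum>q \<in> B.
        lookup u p * lookup v q * lookup (tab p q) r)"
  unfolding extension_algebra_def lookup_bracket_from_table tab_def ..

lemma lookup_bracket_right:
  "q \<in> B \<Longrightarrow> lookup (bracket A u (single q c)) r = c * (\<Sum>p \<in> B. lookup u p * lookup (tab p q) r)"
  and lookup_bracket_left:
  "q \<in> B \<Longrightarrow> lookup (bracket A (single q c) u) r = c * (\<Sum>p \<in> B. lookup u p * lookup (tab q p) r)"
  unfolding extension_algebra_def tab_def using fin by (simp_all add: lookup_bracket_single)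

lemma basis_mem: "E 2 \<in> B" "Y n \<in> B"
  using n3 by auto

lemma bracket_E2_right:
  "bracket A u (single (E 2) c)
     = single (E 2) (c * (\<Sum>k\<in>gens D. left_weight D k * lookup u (X k)))"
  by (rule poly_mapping_eqI, unfold lookup_bracket_right[OF basis_mem(1)] sum_basis[OF fin] tab_simps)
     (simp add: lookup_single when_def mult.commute)

lemma bracket_E2_left:
  "bracket A (single (E 2) c) u
     = single (E 2) (c * (\<Sum>k\<in>gens D. split_weight D k * lookup u (X k)))"
  by (rule poly_mapping_eqI, unfold lookup_bracket_left[OF basis_mem(1)] sum_basis[OF fin] tab_simps)
     (simp add: lookup_single when_def mult.commute)

lemma bracket_Yn:
  "bracket A (single (Y n) c) u
     = single (Y n) (c * ((2 * of_nat n - 1) * (\<Sum>k\<in>gens D. chain_weight D k * lookup u (X k))))"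
  by (rule poly_mapping_eqI, unfold lookup_bracket_left[OF basis_mem(2)] sum_basis[OF fin] tab_simps)
     (simp add: lookup_single when_def sum_distrib_left mult_ac)

lemma lookup_square_E2:
  assumes "u \<in> even_part A"
  shows "lookup (bracket A u u) (E 2) =
     lookup u (E 2) * (\<Sum>k\<in>gens D. (split_weight D k + left_weight D k) * lookup u (X k))
     + (\<Sum>k\<in>gens D. \<Sum>l\<in>gens D. square D k l * lookup u (X k) * lookup u (X l))"
proof -
  let ?c = "lookup u"
  have delta: "(\<Sum>i = 1..n. f i * (if i = 2 then g else 0)) = f 2 * g" for f :: "nat \<Rightarrow> complex" and g
    using n3 by (simp add: if_distrib[of "(*) _"] cong: if_cong)
  have "lookup (bracket A u u) (E 2) =
     (\<Sum>i = 1..n. \<Sum>l\<in>gens D. ?c (E i) * ?c (X l) * (if i = 2 then split_weight D l else 0))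
     + (\<Sum>k\<in>gens D. (\<Sum>j = 1..n. ?c (X k) * ?c (E j) * (if j = 2 then left_weight D k else 0))
          + (\<Sum>l\<in>gens D. ?c (X k) * ?c (X l) * square D k l))"
  proof -
    have "?c (E i) * ?c (X l) * lookup (tab (E i) (X l)) (E 2)
        = ?c (E i) * ?c (X l) * (if i = 2 then split_weight D l else 0)" for i l
      using even_lookup(2)[OF assms, of i] tab_lookup_E2(2)[of i l] by (cases "1 \<le> i") auto
    note EX = this
    show ?thesis
      unfolding lookup_bracket sum_basis[OF fin] even_lookup(1)[OF assms] EX tab_lookup_E2(1,3,4) by simp
  qed
  also have "(\<Sum>i = 1..n. \<Sum>l\<in>gens D. ?c (E i) * ?c (X l) * (if i = 2 then split_weight D l else 0))
    = (\<Sum>l\<in>gens D. ?c (E 2) * ?c (X l) * split_weight D l)"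
    by (subst sum.swap) (simp only: delta)
  also have "(\<Sum>k\<in>gens D. (\<Sum>j = 1..n. ?c (X k) * ?c (E j) * (if j = 2 then left_weight D k else 0))
          + (\<Sum>l\<in>gens D. ?c (X k) * ?c (X l) * square D k l))
     = (\<Sum>k\<in>gens D. ?c (X k) * ?c (E 2) * left_weight D k + (\<Sum>l\<in>gens D. ?c (X k) * ?c (X l) * square D k l))"
    by (simp only: delta)
  finally show ?thesis
    by (simp add: sum.distrib sum_distrib_left algebra_simps)
qed

lemma odd_socle_eq: "odd_socle A = range (single (Y n))"
proof (intro equalityI subsetI)
  fix v assume v: "v \<in> odd_socle A"
  then have odd: "v \<in> odd_part A" by (simp add: odd_socle_def)
  have "single (Y 1) 1 \<in> odd_part A" using n3 by (auto simp: parts)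
  then have "bracket A v (single (Y 1) 1) = 0" using v by (simp add: odd_socle_def)
  then have 0: "lookup (bracket A v (single (Y 1) 1)) r = 0" for r
    by simp
  have "lookup v (Y i) = 0" if i: "i < n" for i
  proof -
    consider "i = 0" | "i = 1" | "2 \<le> i" by linarith
    then show ?thesis
    proof cases
      case 1
      then show ?thesis using odd_lookup(2)[OF odd] by simp
    next
      case 2
      then show ?thesis using 0[of "E 1"] unfolding lookup_bracket_Y1[OF n3 fin] by simp
    next
      case 3
      then show ?thesis using 0[of "E (i + 1)"] i unfolding lookup_bracket_Y1[OF n3 fin] by simp
    qed
  qed
  moreover have "lookup v (Y i) = 0" if "n < i" for i
    using odd_lookup(2)[OF odd, of i] that by simp
  ultimately have "lookup v (Y i) = 0" if "i \<noteq> n" for i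
    using that by (meson nat_neq_iff)
  then have "lookup v p = lookup (single (Y n) (lookup v (Y n))) p" for p
    using odd_lookup(1,3)[OF odd] by (cases p) (auto simp: lookup_single when_def)
  then have "v = single (Y n) (lookup v (Y n))" by (rule poly_mapping_eqI)
  then show "v \<in> range (single (Y n))" by blast
next
  fix v assume "v \<in> range (single (Y n) :: complex \<Rightarrow> vec)"
  then obtain c where c: "v = single (Y n) c" by blast
  have "bracket A v w = 0" if "w \<in> odd_part A" for w
    unfolding c bracket_Yn using odd_lookup(3)[OF that] by simp
  then show "v \<in> odd_socle A" using n3 by (auto simp: odd_socle_def parts c)
qed

lemma E2_even_annihilator: "single (E 2) c \<in> even_annihilator A"
  unfolding even_annihilator_def using n3 odd_lookup(3)
  by (auto simp: parts bracket_E2_left)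

lemma even_annihilator_lookup:
  assumes v: "v \<in> even_annihilator A"
  shows "i \<noteq> 2 \<Longrightarrow> lookup v (E i) = 0"
    and "(\<Sum>k\<in>gens D. chain_weight D k * lookup v (X k)) = 0"
proof -
  have even: "v \<in> even_part A" using v by (simp add: even_annihilator_def)
  have "single (Y 1) 1 \<in> odd_part A" using n3 by (auto simp: parts)
  then have "bracket A v (single (Y 1) 1) = 0" using v by (simp add: even_annihilator_def)
  then have 0: "lookup (bracket A v (single (Y 1) 1)) r = 0" for r
    by simp
  show "(\<Sum>k\<in>gens D. chain_weight D k * lookup v (X k)) = 0"
    using 0[of "Y 1"] unfolding lookup_bracket_Y1[OF n3 fin] by simp
  show "lookup v (E i) = 0" if "i \<noteq> 2"
  proof (cases "i \<in> {1..n}")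
    case True
    then show ?thesis
      using that 0[of "Y (if i = 1 then 2 else i)"] n3 unfolding lookup_bracket_Y1[OF n3 fin] by (auto split: if_splits)
  qed (use even_lookup(2)[OF even] in simp)
qed

end

text \<open>Faithfulness means that no combination of the $x_k$ has both weights zero, as in the classification.\<close>

locale faithful_extension_model = extension_model +
  assumes faithful: "\<And>c. (\<Sum>k\<in>gens D. chain_weight D k * c k) = 0 \<Longrightarrow> (\<Sum>k\<in>gens D. split_weight D k * c k) = 0
      \<Longrightarrow> \<forall>k\<in>gens D. c k = 0"
begin

text \<open>A split vector $v$ has weight $\alpha=0$ since it annihilates $y_1$. Moreover $[e_2,v]=\beta(v)e_2$ must be a
multiple of $v$; if $\beta(v)\ne0$, then $v$ would be a multiple of $e_2$, whose weights are zero. So both weights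
vanish, and faithfulness leaves only multiples of $e_2$.\<close>

lemma split_vector_iff: "split_vector A e \<longleftrightarrow> (\<exists>c. c \<noteq> 0 \<and> e = single (E 2) c)"
proof
  assume e: "split_vector A e"
  then have ann: "e \<in> even_annihilator A" and nz: "e \<noteq> 0" by (auto simp: split_vector_def)
  then have even: "e \<in> even_part A" by (simp add: even_annihilator_def)
  let ?s = "\<Sum>k\<in>gens D. split_weight D k * lookup e (X k)"
  obtain r where "bracket A (single (E 2) 1) e = smul r e"
    using e E2_even_annihilator[of 1] unfolding split_vector_def by auto
  then have eq: "single (E 2) ?s = smul r e" by (simp add: bracket_E2_left)
  have "r * lookup e (X k) = 0" for k
    using arg_cong[OF eq, of "\<lambda>w. lookup w (X k)"] by (simp add: lookup_single)
  then have "r = 0 \<or> (\<forall>k. lookup e (X k) = 0)" by auto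
  then have "?s = 0"
    using arg_cong[OF eq, of "\<lambda>w. lookup w (E 2)"] by auto
  then have "\<forall>k\<in>gens D. lookup e (X k) = 0"
    using even_annihilator_lookup(2)[OF ann] faithful[of "\<lambda>k. lookup e (X k)"] by simp
  then have "lookup e p = lookup (single (E 2) (lookup e (E 2))) p" for p
    using even_annihilator_lookup(1)[OF ann] even_lookup[OF even]
    by (cases p) (auto simp: lookup_single when_def)
  then have "e = single (E 2) (lookup e (E 2))" by (rule poly_mapping_eqI)
  then show "\<exists>c. c \<noteq> 0 \<and> e = single (E 2) c" using nz by (metis single_zero)
next
  assume "\<exists>c. c \<noteq> 0 \<and> e = single (E 2) c"
  then obtain c where c: "c \<noteq> 0" "e = single (E 2) c" by blast
  have "lookup e (E 2) \<noteq> 0" using c by simp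
  then have "e \<noteq> 0" by auto
  moreover have "\<exists>r. bracket A w e = smul r e" for w
    by (intro exI[of _ "\<Sum>k\<in>gens D. left_weight D k * lookup w (X k)"])
       (simp add: c bracket_E2_right mult.commute)
  ultimately show "split_vector A e"
    using E2_even_annihilator[of c] unfolding split_vector_def by (simp add: c(2))
qed

lemma weight_set_iff:
  "(s, t, r) \<in> weight_set A \<longleftrightarrow> (\<exists>c. s = (2 * of_nat n - 1) * (\<Sum>k\<in>gens D. chain_weight D k * c k) \<and>
     t = (\<Sum>k\<in>gens D. split_weight D k * c k) \<and> r = (\<Sum>k\<in>gens D. left_weight D k * c k))"
proof
  assume "(s, t, r) \<in> weight_set A"
  then obtain u v e where "u \<in> even_part A" "v \<in> odd_socle A" "v \<noteq> 0" "split_vector A e"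
     "bracket A v u = smul s v" "bracket A e u = smul t e" "bracket A u e = smul r e"
    unfolding weight_set_def by auto
  note asm = this
  obtain a where a: "v = single (Y n) a" using asm(2) unfolding odd_socle_eq by blast
  then have "a \<noteq> 0" using asm(3) by auto
  obtain c where c: "c \<noteq> 0" "e = single (E 2) c" using asm(4) unfolding split_vector_iff by blast
  have single_inj: "single p x = single p x' \<Longrightarrow> x = x'" for p :: gen and x x' :: complex
    by (metis lookup_single_eq)
  define g where "g k = lookup u (X k)" for k
  have "a * ((2 * of_nat n - 1) * (\<Sum>k\<in>gens D. chain_weight D k * g k)) = s * a"
    using asm(5) unfolding a bracket_Yn smul_single g_def by (rule single_inj)
  moreover have "c * (\<Sum>k\<in>gens D. split_weight D k * g k) = t * c"
    using asm(6) unfolding c(2) bracket_E2_left smul_single g_def by (rule single_inj)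
  moreover have "c * (\<Sum>k\<in>gens D. left_weight D k * g k) = r * c"
    using asm(7) unfolding c(2) bracket_E2_right smul_single g_def by (rule single_inj)
  ultimately show "\<exists>c. s = (2 * of_nat n - 1) * (\<Sum>k\<in>gens D. chain_weight D k * c k) \<and>
     t = (\<Sum>k\<in>gens D. split_weight D k * c k) \<and> r = (\<Sum>k\<in>gens D. left_weight D k * c k)"
    using \<open>a \<noteq> 0\<close> c(1) by (intro exI[of _ g]) (metis mult.commute mult_left_cancel)
next
  assume "\<exists>c. s = (2 * of_nat n - 1) * (\<Sum>k\<in>gens D. chain_weight D k * c k) \<and>
     t = (\<Sum>k\<in>gens D. split_weight D k * c k) \<and> r = (\<Sum>k\<in>gens D. left_weight D k * c k)"
  then obtain c where c: "s = (2 * of_nat n - 1) * (\<Sum>k\<in>gens D. chain_weight D k * c k)"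
     "t = (\<Sum>k\<in>gens D. split_weight D k * c k)" "r = (\<Sum>k\<in>gens D. left_weight D k * c k)" by blast
  define u where "u = (\<Sum>k\<in>gens D. single (X k) (c k))"
  have l: "lookup u (X k) = (if k \<in> gens D then c k else 0)"
    "lookup u (E k) = 0" "lookup u (Y k) = 0" for k
    using fin by (auto simp: u_def lookup_sum lookup_single when_def)
  have "u \<in> even_part A"
    unfolding parts keys_subset_iff
  proof (intro allI impI)
    fix p assume "p \<notin> E ` {1..n} \<union> X ` gens D"
    then show "lookup u p = 0" by (cases p) (auto simp: l)
  qed
  moreover have "single (Y n) (1 :: complex) \<noteq> 0" "single (E 2) (1 :: complex) \<noteq> 0"
    by (metis lookup_single_eq lookup_zero one_neq_zero)+
  moreover have "single (Y n) 1 \<in> odd_socle A" unfolding odd_socle_eq by blast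
  moreover have "split_vector A (single (E 2) 1)" unfolding split_vector_iff by (intro exI[of _ 1]) simp
  moreover have "bracket A (single (Y n) 1) u = smul s (single (Y n) 1)"
    "bracket A (single (E 2) 1) u = smul t (single (E 2) 1)"
    "bracket A u (single (E 2) 1) = smul r (single (E 2) 1)"
    by (simp_all add: bracket_Yn bracket_E2_left bracket_E2_right c l cong: sum.cong)
  ultimately show "(s, t, r) \<in> weight_set A"
    unfolding weight_set_def mem_Collect_eq prod.case scale_A by blast
qed

end

lemma faithful_model:
  assumes "n \<ge> 3"
  shows "faithful_extension_model n (data_of m a)"
proof unfold_locales
  show "finite (gens (data_of m a))" by (rule finite_gens)
  show "\<forall>k\<in>gens (data_of m a). c k = 0"
    if "(\<Sum>k\<in>gens (data_of m a). chain_weight (data_of m a) k * c k) = 0"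
      "(\<Sum>k\<in>gens (data_of m a). split_weight (data_of m a) k * c k) = 0" for c
    using that by (cases m) auto
qed (rule assms)

text \<open>The equations of the set of triples for each name, with $d=2n-1$.\<close>

fun name_weights :: "complex \<Rightarrow> name \<Rightarrow> complex \<Rightarrow> complex \<Rightarrow> complex \<Rightarrow> bool" where
  "name_weights d MH1 s t r \<longleftrightarrow> r = 0"
| "name_weights d MH2 s t r \<longleftrightarrow> r = - t"
| "name_weights d (H1 b) s t r \<longleftrightarrow> d * t = b * s \<and> r = - t"
| "name_weights d (H2 b) s t r \<longleftrightarrow> d * t = b * s \<and> r = 0"
| "name_weights d H3 s t r \<longleftrightarrow> t = 0 \<and> r = 0"
| "name_weights d H4 s t r \<longleftrightarrow> s = 0 \<and> r = 0"
| "name_weights d (H5 \<gamma>) s t r \<longleftrightarrow> s = 0 \<and> r = - t"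

lemma weight_set_model:
  assumes n: "n \<ge> 3"
  shows "(s, t, r) \<in> weight_set (model n m a) \<longleftrightarrow> name_weights (2 * of_nat n - 1) m s t r"
proof -
  interpret faithful_extension_model n "data_of m a" using n by (rule faithful_model)
  have "2 * complex_of_nat n \<noteq> 1"
    by (metis even_mult_iff even_numeral odd_one of_nat_1 of_nat_eq_iff of_nat_mult of_nat_numeral)
  define d where "d = 2 * complex_of_nat n - 1"
  then have d0: "d \<noteq> 0" using \<open>2 * complex_of_nat n \<noteq> 1\<close> by simp
  let ?D = "data_of m a"
  let ?weights = "\<exists>c. s = (d) * (\<Sum>k\<in>gens ?D. chain_weight ?D k * c k) \<and>
     t = (\<Sum>k\<in>gens ?D. split_weight ?D k * c k) \<and> r = (\<Sum>k\<in>gens ?D. left_weight ?D k * c k)"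
  have "?weights \<longleftrightarrow> name_weights (d) m s t r"
  proof (cases m)
    case MH1
    then show "?weights \<longleftrightarrow> name_weights (d) m s t r"
      using d0 by (auto intro!: exI[of _ "\<lambda>k. if k = 1 then s / (d) else t"])
  next
    case MH2
    then show "?weights \<longleftrightarrow> name_weights (d) m s t r"
      using d0 by (auto intro!: exI[of _ "\<lambda>k. if k = 1 then s / (d) else t"])
  next
    case (H1 b)
    then show "?weights \<longleftrightarrow> name_weights (d) m s t r"
      using d0 by (auto simp: field_simps intro!: exI[of _ "\<lambda>_. s / (d)"])
  next
    case (H2 b)
    then show "?weights \<longleftrightarrow> name_weights (d) m s t r"
      using d0 by (auto simp: field_simps intro!: exI[of _ "\<lambda>_. s / (d)"])
  next
    case H3
    then show "?weights \<longleftrightarrow> name_weights (d) m s t r"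
      using d0 by (auto intro!: exI[of _ "\<lambda>_. s / (d)"])
  next
    case H4
    then show "?weights \<longleftrightarrow> name_weights (d) m s t r"
      by (auto intro!: exI[of _ "\<lambda>_. t"])
  next
    case (H5 \<gamma>)
    then show "?weights \<longleftrightarrow> name_weights (d) m s t r"
      by (auto intro!: exI[of _ "\<lambda>_. t"])
  qed
  then show ?thesis unfolding model_eq weight_set_iff d_def .
qed

text \<open>For an even $u$ the $e_2$-coefficient of $[u,u]$ is the sum of the term with $\beta+\varepsilon$, which is zero
for these names, and of the squares of the generators.\<close>

lemma split_square_model:
  assumes n: "n \<ge> 3" and m: "m \<in> {H2 0, H3, H5 0, H5 1}"
  shows "split_square (model n m a) \<longleftrightarrow> m \<in> {H3, H5 1}"
proof -
  interpret faithful_extension_model n "data_of m a" using n by (rule faithful_model)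
  show ?thesis
  proof (cases "m \<in> {H3, H5 1}")
    case True
    let ?u = "single (X 1) 1 :: vec"
    have "X 1 \<in> B" using True by auto
    note br = lookup_bracket_left[OF this]
    have "bracket A ?u ?u = single (E 2) 1"
      by (rule poly_mapping_eqI, unfold br sum_basis[OF fin])
         (use True in \<open>auto simp: lookup_single tab_def\<close>)
    then have "split_vector A (bracket A ?u ?u)" unfolding split_vector_iff by (intro exI[of _ 1]) simp
    moreover have "?u \<in> even_part A" using True by (auto simp: parts)
    ultimately show ?thesis using True unfolding model_eq split_square_def by blast
  next
    case False
    have "lookup (bracket A u u) (E 2) = 0" if "u \<in> even_part A" for u
      unfolding lookup_square_E2[OF that] using False m by auto
    then have "\<not> split_vector A (bracket A u u)" if "u \<in> even_part A" for u
      using that unfolding split_vector_iff by force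
    then show ?thesis using False unfolding model_eq split_square_def by blast
  qed
qed

text \<open>The triples $(0,1,0)$, $(0,1,-1)$, $(d,0,0)$, $(d,b,0)$ and $(d,b,-b)$ suffice to distinguish any two of the
sets, apart from the two pairs with equal sets.\<close>

lemma models_not_isomorphic:
  assumes n: "n \<ge> 3" and adm: "admissible m" "admissible m'" and ne: "m \<noteq> m'"
  shows "\<not> isomorphic (model n m a) (model n m' a')"
proof
  assume iso: "isomorphic (model n m a) (model n m' a')"
  interpret M: faithful_extension_model n "data_of m a" using n by (rule faithful_model)
  interpret M': faithful_extension_model n "data_of m' a'" using n by (rule faithful_model)
  note inv = invariants_eq[OF M.closed_graded M'.closed_graded iso[unfolded model_eq], folded model_eq]
  define d where "d = 2 * complex_of_nat n - 1"
  have "2 * complex_of_nat n \<noteq> 1"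
    by (metis even_mult_iff even_numeral odd_one of_nat_1 of_nat_eq_iff of_nat_mult of_nat_numeral)
  then have d: "d \<noteq> 0" by (simp add: d_def)
  have w: "name_weights d m s t r \<longleftrightarrow> name_weights d m' s t r" for s t r
    unfolding d_def weight_set_model[OF n, symmetric, where m = m and a = a]
      weight_set_model[OF n, symmetric, where m = m' and a = a'] inv(1) ..
  have cases: "(m \<in> {H2 0, H3} \<and> m' \<in> {H2 0, H3}) \<or> (m \<in> {H5 0, H5 1} \<and> m' \<in> {H5 0, H5 1})"
    using w[of 0 1 0] w[of 0 1 "- 1"] w[of d 0 0] w[of d "case m of H1 b \<Rightarrow> b | H2 b \<Rightarrow> b | _ \<Rightarrow> 0" 0]
      w[of d "case m of H1 b \<Rightarrow> b | H2 b \<Rightarrow> b | _ \<Rightarrow> 0" "- (case m of H1 b \<Rightarrow> b | H2 b \<Rightarrow> b | _ \<Rightarrow> 0)"]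
      w[of d "case m' of H1 b \<Rightarrow> b | H2 b \<Rightarrow> b | _ \<Rightarrow> 0" 0]
      w[of d "case m' of H1 b \<Rightarrow> b | H2 b \<Rightarrow> b | _ \<Rightarrow> 0" "- (case m' of H1 b \<Rightarrow> b | H2 b \<Rightarrow> b | _ \<Rightarrow> 0)"]
      adm ne d
    by (cases m; cases m') auto
  then have "m \<in> {H2 0, H3, H5 0, H5 1}" "m' \<in> {H2 0, H3, H5 0, H5 1}" by auto
  then have "m \<in> {H3, H5 1} \<longleftrightarrow> m' \<in> {H3, H5 1}"
    using split_square_model[OF n] inv(2) by blast
  then show False using cases ne by auto
qed

section \<open>Rescaling the shift parameters\<close>

lemma isomorphic_rescale:
  assumes fin: "finite B0" "finite B1" and dis: "B0 \<inter> B1 = {}"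
    and T: "\<And>p q. p \<in> B0 \<union> B1 \<Longrightarrow> q \<in> B0 \<union> B1 \<Longrightarrow> keys (T p q) \<subseteq> B0 \<union> B1"
    and T': "\<And>p q. p \<in> B0 \<union> B1 \<Longrightarrow> q \<in> B0 \<union> B1 \<Longrightarrow> keys (T' p q) \<subseteq> B0 \<union> B1"
    and w: "\<And>p. w p \<noteq> 0"
    and eq: "\<And>p q r. p \<in> B0 \<union> B1 \<Longrightarrow> q \<in> B0 \<union> B1 \<Longrightarrow>
        w p * w q * lookup (T p q) r = w r * lookup (T' p q) r"
  shows "isomorphic (from_table B0 B1 T) (from_table B0 B1 T')"
proof -
  let ?L = "from_table B0 B1 T"
  define b :: "gen \<Rightarrow> vec" where "b p = single p (w p)" for p
  have finB: "finite (B0 \<union> B1)" using fin by simp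
  have l: "lookup (\<Sum>p\<in>A. smul (c p) (b p)) r = (if r \<in> A then c r * w r else 0)"
    if "finite A" for A c r
    using that by (simp add: b_def lookup_sum lookup_single when_def)
  have range: "{u :: vec. keys u \<subseteq> A} = range (\<lambda>c. \<Sum>p\<in>A. smul (c p) (b p))"
    if A: "finite A" for A
  proof (intro equalityI subsetI)
    fix u :: vec assume "u \<in> {u. keys u \<subseteq> A}"
    then have "u = (\<Sum>p\<in>A. smul (lookup u p / w p) (b p))"
      using A w by (intro poly_mapping_eqI) (auto simp: l keys_subset_iff)
    then show "u \<in> range (\<lambda>c. \<Sum>p\<in>A. smul (c p) (b p))" by (intro range_eqI)
  next
    fix u assume "u \<in> range (\<lambda>c. \<Sum>p\<in>A. smul (c p) (b p))"
    then show "u \<in> {u. keys u \<subseteq> A}"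
      using A by (auto simp: keys_subset_iff l)
  qed
  show ?thesis
  proof (rule isomorphic_from_table[of ?L B0 B1 T' b])
    show "vector_space (scale ?L)" by (simp add: vector_space_smul)
    show "bilinear ?L" by (rule bilinear_from_table)
    show "even_part ?L = range (\<lambda>c. \<Sum>p\<in>B0. scale ?L (c p) (b p))"
      "odd_part ?L = range (\<lambda>c. \<Sum>p\<in>B1. scale ?L (c p) (b p))"
      using range fin by (simp_all add: from_table_def)
  next
    fix c assume "(\<Sum>p\<in>B0 \<union> B1. scale ?L (c p) (b p)) = 0"
    then have "(if r \<in> B0 \<union> B1 then c r * w r else 0) = 0" for r
      using l[OF finB, of c r] by simp
    then show "\<forall>p\<in>B0 \<union> B1. c p = 0" using w by (metis mult_eq_0_iff)
  next
    fix p q assume pq: "p \<in> B0 \<union> B1" "q \<in> B0 \<union> B1"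
    show "bracket ?L (b p) (b q) = (\<Sum>r\<in>B0 \<union> B1. scale ?L (lookup (T' p q) r) (b r))"
    proof (rule poly_mapping_eqI)
      fix r
      have "lookup (bracket ?L (b p) (b q)) r
          = (\<Sum>p'\<in>B0 \<union> B1. \<Sum>q'\<in>B0 \<union> B1. if q' = q then (if p' = p then w p * w q * lookup (T p q) r else 0) else 0)"
        unfolding lookup_bracket_from_table by (intro sum.cong refl) (auto simp: b_def lookup_single when_def)
      also have "\<dots> = w p * w q * lookup (T p q) r"
        using pq finB by (simp add: sum.delta del: Un_iff)
      also have "\<dots> = w r * lookup (T' p q) r" by (rule eq[OF pq])
      also have "\<dots> = (if r \<in> B0 \<union> B1 then lookup (T' p q) r * w r else 0)"
        using T'[OF pq] by (auto simp: keys_subset_iff)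
      finally show "lookup (bracket ?L (b p) (b q)) r
          = lookup (\<Sum>r\<in>B0 \<union> B1. scale ?L (lookup (T' p q) r) (b r)) r"
        using l[OF finB] by simp
    qed
  qed (use fin dis T' in auto)
qed

lemma complex_root_exists:
  fixes z :: complex
  assumes "k > 0"
  obtains t where "t ^ k = z"
proof -
  have "rcis (root k (cmod z)) (Arg z / of_nat k) ^ k = z"
    using assms by (simp add: DeMoivre2 rcis_cmod_Arg)
  then show ?thesis using that by blast
qed

text \<open>The factor of $e_i$ for $i\ge3$ under the rescaling by $t$; that of $y_i$ is $t$ times it, and the parameter
$a_i$ gets divided by it.\<close>

definition even_power :: "complex \<Rightarrow> nat \<Rightarrow> complex" where
  "even_power t i = t ^ (2 * (i - 1))"

lemma even_power_simps:
  "even_power t (Suc 0) = 1" "even_power t 2 = t * t" "even_power t 3 = t * t * (t * t)"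
  "1 \<le> i \<Longrightarrow> even_power t (Suc i) = t * t * even_power t i"
proof -
  show "even_power t (Suc 0) = 1" "even_power t 2 = t * t" "even_power t 3 = t * t * (t * t)"
    by (simp_all add: even_power_def power2_eq_square power4_eq_xxxx mult.assoc)
  show "1 \<le> i \<Longrightarrow> even_power t (Suc i) = t * t * even_power t i"
    by (cases i) (simp_all add: even_power_def)
qed

lemma even_power_add:
  assumes "1 \<le> i" "i \<le> j"
  shows "even_power t j = even_power t i * even_power t (j + 1 - i)"
proof -
  have "2 * (j - 1) = 2 * (i - 1) + 2 * (j + 1 - i - 1)" using assms by simp
  then show ?thesis unfolding even_power_def by (metis power_add)
qed

lemma even_power_nonzero: "t \<noteq> 0 \<Longrightarrow> even_power t i \<noteq> 0"
  by (simp add: even_power_def)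

fun grading_weight :: "complex \<Rightarrow> gen \<Rightarrow> complex" where
  "grading_weight t (E i) = (if i = 1 then t * t else if i = 2 then 1 else even_power t i)"
| "grading_weight t (Y i) = even_power t i * t"
| "grading_weight t (X k) = 1"

lemma nil_table_homogeneous:
  "grading_weight t p * grading_weight t q * lookup (nil_table n p q) r
     = grading_weight t r * lookup (nil_table n p q) r"
  by (cases p; cases q) (auto simp: lookup_single when_def even_power_simps)

text \<open>Passing from index $i$ to $j$ in the chain multiplies the scaling factor by $t^{2(j-i)}$, and the parameter
involved is $a_{j+1-i}$; here $e_1$ counts as having index $2$.\<close>

lemma shift_homogeneous:
  assumes t: "t \<noteq> 0" and D: "chain_weight D k = 0" "chain_weight D' k = 0"
    "split_weight D' k = split_weight D k"
    and D': "\<And>j. shift D' k j = shift D k j / even_power t j"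
    and p: "p \<in> E ` {1..n} \<union> Y ` {1..n}"
  shows "grading_weight t p * lookup (extension_table n D p (X k)) r
     = grading_weight t r * lookup (extension_table n D' p (X k)) r"
proof -
  note nz = even_power_nonzero[OF t]
  show ?thesis
  proof (cases p)
    case (Y i)
    then have i: "1 \<le> i" using p by auto
    show ?thesis
    proof (cases r)
      case (Y j)
      then show ?thesis using \<open>p = Y i\<close> nz even_power_add[OF i, of j t] by (simp add: D D')
    qed (use Y in \<open>simp_all add: D D'\<close>)
  next
    case (E i)
    then have i: "1 \<le> i" using p by auto
    show ?thesis
    proof (cases r)
      case r: (E j)
      consider "i = 1" | "i = 2" | "3 \<le> i" using i by linarith
      then show ?thesis
      proof cases
        case 1
        then show ?thesis
          using E r nz even_power_add[of 2 j t] by (auto simp: D D' even_power_simps)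
      next
        case 2
        then show ?thesis using E r by (auto simp: D lookup_single when_def)
      next
        case 3
        then show ?thesis using E r nz even_power_add[OF i, of j t] by (simp add: D D')
      qed
    qed (use E in \<open>auto simp: D D' lookup_single when_def\<close>)
  qed (use p in auto)
qed

lemma rescale_shift:
  assumes n: "n \<ge> 3" and m: "m \<in> {H4, H5 0, H5 1}" and t: "t \<noteq> 0"
  shows "isomorphic (model n m a) (model n m (\<lambda>k. a k / even_power t k))"
proof -
  let ?a = "\<lambda>k. a k / even_power t k"
  have g: "gens (data_of m a) = {1}" "gens (data_of m ?a) = {1}" using m by auto
  let ?B0 = "E ` {1..n} \<union> X ` {1}" and ?B1 = "Y ` {1..n}"
  show ?thesis
    unfolding model_eq extension_algebra_def g
  proof (rule isomorphic_rescale[where w = "grading_weight t"])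
    show "grading_weight t p \<noteq> 0" for p using even_power_nonzero[OF t] t by (cases p) auto
  next
    fix p q r assume pq: "p \<in> ?B0 \<union> ?B1" "q \<in> ?B0 \<union> ?B1"
    have "grading_weight t p * grading_weight t q * lookup (extension_table n (data_of m a) p q) r
        = grading_weight t r * lookup (extension_table n (data_of m ?a) p q) r"
    proof (cases q)
      case (X k)
      show ?thesis
      proof (cases "p \<in> E ` {1..n} \<union> Y ` {1..n}")
        case True
        then show ?thesis
          using shift_homogeneous[OF t _ _ _ _ True, of "data_of m a" k "data_of m ?a" r] m by (auto simp: X)
      next
        case False
        then show ?thesis using pq m by (auto simp: X lookup_single when_def)
      qed
    qed (use pq m in \<open>cases p; auto simp: lookup_single when_def\<close>)+
    then show "grading_weight t p * grading_weight t q * lookup (nil_table n p q + extension_table n (data_of m a) p q) r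
        = grading_weight t r * lookup (nil_table n p q + extension_table n (data_of m ?a) p q) r"
      using nil_table_homogeneous[of t p q n r] by (simp add: lookup_add distrib_left)
    show "keys (nil_table n p q + extension_table n (data_of m a) p q) \<subseteq> ?B0 \<union> ?B1"
      "keys (nil_table n p q + extension_table n (data_of m ?a) p q) \<subseteq> ?B0 \<union> ?B1"
      using keys_table[OF n pq] by blast+
  qed auto
qed

lemma rescale_to_one:
  assumes n: "n \<ge> 3" and m: "m \<in> {H4, H5 0, H5 1}" and k: "2 \<le> k" and nz: "a k \<noteq> 0"
  obtains a' where "a' k = 1" "\<And>j. a j = 0 \<Longrightarrow> a' j = 0" "isomorphic (model n m a) (model n m a')"
proof -
  obtain t where t: "t ^ (2 * (k - 1)) = a k" using complex_root_exists[of "2 * (k - 1)"] k by auto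
  then have "t \<noteq> 0" using nz k by (auto simp: power_0_left)
  then show ?thesis
    using that[of "\<lambda>j. a j / even_power t j"] rescale_shift[OF n m] nz t by (simp add: even_power_def)
qed

theorem theorem4p12:
  fixes n :: nat
  assumes "n \<ge> 3"
  shows "(\<forall>L :: ('a::ab_group_add) superalgebra.
            leibniz_superalgebra L \<and> finite_dimensional L \<and> \<not> nilpotent L \<and> solvable L \<and>
            (\<exists>N. is_nilradical L N \<and> isomorphic (restrict L N) (H_zero n))
            \<longrightarrow> (\<exists>m a. admissible m \<and> isomorphic L (model n m a)))
       \<and> (\<forall>m m' a a'. admissible m \<and> admissible m' \<and> m \<noteq> m'
            \<longrightarrow> \<not> isomorphic (model n m a) (model n m' a'))
       \<and> (\<forall>m \<in> {H4, H5 0, H5 1}. \<forall>a. \<forall>k \<in> {2..n}.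
            a k \<noteq> 0 \<and> (\<forall>j \<in> {2..<k}. a j = 0)
            \<longrightarrow> (\<exists>a'. a' k = 1 \<and> (\<forall>j \<in> {2..<k}. a' j = 0) \<and>
                  isomorphic (model n m a) (model n m a')))"
proof (intro conjI allI impI ballI)
  fix L :: "'a superalgebra"
  assume "leibniz_superalgebra L \<and> finite_dimensional L \<and> \<not> nilpotent L \<and> solvable L \<and>
            (\<exists>N. is_nilradical L N \<and> isomorphic (restrict L N) (H_zero n))"
  then show "\<exists>m a. admissible m \<and> isomorphic L (model n m a)"
    using extension_is_model[OF assms] by blast
next
  fix m m' a a' assume "admissible m \<and> admissible m' \<and> m \<noteq> m'"
  then show "\<not> isomorphic (model n m a) (model n m' a')"
    using models_not_isomorphic[OF assms] by blast
next
  fix m and a :: "nat \<Rightarrow> complex" and k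
  assume m: "m \<in> {H4, H5 0, H5 1}" and k: "k \<in> {2..n}" and a: "a k \<noteq> 0 \<and> (\<forall>j \<in> {2..<k}. a j = 0)"
  then obtain a' where "a' k = 1" "\<And>j. a j = 0 \<Longrightarrow> a' j = 0" "isomorphic (model n m a) (model n m a')"
    using rescale_to_one[OF assms m, of k a] by auto
  then show "\<exists>a'. a' k = 1 \<and> (\<forall>j \<in> {2..<k}. a' j = 0) \<and> isomorphic (model n m a) (model n m a')"
    using a by blast
qed

end
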